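(* For $n\ge 1$ let $F_n$ be the fan graph and $S_n$ the square of the path on $n$ vertices, for $n\ge 3$ let $W_n$ be the wheel graph and $W^n$ the whirl matroid (all defined in the context), and write $P_G(t)=P_{M(G)}(t)$ for the Kazhdan–Lusztig polynomial of the graphic matroid of a graph $G$. Then \[ P_{F_n}(t)=\sum_{k=0}^{\lfloor \frac{n-1}{2}\rfloor} \frac{1}{k+1}\binom{n-1}{k,k,n-2k-1} t^k \quad (n\ge 1), \] \[ P_{S_n}(t)=\sum_{k=0}^{\lfloor \frac{n-1}{2}\rfloor} \frac{1}{k+1}\binom{n-1}{k,k,n-2k-1} t^k \quad (n\ge 1), \] \[ P_{W_n}(t)=\sum_{k=0}^{\lfloor \frac{n-1}{2}\rfloor} \left(\frac{k+1}{n-k} +\frac{k}{n-k+1}-\frac{k}{n-k-1} \right)\binom{n}{k,k+1,n-2k-1}t^{k} \quad (n\ge 3), \] \[ P_{W^n}(t)=\sum _{k=0}^{\lfloor \frac{n-1}{2}\rfloor }\frac{n}{n-k}\binom{n-1}{k, k, n-2k-1} t^k \quad (n\ge 3), \] where $\binom{a}{b,c,d}=\frac{a!}{b!\,c!\,d!}$ denotes a multinomial coefficient and $\lfloor x\rfloor$ the largest integer not exceeding $x$.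
   Context: For a matroid $M$ let $L(M)$ be its lattice of flats, $\mathrm{rk}\, M$ its rank and $\chi_M(t)$ its characteristic polynomial. For a flat $F$, $M_F$ is the localization of $M$ at $F$ (the restriction of $M$ to $F$, whose lattice of flats is the interval below $F$) and $M^F$ is the contraction of $M$ at $F$ (whose lattice of flats is the interval above $F$). The Kazhdan–Lusztig polynomial (of Elias–Proudfoot–Wakefield) is the unique assignment of a polynomial $P_M(t)\in\mathbb{Z}[t]$ to each loopless matroid $M$ such that: $P_M(t)=1$ if $\mathrm{rk}\, M=0$; $\deg P_M(t)<\frac12 \mathrm{rk}\, M$ if $\mathrm{rk}\, M>0$; and $t^{\mathrm{rk}\, M}P_M(t^{-1})=\sum_{F\in L(M)}\chi_{M_F}(t)P_{M^F}(t)$ for every $M$. The fan graph $F_n$ ($n\ge1$) has vertex set $\{0,1,\dots,n\}$ and edges $\{i,i+1\}$ for $1\le i<n$ and $\{0,i\}$ for $1\le i\le n$. The square of a path $S_n$ ($n\ge1$) has vertex set $\{1,\dots,n\}$ with $i,j$ adjacent iff $1\le |i-j|\le 2$. The wheel graph $W_n$ ($n\ge3$) has vertex set $\{0,1,\dots,n\}$, the edges of the $n$-cycle $1,2,\dots,n,1$ (the outer cycle, with edge set $O_n$), and edges $\{0,i\}$ for $1\le i\le n$. The whirl matroid $W^n$ ($n\ge 3$) is the matroid on ground set $E(W_n)$ whose independent sets are the edge sets of forests of $W_n$ together with the set $O_n$.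
   Formalization: The formula for P_{S_n} is false as printed (S_3 is a triangle with P = 1, but the right side is 1+t); it is proved instead for the square of the path on n+1 vertices, n ≥ 1; only the edgeless S_1 is not covered. *)

theory Defs
  imports Complex_Main "HOL-Computational_Algebra.Polynomial"
begin

section \<open>Matroids\<close>

record 'a matroid =
  ground :: "'a set"
  indeps :: "'a set set"

locale is_matroid =
  fixes M :: "'a matroid"
  assumes finite_ground: "finite (ground M)"
    and indeps_subset_ground: "I \<in> indeps M \<Longrightarrow> I \<subseteq> ground M"
    and empty_indep: "{} \<in> indeps M"
    and indep_subset: "I \<in> indeps M \<Longrightarrow> J \<subseteq> I \<Longrightarrow> J \<in> indeps M"
    and augment: "I \<in> indeps M \<Longrightarrow> J \<in> indeps M \<Longrightarrow> card I < card J \<Longrightarrow>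
          \<exists>x\<in>J - I. insert x I \<in> indeps M"

definition loopless_matroid :: "'a matroid \<Rightarrow> bool" where
  "loopless_matroid M \<longleftrightarrow> is_matroid M \<and> (\<forall>x\<in>ground M. {x} \<in> indeps M)"

definition rank_of :: "'a matroid \<Rightarrow> 'a set \<Rightarrow> nat" where
  "rank_of M X = Max (card ` {I \<in> indeps M. I \<subseteq> X})"

definition rk :: "'a matroid \<Rightarrow> nat" where
  "rk M = rank_of M (ground M)"

text \<open>The lattice of flats is this set ordered by inclusion.\<close>
definition flats :: "'a matroid \<Rightarrow> 'a set set" where
  "flats M = {F. F \<subseteq> ground M \<and> (\<forall>x\<in>ground M - F. rank_of M F < rank_of M (insert x F))}"

definition localization :: "'a matroid \<Rightarrow> 'a set \<Rightarrow> 'a matroid" where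
  "localization M F = \<lparr>ground = F, indeps = {I \<in> indeps M. I \<subseteq> F}\<rparr>"

definition basis_in :: "'a matroid \<Rightarrow> 'a set \<Rightarrow> 'a set \<Rightarrow> bool" where
  "basis_in M X B \<longleftrightarrow> B \<in> indeps M \<and> B \<subseteq> X \<and> (\<forall>I\<in>indeps M. B \<subseteq> I \<and> I \<subseteq> X \<longrightarrow> I = B)"

definition contraction :: "'a matroid \<Rightarrow> 'a set \<Rightarrow> 'a matroid" where
  "contraction M F = \<lparr>ground = ground M - F,
     indeps = {I. I \<subseteq> ground M - F \<and> (\<exists>B. basis_in M F B \<and> I \<union> B \<in> indeps M)}\<rparr>"


section \<open>Characteristic polynomial\<close>

text \<open>
  \<open>mobius L A B\<close> is the Moebius function \<open>\<mu>(A, B)\<close> of a family \<open>L\<close> of finite sets ordered by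
  inclusion. The value 0 for infinite \<open>B\<close> only makes the recursion total.
\<close>
function mobius :: "'a set set \<Rightarrow> 'a set \<Rightarrow> 'a set \<Rightarrow> int" where
  "mobius L A B =
     (if \<not> finite B then 0
      else if A = B then 1
      else if A \<subset> B then - (\<Sum>C\<in>{C \<in> L. A \<subseteq> C \<and> C \<subset> B}. mobius L A C)
      else 0)"
  by pat_completeness auto
termination
  by (relation "measure (\<lambda>(L, A, B). card B)") (auto intro: psubset_card_mono)

declare mobius.simps [simp del]

text \<open>\<open>\<Inter> (flats M)\<close> is the least flat, which is empty for a loopless matroid.\<close>
definition characteristic_poly :: "'a matroid \<Rightarrow> int poly" where
  "characteristic_poly M =
     (\<Sum>F\<in>flats M. monom (mobius (flats M) (\<Inter> (flats M)) F) (rk M - rank_of M F))"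


section \<open>Kazhdan--Lusztig polynomial\<close>

text \<open>
  For a polynomial \<open>p\<close> of degree at most \<open>r\<close> this is \<open>t ^ r * p (1 / t)\<close>, since
  \<^term>\<open>reflect_poly p\<close> is \<open>t ^ degree p * p (1 / t)\<close>. The bound holds wherever it is used
  below, by the first two conditions on \<open>P\<close>.
\<close>
definition reverse_poly :: "nat \<Rightarrow> int poly \<Rightarrow> int poly" where
  "reverse_poly r p = monom 1 (r - degree p) * reflect_poly p"

text \<open>
  The value 0 away from loopless matroids is a convention: it makes the assignment unique as a
  total function. Localizations and contractions at flats stay within matroids on the type
  \<^typ>\<open>'a\<close>, so the recursion can be stated for one type.
\<close>
definition is_KL_assignment :: "('a matroid \<Rightarrow> int poly) \<Rightarrow> bool" where
  "is_KL_assignment P \<longleftrightarrow>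
     (\<forall>M. loopless_matroid M \<longrightarrow>
        (rk M = 0 \<longrightarrow> P M = 1) \<and>
        (rk M > 0 \<longrightarrow> 2 * degree (P M) < rk M) \<and>
        reverse_poly (rk M) (P M) =
          (\<Sum>F\<in>flats M. characteristic_poly (localization M F) * P (contraction M F))) \<and>
     (\<forall>M. \<not> loopless_matroid M \<longrightarrow> P M = 0)"

definition KL_poly :: "'a matroid \<Rightarrow> int poly" where
  "KL_poly = (THE P. is_KL_assignment P)"


section \<open>Graphs and graphic matroids\<close>

text \<open>Graphs are simple: every edge is a two-element set of vertices.\<close>
record 'v ugraph =
  verts :: "'v set"
  edges :: "'v set set"

text \<open>A cycle is given by its list of vertices in cyclic order.\<close>
definition is_cycle :: "'v set set \<Rightarrow> 'v list \<Rightarrow> bool" where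
  "is_cycle A vs \<longleftrightarrow> 3 \<le> length vs \<and> distinct vs \<and>
     (\<forall>i<length vs. {vs ! i, vs ! (Suc i mod length vs)} \<in> A)"

definition forest :: "'v set set \<Rightarrow> bool" where
  "forest A \<longleftrightarrow> (\<nexists>vs. is_cycle A vs)"

definition graphic_matroid :: "'v ugraph \<Rightarrow> 'v set matroid" where
  "graphic_matroid G = \<lparr>ground = edges G, indeps = {A. A \<subseteq> edges G \<and> forest A}\<rparr>"

definition fan_graph :: "nat \<Rightarrow> nat ugraph" where
  "fan_graph n = \<lparr>verts = {0..n},
     edges = {{i, i + 1} | i. 1 \<le> i \<and> i < n} \<union> {{0, i} | i. 1 \<le> i \<and> i \<le> n}\<rparr>"

text \<open>
  The square of the path on \<open>n\<close> vertices. Its graphic matroid has rank \<open>n - 1\<close>, so the square that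
  shares its Kazhdan--Lusztig polynomial with \<open>fan_graph n\<close> (rank \<open>n\<close>) is \<open>path_square (n + 1)\<close>.
\<close>
definition path_square :: "nat \<Rightarrow> nat ugraph" where
  "path_square n = \<lparr>verts = {1..n},
     edges = {{i, j} | i j. i \<in> {1..n} \<and> j \<in> {1..n} \<and>
                1 \<le> \<bar>int i - int j\<bar> \<and> \<bar>int i - int j\<bar> \<le> 2}\<rparr>"

definition outer_cycle :: "nat \<Rightarrow> nat set set" where
  "outer_cycle n = {{i, i + 1} | i. 1 \<le> i \<and> i < n} \<union> {{n, 1}}"

definition wheel_graph :: "nat \<Rightarrow> nat ugraph" where
  "wheel_graph n = \<lparr>verts = {0..n},
     edges = outer_cycle n \<union> {{0, i} | i. 1 \<le> i \<and> i \<le> n}\<rparr>"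

definition whirl_matroid :: "nat \<Rightarrow> nat set matroid" where
  "whirl_matroid n = \<lparr>ground = edges (wheel_graph n),
     indeps = {A. A \<subseteq> edges (wheel_graph n) \<and> forest A} \<union> {outer_cycle n}\<rparr>"


section \<open>Multinomial coefficients\<close>

definition multinomial3 :: "nat \<Rightarrow> nat \<Rightarrow> nat \<Rightarrow> nat \<Rightarrow> rat" where
  "multinomial3 a b c d = fact a / (fact b * fact c * fact d)"

end

theory Submission
  imports Defs "HOL-Computational_Algebra.Formal_Power_Series"
begin

text \<open>
  By Moebius inversion, the defining recursion of the Kazhdan--Lusztig polynomial is equivalent to
  the palindromicity of \<open>Z = \<Sum>F. t ^ rk F * P (M / F)\<close> for all contractions of \<open>M\<close>; in this form
  existence is immediate, and a candidate for \<open>F \<mapsto> P (M / F)\<close> can be verified directly.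

  All four families are glued from triangles \<open>{d i, e i, d (i + 1)}\<close> in a path (fans and squares of
  paths, which therefore have isomorphic matroids) or in a cycle (wheels and whirls). The flats are
  the sets that meet no triangle in exactly two elements, except that for the whirl the rim is not a
  flat, and for the wheel the rim minus an edge is not. Recording at each vertex whether its spoke
  (\<open>Spoke\<close>), or else the rim edge before it (\<open>Glue\<close>), or neither (\<open>New\<close>) is in the flat, flats become
  words whose corank is the number of \<open>New\<close>, and \<open>P (M / F)\<close> is a product over the runs between spokes.
  Palindromicity then reduces to two identities: the binomial transform of the Motzkin polynomials are
  the Narayana polynomials, given by \<open>X = u (1 + X) (1 + t X)\<close>, and in the cyclic case the flats with
  spokes contribute \<open>(t - 1) * \<Sum>k. (n choose k)^2 t^k\<close>, which the flats without spokes cancel.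
\<close>


section \<open>Matroids, closure and minors\<close>

text \<open>The two sides of palindromicity are the same sum over words, once with parameter
  \<open>T\<close> and weights \<open>fan_poly\<close>, once with parameter 1 and reversed weights,
  because reversal is multiplicative over runs. A run of \<open>m\<close> segments has weight
  \<open>fan_poly m\<close> because contracting the flat leaves there, up to parallel elements, a
  fan with \<open>m\<close> rim vertices; adding rim edges inside a run merges segments, hence the
  binomial transforms.

  In the cyclic case the state before the first vertex is read from the last letter of the same
  word. A word with a spoke can be cut open there and becomes linear, but an interval whose bottom
  has no spoke contains words of both kinds, and only their total is palindromic.

  From the whirl to the wheel, each of the \<open>m\<close> sets with one segment drops out, where
  it contributed \<open>T ^ (m - 1) - T\<close>, and the rim enters with that same contribution. So
  the two polynomials must differ by one whose binomial transform minus its reversal is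
  \<open>(m - 1) * (T - T ^ (m - 1))\<close>; this equation is the source of
  \<open>relaxation_poly\<close>.\<close>

context is_matroid
begin

section \<open>Bases, rank and submodularity\<close>

lemma finite_indep: "I \<in> indeps M \<Longrightarrow> finite I"
  using indeps_subset_ground finite_ground finite_subset by blast

lemma finite_indeps: "finite (indeps M)"
  by (rule finite_subset[of _ "Pow (ground M)"]) (use indeps_subset_ground finite_ground in auto)

lemma card_le_rank: "I \<in> indeps M \<Longrightarrow> I \<subseteq> X \<Longrightarrow> card I \<le> rank_of M X"
  unfolding rank_of_def using finite_indeps by (intro Max_ge) auto

lemma rank_attained: "\<exists>I\<in>indeps M. I \<subseteq> X \<and> card I = rank_of M X"
proof -
  have "rank_of M X \<in> card ` {I \<in> indeps M. I \<subseteq> X}"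
    unfolding rank_of_def using finite_indeps empty_indep by (intro Max_in) auto
  then show ?thesis by auto
qed

text \<open>An independent superset of \<open>I\<close> inside \<open>X\<close> of largest size
  cannot be smaller than a basis of \<open>X\<close>, since \<open>augment\<close> would enlarge
  it.\<close>

lemma indep_extend:
  assumes "I \<in> indeps M" "I \<subseteq> X"
  obtains B where "B \<in> indeps M" "I \<subseteq> B" "B \<subseteq> X" "card B = rank_of M X"
proof -
  let ?S = "{B \<in> indeps M. I \<subseteq> B \<and> B \<subseteq> X}"
  have fin: "finite ?S" using finite_indeps by auto
  have "I \<in> ?S" using assms by auto
  then obtain B where B: "B \<in> ?S" and max: "\<And>C. C \<in> ?S \<Longrightarrow> card C \<le> card B"
  proof -
    have "Max (card ` ?S) \<in> card ` ?S" using fin \<open>I \<in> ?S\<close> by (intro Max_in) auto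
    then obtain B where "B \<in> ?S" "card B = Max (card ` ?S)" by auto
    moreover have "card C \<le> Max (card ` ?S)" if "C \<in> ?S" for C using fin that by (intro Max_ge) auto
    ultimately show ?thesis using that[of B] by presburger
  qed
  obtain J where J: "J \<in> indeps M" "J \<subseteq> X" "card J = rank_of M X"
    using rank_attained by blast
  have "\<not> card B < card J"
  proof
    assume "card B < card J"
    then obtain x where x: "x \<in> J - B" "insert x B \<in> indeps M"
      using augment B J by blast
    then have "insert x B \<in> ?S" using B J by auto
    from max[OF this] show False using x B finite_indep by auto
  qed
  then have "card B = rank_of M X" using card_le_rank[of B X] B J by auto
  then show ?thesis using B that by auto
qed

lemma basis_in_iff: "basis_in M X B \<longleftrightarrow> B \<in> indeps M \<and> B \<subseteq> X \<and> card B = rank_of M X"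
proof
  assume *: "basis_in M X B"
  then have "B \<in> indeps M" "B \<subseteq> X" by (auto simp: basis_in_def)
  then obtain C where "C \<in> indeps M" "B \<subseteq> C" "C \<subseteq> X" "card C = rank_of M X"
    using indep_extend by blast
  with * show "B \<in> indeps M \<and> B \<subseteq> X \<and> card B = rank_of M X"
    unfolding basis_in_def by blast
next
  assume *: "B \<in> indeps M \<and> B \<subseteq> X \<and> card B = rank_of M X"
  show "basis_in M X B" unfolding basis_in_def
  proof (intro conjI ballI impI)
    fix I assume I: "I \<in> indeps M" "B \<subseteq> I \<and> I \<subseteq> X"
    then have "card I \<le> card B" using * card_le_rank by auto
    then show "I = B" using card_seteq[of I B] I finite_indep by auto
  qed (use * in auto)
qed

lemma rank_mono: "X \<subseteq> Y \<Longrightarrow> rank_of M X \<le> rank_of M Y"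
  using rank_attained[of X] card_le_rank[of _ Y] by (metis order_trans)

lemma rank_le_card: "finite X \<Longrightarrow> rank_of M X \<le> card X"
  using rank_attained[of X] card_mono by metis

lemma rank_empty [simp]: "rank_of M {} = 0"
  using rank_le_card[of "{}"] by simp

lemma rank_indep: "I \<in> indeps M \<Longrightarrow> rank_of M I = card I"
  using card_le_rank[of I I] rank_le_card[of I] finite_indep[of I] by auto

lemma indep_iff_rank:
  assumes "finite X" shows "X \<in> indeps M \<longleftrightarrow> rank_of M X = card X"
  using rank_indep rank_attained[of X] assms by (metis card_subset_eq)

lemma rank_Int_ground: "rank_of M (X \<inter> ground M) = rank_of M X"
proof -
  obtain I where "I \<in> indeps M" "I \<subseteq> X" "card I = rank_of M X" using rank_attained by blast
  then have "rank_of M X \<le> rank_of M (X \<inter> ground M)"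
    using card_le_rank[of I "X \<inter> ground M"] indeps_subset_ground by auto
  then show ?thesis using rank_mono[of "X \<inter> ground M" X] by auto
qed

text \<open>A basis \<open>I\<close> of the intersection is extended to a basis \<open>J\<close> of
  the union; the traces of \<open>J\<close> on \<open>A\<close> and on \<open>B\<close> are
  independent and overlap in at least \<open>I\<close>.\<close>

lemma rank_submodular:
  "rank_of M (A \<union> B) + rank_of M (A \<inter> B) \<le> rank_of M A + rank_of M B"
proof -
  obtain I where I: "I \<in> indeps M" "I \<subseteq> A \<inter> B" "card I = rank_of M (A \<inter> B)"
    using rank_attained by blast
  obtain J where J: "J \<in> indeps M" "I \<subseteq> J" "J \<subseteq> A \<union> B" "card J = rank_of M (A \<union> B)"
    using indep_extend[of I "A \<union> B"] I by blast
  have fJ: "finite J" using J finite_indep by blast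
  have "J \<inter> A \<union> J \<inter> B = J" "J \<inter> A \<inter> (J \<inter> B) = J \<inter> A \<inter> B" using J(3) by auto
  then have "card J + card (J \<inter> A \<inter> B) = card (J \<inter> A) + card (J \<inter> B)"
    using card_Un_Int[of "J \<inter> A" "J \<inter> B"] fJ by auto
  moreover have "card I \<le> card (J \<inter> A \<inter> B)"
    using I J fJ by (intro card_mono) auto
  moreover have "card (J \<inter> A) \<le> rank_of M A" "card (J \<inter> B) \<le> rank_of M B"
    using card_le_rank indep_subset[OF J(1)] by auto
  ultimately show ?thesis using I J by linarith
qed

lemma rank_Un_le: "rank_of M (A \<union> B) \<le> rank_of M A + rank_of M B"
  using rank_submodular[of A B] by linarith

lemma rank_insert_le: "rank_of M (insert x X) \<le> Suc (rank_of M X)"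
  using rank_Un_le[of "{x}" X] rank_le_card[of "{x}"] by simp

text \<open>If the rank grew, a basis of \<open>X\<close> could be augmented from a basis of the
  union; the added element would raise the rank of \<open>X\<close> although it lies in
  \<open>X\<close> or in \<open>Y\<close>.\<close>

lemma rank_Un_eq:
  assumes "\<And>y. y \<in> Y \<Longrightarrow> rank_of M (insert y X) = rank_of M X"
  shows "rank_of M (X \<union> Y) = rank_of M X"
proof (rule ccontr)
  assume ne: "rank_of M (X \<union> Y) \<noteq> rank_of M X"
  obtain B where B: "B \<in> indeps M" "B \<subseteq> X" "card B = rank_of M X"
    using rank_attained by blast
  obtain C where C: "C \<in> indeps M" "C \<subseteq> X \<union> Y" "card C = rank_of M (X \<union> Y)"
    using rank_attained by blast
  have "card B < card C" using ne B C rank_mono[of X "X \<union> Y"] by auto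
  then obtain y where y: "y \<in> C - B" "insert y B \<in> indeps M" using augment B C by blast
  have "rank_of M (insert y X) = rank_of M X"
    using y C assms[of y] by (cases "y \<in> X") (auto simp: insert_absorb)
  moreover have "card (insert y B) \<le> rank_of M (insert y X)"
    using y B by (intro card_le_rank) auto
  ultimately show False using y B finite_indep by auto
qed

text \<open>Restricted to the ground set so that closures are flats. Hence \<open>X\<close> lies in
  \<open>cl X\<close> only for \<open>X\<close> inside the ground set, and the general facts below
  speak of \<open>X \<union> cl X\<close>.\<close>

definition cl :: "'a set \<Rightarrow> 'a set" where
  "cl X = {x \<in> ground M. rank_of M (insert x X) = rank_of M X}"

lemma cl_subset: "cl X \<subseteq> ground M" by (auto simp: cl_def)

lemma subset_cl: "X \<subseteq> ground M \<Longrightarrow> X \<subseteq> cl X" by (auto simp: cl_def insert_absorb)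

lemma rank_Un_cl: "rank_of M (X \<union> cl X) = rank_of M X"
  by (rule rank_Un_eq) (auto simp: cl_def)

lemma rank_le_of_subset_cl: "X \<subseteq> cl Y \<Longrightarrow> rank_of M X \<le> rank_of M Y"
  using rank_mono[of X "Y \<union> cl Y"] rank_Un_cl[of Y] by auto

lemma rank_cl: "X \<subseteq> ground M \<Longrightarrow> rank_of M (cl X) = rank_of M X"
  using rank_Un_cl[of X] subset_cl[of X] by (simp add: Un_absorb1)

lemma cl_mono:
  assumes "X \<subseteq> Y" shows "cl X \<subseteq> cl Y"
proof
  fix x assume x: "x \<in> cl X"
  have "rank_of M (insert x X \<union> Y) + rank_of M (insert x X \<inter> Y)
      \<le> rank_of M (insert x X) + rank_of M Y" by (rule rank_submodular)
  moreover have "rank_of M X \<le> rank_of M (insert x X \<inter> Y)" using assms by (intro rank_mono) auto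
  moreover have "insert x X \<union> Y = insert x Y" using assms by auto
  ultimately have "rank_of M (insert x Y) \<le> rank_of M Y" using x by (auto simp: cl_def)
  then show "x \<in> cl Y" using x rank_mono[OF subset_insertI, of Y x] by (auto simp: cl_def)
qed

lemma cl_least:
  assumes "X \<subseteq> cl Y" shows "cl X \<subseteq> cl Y"
proof
  fix x assume "x \<in> cl X"
  then have x: "x \<in> cl (Y \<union> cl Y)" using cl_mono[of X "Y \<union> cl Y"] assms by auto
  then have "rank_of M (insert x Y) \<le> rank_of M (Y \<union> cl Y)"
    using rank_mono[of "insert x Y" "insert x (Y \<union> cl Y)"] by (auto simp: cl_def)
  then have "rank_of M (insert x Y) = rank_of M Y"
    using rank_Un_cl[of Y] rank_mono[OF subset_insertI, of Y x] by simp
  then show "x \<in> cl Y" using x by (auto simp: cl_def)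
qed

lemma flats_iff_cl: "F \<in> flats M \<longleftrightarrow> F \<subseteq> ground M \<and> cl F = F"
proof -
  have "rank_of M F < rank_of M (insert x F) \<longleftrightarrow> rank_of M (insert x F) \<noteq> rank_of M F" for x
    using rank_mono[OF subset_insertI, of F x] by auto
  then show ?thesis unfolding flats_def using subset_cl[of F] by (auto simp: cl_def)
qed

lemma cl_flat: "X \<subseteq> ground M \<Longrightarrow> cl X \<in> flats M"
  unfolding flats_iff_cl using cl_subset[of X] cl_least[of "cl X" X] subset_cl[of "cl X"] by auto

lemma ground_flat: "ground M \<in> flats M" by (auto simp: flats_def)

lemma flat_subset: "F \<in> flats M \<Longrightarrow> F \<subseteq> ground M" by (auto simp: flats_def)

lemma finite_flat: "F \<in> flats M \<Longrightarrow> finite F"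
  using flat_subset finite_ground finite_subset by blast

lemma finite_flats: "finite (flats M)"
  by (rule finite_subset[of _ "Pow (ground M)"]) (use flat_subset finite_ground in auto)

lemma flat_rank_less:
  assumes "F \<in> flats M" "G \<subseteq> ground M" "F \<subset> G" shows "rank_of M F < rank_of M G"
proof -
  obtain x where x: "x \<in> G - F" using assms by auto
  then have "rank_of M F < rank_of M (insert x F)" using assms by (auto simp: flats_def)
  also have "\<dots> \<le> rank_of M G" using x assms by (intro rank_mono) auto
  finally show ?thesis .
qed

lemma rank_le_rk: "rank_of M X \<le> rk M"
  unfolding rk_def using rank_Int_ground[of X] rank_mono[of "X \<inter> ground M" "ground M"] by auto

lemma empty_flat: "loopless_matroid M \<Longrightarrow> {} \<in> flats M"
  unfolding flats_def loopless_matroid_def using rank_indep[of "{_}"] by auto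

section \<open>Contraction\<close>

lemma ground_contraction [simp]: "ground (contraction M F) = ground M - F"
  by (simp add: contraction_def)

text \<open>The rank equation does not mention the chosen basis of \<open>F\<close>, and all later
  facts on contractions go through ranks. For the converse, a basis of \<open>F\<close> is extended
  inside \<open>I \<union> F\<close>, and counting forces the extension to contain all of
  \<open>I\<close>.\<close>

lemma indep_contraction_iff:
  assumes F: "F \<subseteq> ground M"
  shows "I \<in> indeps (contraction M F) \<longleftrightarrow>
    I \<subseteq> ground M - F \<and> rank_of M (I \<union> F) = card I + rank_of M F"
proof
  assume "I \<in> indeps (contraction M F)"
  then obtain B where I: "I \<subseteq> ground M - F" and B: "basis_in M F B" "I \<union> B \<in> indeps M"
    by (auto simp: contraction_def)
  have fin: "finite (I \<union> B)" using B finite_indep by blast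
  have "I \<inter> B = {}" using I B by (auto simp: basis_in_def)
  then have "card (I \<union> B) = card I + rank_of M F"
    using card_Un_disjoint[of I B] fin B by (auto simp: basis_in_iff)
  moreover have "card (I \<union> B) \<le> rank_of M (I \<union> F)"
    using B by (intro card_le_rank) (auto simp: basis_in_def)
  moreover have "rank_of M (I \<union> F) \<le> card I + rank_of M F"
    using rank_Un_le[of I F] rank_le_card[of I] fin by auto
  ultimately show "I \<subseteq> ground M - F \<and> rank_of M (I \<union> F) = card I + rank_of M F" using I by auto
next
  assume I: "I \<subseteq> ground M - F \<and> rank_of M (I \<union> F) = card I + rank_of M F"
  obtain B where B: "B \<in> indeps M" "B \<subseteq> F" "card B = rank_of M F"
    using rank_attained by blast
  obtain C where C: "C \<in> indeps M" "B \<subseteq> C" "C \<subseteq> I \<union> F" "card C = rank_of M (I \<union> F)"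
    using indep_extend[of B "I \<union> F"] B by blast
  have finI: "finite I" using I finite_ground finite_subset by blast
  have "card (C \<inter> F) \<le> card B" using card_le_rank[of "C \<inter> F" F] indep_subset[OF C(1)] B by auto
  then have "C \<inter> F = B" using card_seteq[of "C \<inter> F" B] finite_indep C B by auto
  then have "C \<subseteq> I \<union> B" using C by auto
  moreover have "card (I \<union> B) = card I + card B"
    using I B finI finite_indep[OF B(1)] by (intro card_Un_disjoint) auto
  ultimately have "C = I \<union> B" using card_subset_eq[of "I \<union> B" C] C I B finI finite_indep[OF B(1)] by auto
  then show "I \<in> indeps (contraction M F)"
    using I B C by (auto simp: contraction_def basis_in_iff)
qed

lemma matroid_contraction:
  assumes F: "F \<subseteq> ground M" shows "is_matroid (contraction M F)"
proof
  show "finite (ground (contraction M F))" using finite_ground by simp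
  show "I \<subseteq> ground (contraction M F)" if "I \<in> indeps (contraction M F)" for I
    using that indep_contraction_iff[OF F] by simp
  show "{} \<in> indeps (contraction M F)" by (simp add: indep_contraction_iff[OF F])
  show "J \<in> indeps (contraction M F)" if "I \<in> indeps (contraction M F)" "J \<subseteq> I" for I J
  proof -
    have I: "I \<subseteq> ground M - F" "rank_of M (I \<union> F) = card I + rank_of M F"
      using that indep_contraction_iff[OF F] by auto
    have fin: "finite I" using I finite_ground finite_subset by blast
    have "I \<union> F = (I - J) \<union> (J \<union> F)" using that by auto
    then have "rank_of M (I \<union> F) \<le> card (I - J) + rank_of M (J \<union> F)"
      using rank_Un_le[of "I - J" "J \<union> F"] rank_le_card[of "I - J"] fin by auto
    moreover have "card I = card (I - J) + card J"
      using that(2) fin by (simp add: card_Diff_subset card_mono finite_subset)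
    moreover have "rank_of M (J \<union> F) \<le> card J + rank_of M F"
      using rank_Un_le[of J F] rank_le_card[of J] that fin finite_subset by fastforce
    ultimately show ?thesis using I that by (auto simp: indep_contraction_iff[OF F])
  qed
  show "\<exists>x\<in>J - I. insert x I \<in> indeps (contraction M F)"
    if "I \<in> indeps (contraction M F)" "J \<in> indeps (contraction M F)" "card I < card J" for I J
  proof -
    have I: "I \<subseteq> ground M - F" "rank_of M (I \<union> F) = card I + rank_of M F"
     and J: "J \<subseteq> ground M - F" "rank_of M (J \<union> F) = card J + rank_of M F"
      using that indep_contraction_iff[OF F] by auto
    have fin: "finite I" using I finite_ground finite_subset by blast
    have "rank_of M (J \<union> F) \<le> rank_of M (I \<union> F \<union> J)" by (rule rank_mono) auto
    then have "rank_of M (I \<union> F \<union> J) \<noteq> rank_of M (I \<union> F)" using I J that by auto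
    then obtain x where x: "x \<in> J" "rank_of M (insert x (I \<union> F)) \<noteq> rank_of M (I \<union> F)"
      using rank_Un_eq[of J "I \<union> F"] by blast
    then have xI: "x \<notin> I" by (auto simp: insert_absorb)
    have "rank_of M (insert x (I \<union> F)) = Suc (rank_of M (I \<union> F))"
      using x(2) rank_insert_le[of x "I \<union> F"] rank_mono[OF subset_insertI, of "I \<union> F" x] by linarith
    then have "insert x I \<in> indeps (contraction M F)"
      using I J x xI fin by (auto simp: indep_contraction_iff[OF F])
    then show ?thesis using x xI by auto
  qed
qed

lemma rank_contraction:
  assumes F: "F \<subseteq> ground M" and X: "X \<subseteq> ground M - F"
  shows "rank_of (contraction M F) X = rank_of M (X \<union> F) - rank_of M F"
proof -
  interpret C: is_matroid "contraction M F" by (rule matroid_contraction[OF F])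
  obtain I where I: "I \<in> indeps (contraction M F)" "I \<subseteq> X" "card I = rank_of (contraction M F) X"
    using C.rank_attained by blast
  have "rank_of M (I \<union> F) \<le> rank_of M (X \<union> F)" using I by (intro rank_mono) auto
  then have le: "rank_of (contraction M F) X \<le> rank_of M (X \<union> F) - rank_of M F"
    using I by (auto simp: indep_contraction_iff[OF F])
  obtain B where B: "B \<in> indeps M" "B \<subseteq> F" "card B = rank_of M F"
    using rank_attained by blast
  obtain D where D: "D \<in> indeps M" "B \<subseteq> D" "D \<subseteq> X \<union> F" "card D = rank_of M (X \<union> F)"
    using indep_extend[of B "X \<union> F"] B by blast
  have finD: "finite D" using D finite_indep by blast
  have "card (D \<inter> F) \<le> card B" using card_le_rank[of "D \<inter> F" F] indep_subset[OF D(1)] B by auto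
  then have DF: "D \<inter> F = B" using card_seteq[of "D \<inter> F" B] finD D B by auto
  then have "D = (D - F) \<union> B" by auto
  then have "D - F \<in> indeps (contraction M F)"
    using D B X by (auto simp: contraction_def basis_in_iff intro!: exI[of _ B])
  then have "card (D - F) \<le> rank_of (contraction M F) X" using D by (intro C.card_le_rank) auto
  moreover have "card (D - F) = card D - card B"
    using card_Diff_subset_Int[of D F] finite_Int[of D F] DF finD by simp
  ultimately show ?thesis using le D B by simp
qed

lemma rk_contraction: "F \<subseteq> ground M \<Longrightarrow> rk (contraction M F) = rk M - rank_of M F"
  unfolding rk_def using rank_contraction[of F "ground M - F"] by (simp add: Un_absorb2)

lemma flats_contraction:
  assumes F: "F \<in> flats M"
  shows "flats (contraction M F) = (\<lambda>G. G - F) ` {G \<in> flats M. F \<subseteq> G}"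
proof -
  have FE: "F \<subseteq> ground M" using F flat_subset by blast
  have iff: "H \<in> flats (contraction M F) \<longleftrightarrow> H \<union> F \<in> flats M" if H: "H \<subseteq> ground M - F" for H
  proof -
    have "rank_of (contraction M F) H < rank_of (contraction M F) (insert x H) \<longleftrightarrow>
      rank_of M (H \<union> F) < rank_of M (insert x (H \<union> F))" if "x \<in> ground M - F - H" for x
      using that H rank_contraction[OF FE, of H] rank_contraction[OF FE, of "insert x H"]
        rank_mono[of F "H \<union> F"] by auto
    then show ?thesis using H FE by (auto simp: flats_def)
  qed
  show ?thesis
  proof (intro equalityI subsetI)
    fix H assume H: "H \<in> flats (contraction M F)"
    then have sub: "H \<subseteq> ground M - F" by (auto simp: flats_def)
    then show "H \<in> (\<lambda>G. G - F) ` {G \<in> flats M. F \<subseteq> G}"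
      using iff[OF sub] H by (intro image_eqI[of _ _ "H \<union> F"]) auto
  next
    fix H assume "H \<in> (\<lambda>G. G - F) ` {G \<in> flats M. F \<subseteq> G}"
    then obtain G where G: "H = G - F" "G \<in> flats M" "F \<subseteq> G" by auto
    then have sub: "H \<subseteq> ground M - F" using flat_subset by auto
    moreover have "H \<union> F = G" using G by auto
    ultimately show "H \<in> flats (contraction M F)" using iff[OF sub] G by simp
  qed
qed

lemma inj_on_Diff_flats: "inj_on (\<lambda>G. G - F) {G \<in> flats M. F \<subseteq> G}"
  by (auto simp: inj_on_def)

lemma loopless_contraction:
  assumes F: "F \<in> flats M" shows "loopless_matroid (contraction M F)"
  unfolding loopless_matroid_def
proof (intro conjI ballI)
  have FE: "F \<subseteq> ground M" using F flat_subset by blast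
  show "is_matroid (contraction M F)" by (rule matroid_contraction[OF FE])
  fix x assume "x \<in> ground (contraction M F)"
  then have x: "x \<in> ground M - F" by simp
  then have "rank_of M F < rank_of M (insert x F)" using F by (auto simp: flats_def)
  then have "rank_of M (insert x F) = Suc (rank_of M F)" using rank_insert_le[of x F] by auto
  then show "{x} \<in> indeps (contraction M F)" using x by (auto simp: indep_contraction_iff[OF FE])
qed

text \<open>Rank differences telescope. This turns statements about all contractions into statements
  about intervals of flats of a single matroid.\<close>

lemma contraction_contraction:
  assumes F: "F \<subseteq> ground M" and G: "G \<subseteq> ground M" "F \<subseteq> G"
  shows "contraction (contraction M F) (G - F) = contraction M G"
proof -
  interpret C: is_matroid "contraction M F" by (rule matroid_contraction[OF F])
  have GF: "G - F \<subseteq> ground (contraction M F)" using G by auto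
  have "I \<in> indeps (contraction (contraction M F) (G - F)) \<longleftrightarrow> I \<in> indeps (contraction M G)" for I
  proof (cases "I \<subseteq> ground M - G")
    case True
    have "I \<union> (G - F) \<subseteq> ground M - F" using True G by auto
    moreover have "I \<union> (G - F) \<union> F = I \<union> G" "(G - F) \<union> F = G" using G by auto
    moreover have "G - F \<subseteq> ground M - F" "ground M - F - (G - F) = ground M - G" using G by auto
    ultimately show ?thesis
      using True rank_contraction[OF F, of "I \<union> (G - F)"] rank_contraction[OF F, of "G - F"]
        rank_mono[of F G] rank_mono[of G "I \<union> G"] G(2)
      by (auto simp: C.indep_contraction_iff[OF GF] indep_contraction_iff[OF G(1)])
  next
    case False
    moreover have "ground M - F - (G - F) = ground M - G" using G by auto
    ultimately show ?thesis
      by (auto simp: C.indep_contraction_iff[OF GF] indep_contraction_iff[OF G(1)])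
  qed
  moreover have "ground (contraction (contraction M F) (G - F)) = ground (contraction M G)"
    using G by auto
  ultimately show ?thesis by (intro matroid.equality) auto
qed

lemma contraction_empty: "contraction M {} = M"
proof (rule matroid.equality)
  have "basis_in M {} B \<longleftrightarrow> B = {}" for B using empty_indep by (auto simp: basis_in_def)
  then show "indeps (contraction M {}) = indeps M"
    using indeps_subset_ground by (auto simp: contraction_def)
qed auto

section \<open>Localization\<close>

lemma rank_localization: "X \<subseteq> F \<Longrightarrow> rank_of (localization M F) X = rank_of M X"
  unfolding rank_of_def localization_def by (intro arg_cong[where f = Max] arg_cong[where f = "(`) card"]) auto

text \<open>Elements outside the flat \<open>F\<close> raise the rank of any subset of
  \<open>F\<close> automatically: otherwise they would lie in its closure, hence in
  \<open>F\<close>.\<close>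

lemma flats_localization:
  assumes "F \<in> flats M" shows "flats (localization M F) = {G \<in> flats M. G \<subseteq> F}"
proof -
  have "G \<in> flats (localization M F) \<longleftrightarrow> G \<in> flats M" if G: "G \<subseteq> F" for G
  proof -
    have "G \<in> flats (localization M F) \<longleftrightarrow> (\<forall>x\<in>F - G. rank_of M G < rank_of M (insert x G))"
      using G rank_localization[of G F] rank_localization[of "insert _ G" F]
      by (auto simp: flats_def localization_def)
    also have "\<dots> \<longleftrightarrow> (\<forall>x\<in>ground M - G. rank_of M G < rank_of M (insert x G))"
    proof
      assume *: "\<forall>x\<in>F - G. rank_of M G < rank_of M (insert x G)"
      show "\<forall>x\<in>ground M - G. rank_of M G < rank_of M (insert x G)"
      proof
        fix x assume x: "x \<in> ground M - G"
        show "rank_of M G < rank_of M (insert x G)"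
        proof (rule ccontr)
          assume less: "\<not> ?thesis"
          then have "x \<in> cl G" using x rank_mono[OF subset_insertI, of G x] by (auto simp: cl_def)
          then have "x \<in> F" using cl_mono[OF G] assms by (auto simp: flats_iff_cl)
          then show False using * x less by auto
        qed
      qed
    qed (use assms flat_subset in auto)
    also have "\<dots> \<longleftrightarrow> G \<in> flats M"
      using order_trans[OF G flat_subset[OF assms]] by (simp add: flats_def)
    finally show ?thesis .
  qed
  moreover have "G \<subseteq> F" if "G \<in> flats (localization M F)" for G
    using that by (auto simp: flats_def localization_def)
  ultimately show ?thesis by blast
qed

end

section \<open>Kazhdan--Lusztig polynomials via palindromicity\<close>

lemma coeff_reverse_poly:
  assumes "degree p \<le> r"
  shows "coeff (reverse_poly r p) i = (if i \<le> r then coeff p (r - i) else 0)"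
  using assms coeff_eq_0[of p "r - i"]
  by (auto simp: reverse_poly_def coeff_monom_mult coeff_reflect_poly intro: arg_cong[where f = "coeff p"])

lemma reverse_poly_mult:
  assumes "degree p \<le> r" "degree q \<le> s"
  shows "reverse_poly (r + s) (p * q) = reverse_poly r p * reverse_poly s q"
proof (cases "p = 0 \<or> q = 0")
  case False
  then have "r + s - degree (p * q) = (r - degree p) + (s - degree q)"
    using assms by (simp add: degree_mult_eq)
  then show ?thesis
    using mult_monom[of "1::int" "r - degree p" 1 "s - degree q"]
    by (simp add: reverse_poly_def reflect_poly_mult mult_ac)
qed (auto simp: reverse_poly_def)

lemma reverse_poly_0 [simp]: "reverse_poly r 0 = 0"
  by (simp add: reverse_poly_def)

lemma reverse_poly_const_1 [simp]: "reverse_poly r 1 = monom 1 r"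
  by (simp add: reverse_poly_def)

text \<open>With both degrees below \<open>c / 2\<close>, the reversals occupy only exponents above
  \<open>c / 2\<close>, so the difference reveals all lower coefficients. Every uniqueness argument
  below rests on this.\<close>

lemma reverse_poly_diff_unique:
  assumes "2 * degree p < c" "2 * degree q < c"
    and eq: "reverse_poly c p - p = reverse_poly c q - q"
  shows "p = q"
proof (rule poly_eqI)
  fix i
  have *: "coeff (reverse_poly c p) i - coeff p i = coeff (reverse_poly c q) i - coeff q i"
    using arg_cong[OF eq, of "\<lambda>p. coeff p i"] by simp
  show "coeff p i = coeff q i"
  proof (cases "2 * i < c")
    case True
    then have "degree p < c - i" "degree q < c - i" using assms by auto
    then show ?thesis using * assms True by (simp add: coeff_reverse_poly coeff_eq_0)
  next
    case False
    then show ?thesis using assms by (simp add: coeff_eq_0)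
  qed
qed

text \<open>Keeps exactly the exponents below \<open>r / 2\<close>, the longest truncation that the
  degree bound admits.\<close>

definition lower_half :: "nat \<Rightarrow> int poly \<Rightarrow> int poly" where
  "lower_half r p = (\<Sum>k<(r + 1) div 2. monom (coeff p k) k)"

lemma coeff_lower_half: "coeff (lower_half r p) i = (if 2 * i < r then coeff p i else 0)"
proof -
  have "coeff (lower_half r p) i = (\<Sum>k<(r + 1) div 2. if k = i then coeff p k else 0)"
    by (simp add: lower_half_def coeff_sum)
  also have "\<dots> = (if i < (r + 1) div 2 then coeff p i else 0)" by simp
  finally show ?thesis by auto
qed

lemma degree_lower_half: "r > 0 \<Longrightarrow> 2 * degree (lower_half r p) < r"
proof -
  assume "r > 0"
  have "degree (lower_half r p) \<le> (r - 1) div 2"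
    by (rule degree_le) (auto simp: coeff_lower_half)
  then show ?thesis using \<open>r > 0\<close> by auto
qed

text \<open>Antisymmetry makes the middle coefficient vanish, so \<open>p\<close> is its lower half
  minus the reversal of that half.\<close>

lemma reverse_lower_half:
  assumes "r > 0" and anti: "\<And>i. i \<le> r \<Longrightarrow> coeff p (r - i) = - coeff p i"
    and zero: "\<And>i. i > r \<Longrightarrow> coeff p i = 0"
  shows "reverse_poly r (lower_half r p) - lower_half r p + p = 0"
proof (rule poly_eqI)
  fix i
  have deg: "degree (lower_half r p) \<le> r" using degree_lower_half[OF assms(1), of p] by auto
  show "coeff (reverse_poly r (lower_half r p) - lower_half r p + p) i = coeff 0 i"
  proof (cases "i \<le> r")
    case True
    show ?thesis
    proof (cases "2 * i = r")
      case eq: True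
      then have "r - i = i" by auto
      then have "coeff p i = 0" using anti[OF True] by simp
      then show ?thesis using True eq \<open>r - i = i\<close> by (simp add: coeff_reverse_poly[OF deg] coeff_lower_half)
    next
      case False
      then have "2 * (r - i) < r \<longleftrightarrow> \<not> 2 * i < r" using True by auto
      then show ?thesis using True anti[OF True] by (simp add: coeff_reverse_poly[OF deg] coeff_lower_half)
    qed
  qed (use zero in \<open>simp add: coeff_reverse_poly[OF deg] coeff_lower_half\<close>)
qed

text \<open>Palindromicity solved for the term of the empty flat: the contributions of the other
  flats form an antisymmetric polynomial, and its lower half is the only choice within the degree
  bound. The recursion descends because contracting a nonempty flat shrinks the ground set.\<close>

function klp :: "'a matroid \<Rightarrow> int poly" where
  "klp M = (if loopless_matroid M then
      if rk M = 0 then 1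
      else lower_half (rk M) (\<Sum>F\<in>flats M - {{}}. reverse_poly (rk M - rank_of M F) (klp (contraction M F))
        - monom 1 (rank_of M F) * klp (contraction M F))
     else 0)"
  by pat_completeness auto
termination
  by (relation "measure (\<lambda>M. card (ground M))")
    (auto simp: flats_def loopless_matroid_def contraction_def is_matroid.finite_ground
      intro!: psubset_card_mono)

declare klp.simps [simp del]

lemma klp_rank_0: "loopless_matroid M \<Longrightarrow> rk M = 0 \<Longrightarrow> klp M = 1"
  by (simp add: klp.simps)

lemma degree_klp: "loopless_matroid M \<Longrightarrow> rk M > 0 \<Longrightarrow> 2 * degree (klp M) < rk M"
  by (subst klp.simps) (simp add: degree_lower_half)

lemma degree_klp_le: "loopless_matroid M \<Longrightarrow> degree (klp M) \<le> rk M"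
  using degree_klp[of M] klp_rank_0[of M] by (cases "rk M = 0") auto

lemma matroid_of_loopless: "loopless_matroid M \<Longrightarrow> is_matroid M"
  by (simp add: loopless_matroid_def)

lemma loopless_rank_0:
  assumes "loopless_matroid M" "rk M = 0" shows "ground M = {}"
proof (rule ccontr)
  interpret is_matroid M using assms(1) by (rule matroid_of_loopless)
  assume "ground M \<noteq> {}"
  then obtain x where "x \<in> ground M" by auto
  then have "card {x} \<le> rk M" unfolding rk_def
    using assms(1) by (intro card_le_rank) (auto simp: loopless_matroid_def)
  then show False using assms by simp
qed

lemma klp_palindromic:
  assumes M: "loopless_matroid M"
  shows "(\<Sum>F\<in>flats M. reverse_poly (rk M - rank_of M F) (klp (contraction M F)))
    = (\<Sum>F\<in>flats M. monom 1 (rank_of M F) * klp (contraction M F))"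
proof -
  interpret is_matroid M using M by (rule matroid_of_loopless)
  define T where "T F = reverse_poly (rk M - rank_of M F) (klp (contraction M F))
        - monom 1 (rank_of M F) * klp (contraction M F)" for F
  have coeff_T: "coeff (T F) i =
     (if i \<le> rk M - rank_of M F then coeff (klp (contraction M F)) (rk M - rank_of M F - i) else 0)
     - (if rank_of M F \<le> i then coeff (klp (contraction M F)) (i - rank_of M F) else 0)"
    and deg: "degree (klp (contraction M F)) \<le> rk M - rank_of M F" if "F \<in> flats M" for F i
  proof -
    show "degree (klp (contraction M F)) \<le> rk M - rank_of M F"
      using degree_klp_le[OF loopless_contraction[OF that]] rk_contraction[OF flat_subset[OF that]] by simp
    then show "coeff (T F) i =
     (if i \<le> rk M - rank_of M F then coeff (klp (contraction M F)) (rk M - rank_of M F - i) else 0)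
     - (if rank_of M F \<le> i then coeff (klp (contraction M F)) (i - rank_of M F) else 0)"
      by (simp add: T_def coeff_reverse_poly coeff_monom_mult)
  qed
  have "(\<Sum>F\<in>flats M. T F) = 0"
  proof (cases "rk M = 0")
    case True
    then have "ground M = {}" using loopless_rank_0[OF M] by simp
    then have "flats M = {{}}" using ground_flat flat_subset by auto
    then show ?thesis using True M by (simp add: T_def contraction_empty klp_rank_0)
  next
    case False
    let ?D = "\<Sum>F\<in>flats M - {{}}. T F"
    \<comment> \<open>Swapping \<open>i\<close> with \<open>rk M - i\<close> exchanges the two parts
      of each \<open>T F\<close>.\<close>
    have anti: "coeff ?D (rk M - i) = - coeff ?D i" if "i \<le> rk M" for i
      unfolding coeff_sum sum_negf[symmetric]
    proof (rule sum.cong)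
      fix F assume "F \<in> flats M - {{}}"
      then have F: "F \<in> flats M" by simp
      have k: "rank_of M F \<le> rk M" by (rule rank_le_rk)
      have "rk M - i \<le> rk M - rank_of M F \<longleftrightarrow> rank_of M F \<le> i"
        "rank_of M F \<le> rk M - i \<longleftrightarrow> i \<le> rk M - rank_of M F"
        "rank_of M F \<le> i \<Longrightarrow> rk M - rank_of M F - (rk M - i) = i - rank_of M F"
        "rk M - i - rank_of M F = rk M - rank_of M F - i" using k that by auto
      then show "coeff (T F) (rk M - i) = - coeff (T F) i"
        by (simp add: coeff_T[OF F])
    qed simp
    have zero: "coeff ?D i = 0" if "i > rk M" for i
      unfolding coeff_sum
    proof (rule sum.neutral, rule ballI)
      fix F assume "F \<in> flats M - {{}}"
      then have F: "F \<in> flats M" by simp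
      have "i - rank_of M F > degree (klp (contraction M F))"
        using deg[OF F] that rank_le_rk[of F] by linarith
      then show "coeff (T F) i = 0" using that by (simp add: coeff_T[OF F] coeff_eq_0)
    qed
    have "klp M = lower_half (rk M) ?D"
      using M False by (subst klp.simps) (simp add: T_def)
    moreover have "T {} = reverse_poly (rk M) (klp M) - klp M"
      by (simp add: T_def contraction_empty)
    ultimately have "T {} + ?D = 0" using reverse_lower_half[of "rk M" ?D] False anti zero by simp
    then show ?thesis using sum.remove[OF finite_flats empty_flat[OF M], of T] by simp
  qed
  then show ?thesis by (simp add: T_def sum_subtractf)
qed

text \<open>Palindromicity of the contraction at \<open>G\<close>, transported to the flats of
  \<open>M\<close> above \<open>G\<close>; this is the form that Moebius inversion consumes.\<close>

lemma klp_palindromic_interval: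
  assumes M: "loopless_matroid M" and G: "G \<in> flats M"
  shows "(\<Sum>F\<in>{F \<in> flats M. G \<subseteq> F}. reverse_poly (rk M - rank_of M F) (klp (contraction M F)))
    = (\<Sum>F\<in>{F \<in> flats M. G \<subseteq> F}. monom 1 (rank_of M F - rank_of M G) * klp (contraction M F))"
proof -
  interpret is_matroid M using M by (rule matroid_of_loopless)
  have GE: "G \<subseteq> ground M" using G by (rule flat_subset)
  let ?C = "contraction M G"
  have *: "rank_of ?C (F - G) = rank_of M F - rank_of M G" "contraction ?C (F - G) = contraction M F"
    "rk ?C - rank_of ?C (F - G) = rk M - rank_of M F"
    if "F \<in> flats M" "G \<subseteq> F" for F
  proof -
    have F: "F \<subseteq> ground M" using that flat_subset by auto
    show 1: "rank_of ?C (F - G) = rank_of M F - rank_of M G"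
      using rank_contraction[OF GE, of "F - G"] F that by (simp add: Un_absorb2 Diff_mono)
    show "contraction ?C (F - G) = contraction M F" by (rule contraction_contraction[OF GE F that(2)])
    show "rk ?C - rank_of ?C (F - G) = rk M - rank_of M F"
      using 1 rk_contraction[OF GE] rank_mono[OF that(2)] rank_le_rk[of F] by simp
  qed
  have "(\<Sum>F\<in>flats ?C. reverse_poly (rk ?C - rank_of ?C F) (klp (contraction ?C F)))
     = (\<Sum>F\<in>flats ?C. monom 1 (rank_of ?C F) * klp (contraction ?C F))"
    by (rule klp_palindromic[OF loopless_contraction[OF G]])
  then show ?thesis
    unfolding flats_contraction[OF G] sum.reindex[OF inj_on_Diff_flats] using * by simp
qed

section \<open>Moebius inversion, existence and uniqueness\<close>

lemma mobius_lower_interval: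
  assumes "finite G" "G \<subseteq> F"
  shows "mobius {G \<in> L. G \<subseteq> F} A G = mobius L A G"
  using assms
proof (induction G rule: finite_psubset_induct)
  case (psubset G)
  have "{C \<in> {G \<in> L. G \<subseteq> F}. A \<subseteq> C \<and> C \<subset> G} = {C \<in> L. A \<subseteq> C \<and> C \<subset> G}" using psubset by auto
  moreover have "(\<Sum>C\<in>{C \<in> L. A \<subseteq> C \<and> C \<subset> G}. mobius {G \<in> L. G \<subseteq> F} A C)
     = (\<Sum>C\<in>{C \<in> L. A \<subseteq> C \<and> C \<subset> G}. mobius L A C)"
    using psubset by (intro sum.cong) auto
  ultimately show ?case by (subst (1 2) mobius.simps) simp
qed

lemma sum_mobius:
  assumes "finite F" "F \<in> L" "{} \<in> L"
  shows "(\<Sum>G\<in>{G \<in> L. G \<subseteq> F}. mobius L {} G) = (if F = {} then 1 else 0)"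
proof (cases "F = {}")
  case True
  then have "{G \<in> L. G \<subseteq> F} = {{}}" using assms by auto
  then show ?thesis using True by (simp add: mobius.simps)
next
  case False
  have "{G \<in> L. G \<subseteq> F} = insert F {C \<in> L. {} \<subseteq> C \<and> C \<subset> F}" using assms by auto
  moreover have "finite {C \<in> L. {} \<subseteq> C \<and> C \<subset> F}"
    by (rule finite_subset[of _ "Pow F"]) (use assms in auto)
  ultimately have "(\<Sum>G\<in>{G \<in> L. G \<subseteq> F}. mobius L {} G)
     = mobius L {} F + (\<Sum>C\<in>{C \<in> L. {} \<subseteq> C \<and> C \<subset> F}. mobius L {} C)" by simp
  moreover have "mobius L {} F = - (\<Sum>C\<in>{C \<in> L. {} \<subseteq> C \<and> C \<subset> F}. mobius L {} C)"
    using False assms by (subst mobius.simps) auto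
  ultimately show ?thesis using False by simp
qed

lemma characteristic_poly_localization:
  assumes M: "loopless_matroid M" and F: "F \<in> flats M"
  shows "characteristic_poly (localization M F) =
    (\<Sum>G\<in>{G \<in> flats M. G \<subseteq> F}. monom (mobius (flats M) {} G) (rank_of M F - rank_of M G))"
proof -
  interpret is_matroid M using M by (rule matroid_of_loopless)
  have fl: "flats (localization M F) = {G \<in> flats M. G \<subseteq> F}" by (rule flats_localization[OF F])
  have "\<Inter> {G \<in> flats M. G \<subseteq> F} = {}" using empty_flat[OF M] by auto
  moreover have "rk (localization M F) = rank_of M F"
    by (simp add: rk_def localization_def) (use rank_localization[of F F] in \<open>simp add: localization_def\<close>)
  ultimately show ?thesis
    unfolding characteristic_poly_def fl
    by (intro sum.cong) (auto simp: mobius_lower_interval finite_flat rank_localization)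
qed

text \<open>Expanding the characteristic polynomials and exchanging sums makes each inner sum range
  over the interval above \<open>G\<close>. Palindromicity there replaces it by reversals, and after
  exchanging back the Moebius values cancel except at the empty flat.\<close>

lemma klp_recursion:
  assumes M: "loopless_matroid M"
  shows "reverse_poly (rk M) (klp M) =
    (\<Sum>F\<in>flats M. characteristic_poly (localization M F) * klp (contraction M F))"
proof -
  interpret is_matroid M using M by (rule matroid_of_loopless)
  let ?L = "flats M"
  define \<mu> where "\<mu> G = [:mobius ?L {} G:]" for G
  define R where "R F = reverse_poly (rk M - rank_of M F) (klp (contraction M F))" for F
  have swap: "(\<Sum>F\<in>?L. \<Sum>G\<in>{G \<in> ?L. G \<subseteq> F}. f F G) = (\<Sum>G\<in>?L. \<Sum>F\<in>{F \<in> ?L. G \<subseteq> F}. f F G)"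
    for f :: "'a set \<Rightarrow> 'a set \<Rightarrow> int poly"
    by (rule sum.swap_restrict[OF finite_flats finite_flats])
  have "(\<Sum>F\<in>?L. characteristic_poly (localization M F) * klp (contraction M F))
     = (\<Sum>F\<in>?L. \<Sum>G\<in>{G \<in> ?L. G \<subseteq> F}. \<mu> G * (monom 1 (rank_of M F - rank_of M G) * klp (contraction M F)))"
    by (intro sum.cong) (auto simp: characteristic_poly_localization[OF M] sum_distrib_right \<mu>_def
        mult.assoc[symmetric] smult_monom intro!: sum.cong)
  also have "\<dots> = (\<Sum>G\<in>?L. \<mu> G * (\<Sum>F\<in>{F \<in> ?L. G \<subseteq> F}. monom 1 (rank_of M F - rank_of M G) * klp (contraction M F)))"
    unfolding swap sum_distrib_left ..
  also have "\<dots> = (\<Sum>G\<in>?L. \<mu> G * (\<Sum>F\<in>{F \<in> ?L. G \<subseteq> F}. R F))"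
    using klp_palindromic_interval[OF M] by (simp add: R_def)
  also have "\<dots> = (\<Sum>F\<in>?L. (\<Sum>G\<in>{G \<in> ?L. G \<subseteq> F}. \<mu> G) * R F)"
    unfolding sum_distrib_left sum_distrib_right swap[symmetric] ..
  also have "\<dots> = (\<Sum>F\<in>?L. if F = {} then R F else 0)"
  proof (rule sum.cong)
    fix F assume F: "F \<in> ?L"
    have "(\<Sum>G\<in>{G \<in> ?L. G \<subseteq> F}. \<mu> G) = [:\<Sum>G\<in>{G \<in> ?L. G \<subseteq> F}. mobius ?L {} G:]"
      unfolding \<mu>_def by (induction rule: infinite_finite_induct) (auto simp: )
    then show "(\<Sum>G\<in>{G \<in> ?L. G \<subseteq> F}. \<mu> G) * R F = (if F = {} then R F else 0)"
      using sum_mobius[OF finite_flat[OF F] F empty_flat[OF M]] by simp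
  qed simp
  also have "\<dots> = R {}" using empty_flat[OF M] finite_flats by simp
  finally show ?thesis by (simp add: R_def contraction_empty)
qed

lemma is_KL_assignment_klp: "is_KL_assignment klp"
  unfolding is_KL_assignment_def
  by (auto simp: klp_rank_0 degree_klp klp_recursion) (simp add: klp.simps)

text \<open>Induction on the size of the ground set: the localization at the empty flat has
  characteristic polynomial 1, so the recursion isolates the reversal of the value at
  \<open>M\<close> minus the value itself, and the degree bound recovers the value.\<close>

lemma is_KL_assignment_unique:
  fixes P Q :: "'a matroid \<Rightarrow> int poly"
  assumes P: "is_KL_assignment P" and Q: "is_KL_assignment Q"
  shows "P = Q"
proof
  fix M :: "'a matroid"
  show "P M = Q M"
  proof (induction "card (ground M)" arbitrary: M rule: less_induct)
    case less
    show ?case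
    proof (cases "loopless_matroid M \<and> rk M > 0")
      case False
      then show ?thesis using P Q unfolding is_KL_assignment_def by (metis gr0I)
    next
      case True
      then have M: "loopless_matroid M" and r: "rk M > 0" by auto
      interpret is_matroid M using M by (rule matroid_of_loopless)
      have eq: "P (contraction M F) = Q (contraction M F)" if "F \<in> flats M - {{}}" for F
        using that flat_subset[of F] finite_ground by (intro less) (auto intro!: psubset_card_mono)
      have char: "characteristic_poly (localization M {}) = 1"
      proof -
        have "{G \<in> flats M. G \<subseteq> {}} = {{}}" using empty_flat[OF M] by auto
        then show ?thesis using characteristic_poly_localization[OF M empty_flat[OF M]]
          by (simp add: mobius.simps)
      qed
      have step: "reverse_poly (rk M) (R M) - R M =
          (\<Sum>F\<in>flats M - {{}}. characteristic_poly (localization M F) * R (contraction M F))"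
        if "is_KL_assignment R" for R :: "'a matroid \<Rightarrow> int poly"
        using that M sum.remove[OF finite_flats empty_flat[OF M], of
            "\<lambda>F. characteristic_poly (localization M F) * R (contraction M F)"]
        by (simp add: is_KL_assignment_def char contraction_empty)
      have "reverse_poly (rk M) (P M) - P M = reverse_poly (rk M) (Q M) - Q M"
        unfolding step[OF P] step[OF Q] using eq by (intro sum.cong) auto
      then show ?thesis
        using P Q M r by (intro reverse_poly_diff_unique[of "P M" "rk M" "Q M"])
          (auto simp: is_KL_assignment_def)
    qed
  qed
qed

lemma KL_poly_eq_klp: "KL_poly = klp"
  unfolding KL_poly_def
  using is_KL_assignment_klp is_KL_assignment_unique by (intro the_equality)

text \<open>The verification principle, with \<open>g F\<close> as candidate for the polynomial of
  the contraction at \<open>F\<close>. By induction on the corank the terms strictly above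
  \<open>A\<close> are known, which leaves equal reversal differences at \<open>A\<close>.\<close>

lemma KL_poly_eqI:
  assumes M: "loopless_matroid M"
    and top: "g (ground M) = 1"
    and deg: "\<And>F. F \<in> flats M \<Longrightarrow> F \<noteq> ground M \<Longrightarrow> 2 * degree (g F) < rk M - rank_of M F"
    and palindromic: "\<And>A. A \<in> flats M \<Longrightarrow>
      (\<Sum>F\<in>{F \<in> flats M. A \<subseteq> F}. reverse_poly (rk M - rank_of M F) (g F))
      = (\<Sum>F\<in>{F \<in> flats M. A \<subseteq> F}. monom 1 (rank_of M F - rank_of M A) * g F)"
  shows "KL_poly M = g {}"
proof -
  interpret is_matroid M using M by (rule matroid_of_loopless)
  have "klp (contraction M A) = g A" if "A \<in> flats M" for A
    using that
  proof (induction "rk M - rank_of M A" arbitrary: A rule: less_induct)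
    case less
    note A = \<open>A \<in> flats M\<close>
    have lc: "loopless_matroid (contraction M A)" by (rule loopless_contraction[OF A])
    have rkc: "rk (contraction M A) = rk M - rank_of M A" by (rule rk_contraction[OF flat_subset[OF A]])
    show ?case
    proof (cases "A = ground M")
      case True
      then show ?thesis using top klp_rank_0[OF lc] rkc by (simp add: rk_def)
    next
      case False
      then have pos: "rank_of M A < rk M"
        using flat_rank_less[OF A, of "ground M"] flat_subset[OF A] by (auto simp: rk_def)
      let ?S = "{F \<in> flats M. A \<subseteq> F}"
      have fin: "finite ?S" using finite_flats by auto
      have AS: "A \<in> ?S" using A by auto
      have eq: "klp (contraction M F) = g F" if "F \<in> ?S - {A}" for F
      proof (rule less)
        have "rank_of M A < rank_of M F" using that flat_subset by (intro flat_rank_less[OF A]) auto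
        then show "rk M - rank_of M F < rk M - rank_of M A" using rank_le_rk[of F] by linarith
      qed (use that in auto)
      have *: "reverse_poly (rk M - rank_of M A) (h A) - h A =
          (\<Sum>F\<in>?S - {A}. monom 1 (rank_of M F - rank_of M A) * h F - reverse_poly (rk M - rank_of M F) (h F))"
        if "(\<Sum>F\<in>?S. reverse_poly (rk M - rank_of M F) (h F)) =
          (\<Sum>F\<in>?S. monom 1 (rank_of M F - rank_of M A) * h F)" for h
        using that sum.remove[OF fin AS, of "\<lambda>F. reverse_poly (rk M - rank_of M F) (h F)"]
          sum.remove[OF fin AS, of "\<lambda>F. monom 1 (rank_of M F - rank_of M A) * h F"]
        by (simp add: sum_subtractf algebra_simps)
      have "reverse_poly (rk M - rank_of M A) (klp (contraction M A)) - klp (contraction M A)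
          = reverse_poly (rk M - rank_of M A) (g A) - g A"
        unfolding *[OF palindromic[OF A]] *[OF klp_palindromic_interval[OF M A]]
        using eq by (intro sum.cong) auto
      moreover have "2 * degree (klp (contraction M A)) < rk M - rank_of M A"
        using degree_klp[OF lc] rkc pos by simp
      ultimately show ?thesis by (intro reverse_poly_diff_unique[OF _ deg[OF A False]])
    qed
  qed
  from this[OF empty_flat[OF M]] show ?thesis by (simp add: KL_poly_eq_klp contraction_empty)
qed

section \<open>Graphic matroids and relaxations\<close>

text \<open>A closure with the Steinitz exchange property on a whole type. It serves to obtain the
  augmentation axiom for forests from connectivity instead of from manipulating cycles.\<close>

locale exchange_closure =
  fixes cl :: "'a set \<Rightarrow> 'a set"
  assumes extensive: "X \<subseteq> cl X"
    and least: "X \<subseteq> cl Y \<Longrightarrow> cl X \<subseteq> cl Y"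
    and exchange: "y \<in> cl (insert x X) \<Longrightarrow> y \<notin> cl X \<Longrightarrow> x \<in> cl (insert y X)"
begin

definition independent :: "'a set \<Rightarrow> bool" where
  "independent I \<longleftrightarrow> (\<forall>x\<in>I. x \<notin> cl (I - {x}))"

lemma mono: "X \<subseteq> Y \<Longrightarrow> cl X \<subseteq> cl Y"
  using extensive[of Y] by (intro least) auto

lemma independent_subset: "independent I \<Longrightarrow> J \<subseteq> I \<Longrightarrow> independent J"
  unfolding independent_def using mono[of "J - {_}" "I - {_}"] by blast

lemma in_cl_of_dependent:
  assumes "independent I" "\<not> independent (insert x I)" shows "x \<in> cl I"
proof -
  obtain y where y: "y \<in> insert x I" "y \<in> cl (insert x I - {y})"
    using assms(2) unfolding independent_def by blast
  show ?thesis
  proof (cases "y = x")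
    case True
    then show ?thesis using y mono[of "insert x I - {x}" I] by auto
  next
    case False
    then have "insert x I - {y} = insert x (I - {y})" "insert y (I - {y}) = I" using y by auto
    then show ?thesis using y False exchange[of y x "I - {y}"] assms(1) by (auto simp: independent_def)
  qed
qed

text \<open>Steinitz exchange: swapping some \<open>x\<close> in \<open>I - J\<close> for an element
  \<open>y\<close> of \<open>J - I\<close> keeps \<open>J\<close> in the closure and shrinks
  \<open>I - J\<close>.\<close>

lemma independent_card_le:
  assumes "finite I" "finite J" "independent J" "J \<subseteq> cl I"
  shows "card J \<le> card I"
  using assms
proof (induction "card (I - J)" arbitrary: I rule: less_induct)
  case less
  show ?case
  proof (cases "J \<subseteq> I")
    case True
    then show ?thesis using less.prems by (simp add: card_mono)
  next
    case False
    then obtain y where y: "y \<in> J" "y \<notin> I" by auto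
    \<comment> \<open>For a maximal such \<open>K\<close>, any further \<open>x\<close> from
      \<open>I\<close> puts \<open>y\<close> into the closure, so \<open>x\<close> and
      \<open>y\<close> can be exchanged; \<open>x\<close> is not in \<open>J\<close> because
      \<open>K\<close> contains \<open>I \<inter> J\<close>.\<close>
    let ?K = "{K. I \<inter> J \<subseteq> K \<and> K \<subseteq> I \<and> y \<notin> cl K}"
    have fin: "finite ?K" by (rule finite_subset[of _ "Pow I"]) (use less.prems in auto)
    have "y \<notin> cl (J - {y})" using less.prems y by (auto simp: independent_def)
    then have "I \<inter> J \<in> ?K" using mono[of "I \<inter> J" "J - {y}"] y by auto
    then obtain K where K: "K \<in> ?K" "\<And>L. L \<in> ?K \<Longrightarrow> K \<subseteq> L \<Longrightarrow> K = L"
      using finite_has_maximal[OF fin] by (metis (no_types, lifting) empty_iff)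
    have "K \<noteq> I" using K less.prems y by auto
    then obtain x where x: "x \<in> I" "x \<notin> K" using K by auto
    have "insert x K \<notin> ?K" using K(2)[of "insert x K"] x by auto
    then have "y \<in> cl (insert x K)" using K(1) x by auto
    then have "x \<in> cl (insert y K)" using exchange[of y x K] K(1) by auto
    moreover have "insert y K \<subseteq> insert y (I - {x})" using K(1) x by auto
    ultimately have "x \<in> cl (insert y (I - {x}))" using mono by blast
    then have "I \<subseteq> cl (insert y (I - {x}))" using extensive[of "insert y (I - {x})"] by auto
    then have J: "J \<subseteq> cl (insert y (I - {x}))" using least less.prems by blast
    have "x \<notin> J" using x K(1) by auto
    then have "insert y (I - {x}) - J \<subset> I - J" using x y by auto
    then have "card (insert y (I - {x}) - J) < card (I - J)"
      using less.prems by (intro psubset_card_mono) auto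
    from less.hyps[OF this _ less.prems(2,3) J] less.prems(1)
    have "card J \<le> card (insert y (I - {x}))" by simp
    also have "\<dots> = card I"
      using x(1) y(2) less.prems(1) card_Suc_Diff1[of I x] by simp
    finally show "card J \<le> card I" .
  qed
qed

lemma matroid_independent:
  assumes "finite E"
  shows "is_matroid \<lparr>ground = E, indeps = {I. I \<subseteq> E \<and> independent I}\<rparr>"
proof
  fix I J assume "I \<in> indeps \<lparr>ground = E, indeps = {I. I \<subseteq> E \<and> independent I}\<rparr>"
    "J \<in> indeps \<lparr>ground = E, indeps = {I. I \<subseteq> E \<and> independent I}\<rparr>" and less: "card I < card J"
  then have I: "I \<subseteq> E" "independent I" "finite I" and J: "J \<subseteq> E" "independent J" "finite J"
    using finite_subset[OF _ assms] by auto
  have "\<not> J \<subseteq> cl I" using independent_card_le[OF I(3) J(3,2)] less by auto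
  then obtain x where x: "x \<in> J" "x \<notin> cl I" by auto
  then have "x \<notin> I" "independent (insert x I)" using extensive in_cl_of_dependent[OF I(2)] by auto
  then show "\<exists>x\<in>J - I. insert x I \<in> indeps \<lparr>ground = E, indeps = {I. I \<subseteq> E \<and> independent I}\<rparr>"
    using x I J by auto
qed (use assms independent_subset in \<open>auto simp: independent_def\<close>)

end

section \<open>Connectivity closure of edge sets\<close>

definition adjacency :: "'v set set \<Rightarrow> ('v \<times> 'v) set" where
  "adjacency A = {(u, v). {u, v} \<in> A}"

text \<open>An edge is spanned when its ends are connected. The summand \<open>A\<close> keeps
  members that are not pairs, so that the closure laws hold for arbitrary sets of sets; reflexivity
  puts every singleton, a loop, into the closure.\<close>

definition edge_closure :: "'v set set \<Rightarrow> 'v set set" where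
  "edge_closure A = A \<union> {{u, v} |u v. (u, v) \<in> (adjacency A)\<^sup>*}"

lemma sym_adjacency: "sym (adjacency A)"
  by (auto simp: sym_def adjacency_def insert_commute)

lemma adjacency_rtrancl_sym: "(u, v) \<in> (adjacency A)\<^sup>* \<Longrightarrow> (v, u) \<in> (adjacency A)\<^sup>*"
  by (rule symD[OF sym_rtrancl[OF sym_adjacency]])

lemma doubleton_in_edge_closure:
  "{u, v} \<in> edge_closure A \<longleftrightarrow> (u, v) \<in> (adjacency A)\<^sup>*"
proof
  assume "{u, v} \<in> edge_closure A"
  then consider "{u, v} \<in> A" | a b where "{u, v} = {a, b}" "(a, b) \<in> (adjacency A)\<^sup>*"
    by (auto simp: edge_closure_def)
  then show "(u, v) \<in> (adjacency A)\<^sup>*"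
  proof cases
    case 1
    then show ?thesis by (auto simp: adjacency_def)
  next
    case 2
    then show ?thesis using adjacency_rtrancl_sym by (fastforce simp: doubleton_eq_iff)
  qed
qed (auto simp: edge_closure_def)

lemma adjacency_insert: "adjacency (insert {a, b} A) = insert (a, b) (insert (b, a) (adjacency A))"
  by (auto simp: adjacency_def doubleton_eq_iff)

interpretation edge_closure: exchange_closure edge_closure
proof
  show "X \<subseteq> edge_closure X" for X :: "'a set set" by (auto simp: edge_closure_def)
  show "edge_closure X \<subseteq> edge_closure Y" if "X \<subseteq> edge_closure Y" for X Y :: "'a set set"
  proof -
    have "adjacency X \<subseteq> (adjacency Y)\<^sup>*"
    proof (rule subrelI)
      fix u v assume "(u, v) \<in> adjacency X"
      then have "{u, v} \<in> edge_closure Y" using that by (auto simp: adjacency_def)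
      then show "(u, v) \<in> (adjacency Y)\<^sup>*" by (simp add: doubleton_in_edge_closure)
    qed
    then have "(adjacency X)\<^sup>* \<subseteq> (adjacency Y)\<^sup>*" by (rule rtrancl_subset_rtrancl)
    then show ?thesis using that unfolding edge_closure_def by blast
  qed
  show "x \<in> edge_closure (insert y X)" if "y \<in> edge_closure (insert x X)" "y \<notin> edge_closure X"
    for x y :: "'a set" and X
  proof (cases "y = x \<or> (\<nexists>a b. x = {a, b})")
    case True
    then have "y = x \<or> adjacency (insert x X) = adjacency X" by (auto simp: adjacency_def)
    then show ?thesis using that by (auto simp: edge_closure_def)
  next
    case False
    then obtain a b where x: "x = {a, b}" by auto
    have yc: "y \<in> edge_closure (insert x X)" using that by simp
    have "y \<notin> insert x X" using False that by (auto simp: edge_closure_def)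
    then obtain u v where y: "y = {u, v}" "(u, v) \<in> (adjacency (insert x X))\<^sup>*"
      using yc unfolding edge_closure_def by blast
    have nuv: "(u, v) \<notin> (adjacency X)\<^sup>*" using that y by (simp add: doubleton_in_edge_closure)
    have "(adjacency X)\<^sup>* \<subseteq> (adjacency (insert y X))\<^sup>*"
      by (rule rtrancl_mono) (auto simp: adjacency_def)
    moreover have "(u, v) \<in> (adjacency (insert y X))\<^sup>*" using y by (auto simp: adjacency_def)
    \<comment> \<open>A walk from \<open>u\<close> to \<open>v\<close> must use the new edge, in one
      of its two directions, because without it \<open>u\<close> and \<open>v\<close> are not
      connected.\<close>
    moreover have "(u, a) \<in> (adjacency X)\<^sup>* \<and> (b, v) \<in> (adjacency X)\<^sup>* \<or>
        (u, b) \<in> (adjacency X)\<^sup>* \<and> (a, v) \<in> (adjacency X)\<^sup>*"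
      using y(2) nuv unfolding x adjacency_insert rtrancl_insert
      by (auto intro: rtrancl_trans)
    ultimately have "(a, b) \<in> (adjacency (insert y X))\<^sup>*"
      using adjacency_rtrancl_sym by (metis (no_types, lifting) rtrancl_trans subsetD)
    then show ?thesis by (simp add: x doubleton_in_edge_closure)
  qed
qed

lemma rtrancl_distinct_path:
  assumes "(u, v) \<in> R\<^sup>*"
  shows "\<exists>vs. vs \<noteq> [] \<and> distinct vs \<and> hd vs = u \<and> last vs = v \<and>
    (\<forall>i. Suc i < length vs \<longrightarrow> (vs ! i, vs ! Suc i) \<in> R)"
  using assms
proof (induction rule: rtrancl_induct)
  case base
  show ?case by (rule exI[of _ "[u]"]) simp
next
  case (step v w)
  then obtain vs where vs: "vs \<noteq> []" "distinct vs" "hd vs = u" "last vs = v"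
    "\<And>i. Suc i < length vs \<Longrightarrow> (vs ! i, vs ! Suc i) \<in> R" by blast
  show ?case
  proof (cases "w \<in> set vs")
    case True
    then obtain k where k: "k < length vs" "vs ! k = w" by (auto simp: in_set_conv_nth)
    then have "last (take (Suc k) vs) = w" by (simp add: take_Suc_conv_app_nth)
    then show ?thesis
      using vs k by (intro exI[of _ "take (Suc k) vs"]) auto
  next
    case False
    have "((vs @ [w]) ! i, (vs @ [w]) ! Suc i) \<in> R" if "Suc i < length (vs @ [w])" for i
    proof (cases "Suc i = length vs")
      case True
      then have "vs ! i = v" using vs by (metis diff_Suc_1 last_conv_nth)
      then show ?thesis using True step by (auto simp: nth_append)
    next
      case False
      then show ?thesis using that vs(5)[of i] by (auto simp: nth_append)
    qed
    then show ?thesis using vs False by (intro exI[of _ "vs @ [w]"]) auto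
  qed
qed

text \<open>A cycle makes an edge on it dependent on the rest. Conversely, an edge whose ends are
  joined by other edges closes a repetition-free path into a cycle; as the edge itself is removed,
  that path has at least three vertices.\<close>

lemma forest_iff_independent:
  assumes A: "\<And>a. a \<in> A \<Longrightarrow> card a = 2"
  shows "forest A \<longleftrightarrow> edge_closure.independent A"
proof
  assume f: "forest A"
  show "edge_closure.independent A"
    unfolding edge_closure.independent_def
  proof (intro ballI notI)
    fix a assume a: "a \<in> A" "a \<in> edge_closure (A - {a})"
    then obtain u v where uv: "a = {u, v}" "u \<noteq> v" using A by (meson card_2_iff)
    then have "(u, v) \<in> (adjacency (A - {a}))\<^sup>*" using a doubleton_in_edge_closure by metis
    then obtain vs where vs: "vs \<noteq> []" "distinct vs" "hd vs = u" "last vs = v"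
      "\<And>i. Suc i < length vs \<Longrightarrow> {vs ! i, vs ! Suc i} \<in> A - {a}"
      using rtrancl_distinct_path[of u v "adjacency (A - {a})"]
      unfolding adjacency_def mem_Collect_eq case_prod_conv by blast
    have first: "vs ! 0 = u" using vs by (simp add: hd_conv_nth)
    have last: "vs ! (length vs - 1) = v" using vs by (simp add: last_conv_nth)
    have "length vs \<noteq> 1" "length vs \<noteq> 2" "length vs \<noteq> 0"
      using first last uv vs(5)[of 0] vs(1) by auto
    then have len: "3 \<le> length vs" by linarith
    have "{vs ! i, vs ! (Suc i mod length vs)} \<in> A" if "i < length vs" for i
    proof (cases "Suc i < length vs")
      case True
      then show ?thesis using vs(5)[of i] by simp
    next
      case False
      then have i: "i = length vs - 1" "Suc i = length vs" using that by auto
      have "{vs ! i, vs ! (Suc i mod length vs)} = {v, u}"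
        unfolding i(2) using first last i(1) by simp
      then show ?thesis using a uv by (simp add: insert_commute)
    qed
    then have "is_cycle A vs" using vs len by (simp add: is_cycle_def)
    then show False using f by (auto simp: forest_def)
  qed
next
  assume ind: "edge_closure.independent A"
  show "forest A" unfolding forest_def
  proof
    assume "\<exists>vs. is_cycle A vs"
    then obtain vs where vs: "3 \<le> length vs" "distinct vs"
      "\<And>i. i < length vs \<Longrightarrow> {vs ! i, vs ! (Suc i mod length vs)} \<in> A"
      by (auto simp: is_cycle_def)
    let ?l = "length vs - 1"
    let ?a = "{vs ! 0, vs ! ?l}"
    have "Suc ?l = length vs" using vs(1) by simp
    then have a: "?a \<in> A" using vs(3)[of ?l] by (simp add: insert_commute)
    have "(vs ! 0, vs ! k) \<in> (adjacency (A - {?a}))\<^sup>*" if "k < length vs" for k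
      using that
    proof (induction k)
      case (Suc k)
      have "{vs ! k, vs ! Suc k} \<in> A" using vs(3)[of k] Suc by simp
      moreover have "{vs ! k, vs ! Suc k} \<noteq> ?a"
      proof
        assume "{vs ! k, vs ! Suc k} = ?a"
        then have "vs ! Suc k = vs ! 0 \<or> vs ! Suc k = vs ! ?l \<and> vs ! k = vs ! 0"
          by (auto simp: doubleton_eq_iff)
        then have "Suc k = ?l \<and> k = 0"
          using Suc.prems vs(1) nth_eq_iff_index_eq[OF vs(2), of "Suc k" 0] nth_eq_iff_index_eq[OF vs(2), of k 0]
            nth_eq_iff_index_eq[OF vs(2), of "Suc k" ?l] by fastforce
        then show False using vs(1) by auto
      qed
      ultimately have "(vs ! k, vs ! Suc k) \<in> adjacency (A - {?a})" by (simp add: adjacency_def)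
      then show ?case using Suc by (auto intro: rtrancl_into_rtrancl)
    qed simp
    then have "?a \<in> edge_closure (A - {?a})"
      using vs(1) by (auto simp: doubleton_in_edge_closure)
    then show False using ind a by (auto simp: edge_closure.independent_def)
  qed
qed

lemma loopless_graphic_matroid:
  assumes "finite (edges G)" and e: "\<And>a. a \<in> edges G \<Longrightarrow> card a = 2"
  shows "loopless_matroid (graphic_matroid G)"
proof -
  have "{A. A \<subseteq> edges G \<and> forest A} = {A. A \<subseteq> edges G \<and> edge_closure.independent A}"
    using forest_iff_independent e by blast
  then have "is_matroid (graphic_matroid G)"
    using edge_closure.matroid_independent[OF assms(1)] by (simp add: graphic_matroid_def)
  moreover have "forest {a}" if a: "a \<in> edges G" for a
  proof -
    obtain u v where "a = {u, v}" "u \<noteq> v" using e[OF a] by (meson card_2_iff)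
    then have "a \<notin> edge_closure {}" by (auto simp: doubleton_in_edge_closure adjacency_def)
    then show ?thesis using e[OF a] by (subst forest_iff_independent)
        (auto simp: edge_closure.independent_def)
  qed
  ultimately show ?thesis by (auto simp: loopless_matroid_def graphic_matroid_def)
qed

text \<open>Relaxation of a circuit-hyperplane, with its properties in checkable form: deleting an
  element of \<open>X\<close>, or swapping one for an outside element, gives an independent set, and
  \<open>X\<close> is at least as large as a basis.\<close>

lemma (in is_matroid) matroid_relaxation:
  assumes X: "X \<subseteq> ground M" "X \<noteq> {}"
    and circuit: "\<And>x. x \<in> X \<Longrightarrow> X - {x} \<in> indeps M"
    and hyperplane: "\<And>x y. x \<in> X \<Longrightarrow> y \<in> ground M - X \<Longrightarrow> insert y (X - {x}) \<in> indeps M"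
    and max: "rk M \<le> card X"
  shows "is_matroid \<lparr>ground = ground M, indeps = indeps M \<union> {X}\<rparr>"
proof
  have finX: "finite X" using X finite_ground finite_subset by blast
  have proper: "J \<in> indeps M" if J: "J \<subset> X" for J
  proof -
    obtain x where "x \<in> X - J" using J by auto
    then show ?thesis using indep_subset[OF circuit[of x], of J] J by auto
  qed
  show "J \<in> indeps \<lparr>ground = ground M, indeps = indeps M \<union> {X}\<rparr>"
    if "I \<in> indeps \<lparr>ground = ground M, indeps = indeps M \<union> {X}\<rparr>" "J \<subseteq> I" for I J
    using that proper[of J] indep_subset[of I J] by auto
  fix I J assume "I \<in> indeps \<lparr>ground = ground M, indeps = indeps M \<union> {X}\<rparr>"
    "J \<in> indeps \<lparr>ground = ground M, indeps = indeps M \<union> {X}\<rparr>" and less: "card I < card J"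
  then have I: "I \<in> indeps M \<or> I = X" and J: "J \<in> indeps M \<or> J = X" by auto
  have max': "card K \<le> card X" if "K \<in> indeps M" for K
    using that max card_le_rank[OF that indeps_subset_ground[OF that]] by (simp add: rk_def)
  then have Ii: "I \<in> indeps M" using I J less max'[of J] by force
  have "\<exists>x\<in>J - I. insert x I \<in> indeps M \<union> {X}"
  proof (cases "J \<in> indeps M")
    case True
    then show ?thesis using augment Ii less by blast
  next
    case False
    then have JX: "J = X" using J by simp
    show ?thesis
    proof (cases "I \<subseteq> X")
      case True
      then obtain x where "x \<in> X - I" using less JX by (metis Diff_eq_empty_iff equals0I less_irrefl subset_antisym)
      then show ?thesis using True proper[of "insert x I"] JX by (cases "insert x I = X") auto
    next
      case False
      then obtain y where y: "y \<in> I" "y \<notin> X" by auto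
      obtain z where z: "z \<in> X" using X by auto
      \<comment> \<open>Here \<open>J\<close> is the new basis \<open>X\<close> and \<open>I\<close>
        is not inside it. Augmenting from this independent set of the same size works instead:
        \<open>y\<close> is already in \<open>I\<close>, so the element found comes from
        \<open>X\<close>.\<close>
      have "insert y (X - {z}) \<in> indeps M"
        using y z hyperplane indeps_subset_ground[OF Ii] by auto
      moreover have "card (insert y (X - {z})) = card X"
        using y finX card_Suc_Diff1[OF finX z] by simp
      ultimately obtain x where "x \<in> insert y (X - {z}) - I" "insert x I \<in> indeps M"
        using augment[OF Ii, of "insert y (X - {z})"] less JX by auto
      then show ?thesis using y JX by auto
    qed
  qed
  then show "\<exists>x\<in>J - I. insert x I \<in> indeps \<lparr>ground = ground M, indeps = indeps M \<union> {X}\<rparr>" by simp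
next
  show "I \<subseteq> ground \<lparr>ground = ground M, indeps = indeps M \<union> {X}\<rparr>"
    if "I \<in> indeps \<lparr>ground = ground M, indeps = indeps M \<union> {X}\<rparr>" for I
    using that X indeps_subset_ground by auto
qed (use finite_ground empty_indep in auto)

section \<open>Words of tokens\<close>

datatype token = Spoke | New | Glue

instance token :: finite
proof
  have "(UNIV :: token set) = {Spoke, New, Glue}" by (auto intro: token.exhaust)
  then show "finite (UNIV :: token set)" by (metis finite.emptyI finite_insert)
qed

text \<open>\<open>compat b a c\<close>: the token \<open>c\<close> of a flat above a flat with token \<open>a\<close> at the same vertex,
  where \<open>b\<close> says that the larger flat does not contain the spoke at the preceding vertex.\<close>
fun compat :: "bool \<Rightarrow> token \<Rightarrow> token \<Rightarrow> bool" where
  "compat b Spoke c \<longleftrightarrow> c = Spoke"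
| "compat b New c \<longleftrightarrow> (c = Glue \<longrightarrow> b)"
| "compat b Glue c \<longleftrightarrow> c = (if b then Glue else Spoke)"

text \<open>The words of the closed sets above the one with word \<open>A\<close>, generated by a
  left-to-right automaton whose only state is the flag of \<open>compat\<close>.\<close>

fun ups :: "bool \<Rightarrow> token list \<Rightarrow> token list set" where
  "ups b [] = {[]}"
| "ups b (a # A) = (\<Union>c\<in>{c. compat b a c}. (#) c ` ups (c \<noteq> Spoke) A)"

abbreviation num_new :: "token list \<Rightarrow> nat" where
  "num_new C \<equiv> count_list C New"

text \<open>The state in which the automaton of \<open>ups\<close> is left after \<open>C\<close>;
  the start value survives only through the empty word.\<close>

definition open_after :: "bool \<Rightarrow> token list \<Rightarrow> bool" where
  "open_after b C = (if C = [] then b else last C \<noteq> Spoke)"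

lemma open_after_simps [simp]:
  "open_after b [] = b" "open_after b (c # C) = open_after (c \<noteq> Spoke) C"
  by (auto simp: open_after_def)

lemma open_after_append: "open_after b (C @ D) = open_after (open_after b C) D"
  by (auto simp: open_after_def)

lemma length_ups: "C \<in> ups b A \<Longrightarrow> length C = length A"
  by (induction b A arbitrary: C rule: ups.induct) auto

lemma finite_ups: "finite (ups b A)"
  by (induction b A rule: ups.induct) auto

lemma Cons_in_ups: "c # C \<in> ups b (a # A) \<longleftrightarrow> compat b a c \<and> C \<in> ups (c \<noteq> Spoke) A"
  by auto

lemma in_ups_iff_nth:
  "C \<in> ups b A \<longleftrightarrow> length C = length A \<and>
    (\<forall>i<length A. compat (if i = 0 then b else C ! (i - 1) \<noteq> Spoke) (A ! i) (C ! i))"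
proof (induction A arbitrary: b C)
  case (Cons a A)
  show ?case
  proof (cases C)
    case (Cons c C')
    have "(if i = 0 then c \<noteq> Spoke else C' ! (i - 1) \<noteq> Spoke) = ((c # C') ! i \<noteq> Spoke)" for i
      by (cases i) auto
    then show ?thesis unfolding Cons Cons_in_ups Cons.IH by (auto simp: All_less_Suc2)
  qed auto
qed auto

lemma append_in_ups:
  "length C = length A \<Longrightarrow> C @ D \<in> ups b (A @ B) \<longleftrightarrow> C \<in> ups b A \<and> D \<in> ups (open_after b C) B"
proof (induction A arbitrary: b C)
  case (Cons a A)
  then obtain c C' where "C = c # C'" by (cases C) auto
  then show ?case using Cons by (simp del: ups.simps add: Cons_in_ups)
qed simp

lemma num_new_ups: "C \<in> ups b A \<Longrightarrow> num_new C \<le> num_new A"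
proof (induction A arbitrary: b C)
  case (Cons a A)
  then obtain c C' where C: "C = c # C'" "compat b a c" "C' \<in> ups (c \<noteq> Spoke) A" by auto
  have "c = New \<Longrightarrow> a = New" using C(2) by (cases a) (auto split: if_splits)
  then show ?case using Cons.IH[OF C(3)] C(1) by auto
qed simp

lemma sum_ups_Cons:
  "sum f (ups b (a # A)) = (\<Sum>c\<in>{c. compat b a c}. \<Sum>C\<in>ups (c \<noteq> Spoke) A. f (c # C))"
  unfolding ups.simps by (subst sum.UNION_disjoint) (auto simp: finite_ups sum.reindex)

lemma compat_sets:
  "{c. compat b Spoke c} = {Spoke}"
  "{c. compat b New c} = (if b then {Spoke, New, Glue} else {Spoke, New})"
  "{c. compat b Glue c} = (if b then {Glue} else {Spoke})"
proof -
  show "{c. compat b New c} = (if b then {Spoke, New, Glue} else {Spoke, New})"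
    using token.exhaust by auto
qed auto

text \<open>In \<open>scan w \<phi> m C\<close>, \<open>m\<close> counts the segments of the current run of vertices off the hub; a run
  ended by a spoke contributes its weight \<open>w\<close>, and the last run contributes \<open>\<phi>\<close>.\<close>
fun scan :: "(nat \<Rightarrow> 'a::comm_ring_1) \<Rightarrow> (nat \<Rightarrow> 'a) \<Rightarrow> nat \<Rightarrow> token list \<Rightarrow> 'a" where
  "scan w \<phi> m [] = \<phi> m"
| "scan w \<phi> m (Spoke # C) = w m * scan w \<phi> 0 C"
| "scan w \<phi> m (New # C) = scan w \<phi> (Suc m) C"
| "scan w \<phi> m (Glue # C) = scan w \<phi> m C"

text \<open>Cyclic version: the first and the last run form one run; \<open>v\<close> is the weight of a word without
  spokes.\<close>
fun cyc_scan :: "(nat \<Rightarrow> 'a::comm_ring_1) \<Rightarrow> (nat \<Rightarrow> 'a) \<Rightarrow> nat \<Rightarrow> token list \<Rightarrow> 'a" where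
  "cyc_scan w v m [] = v m"
| "cyc_scan w v m (Spoke # C) = scan w (\<lambda>k. w (m + k)) 0 C"
| "cyc_scan w v m (New # C) = cyc_scan w v (Suc m) C"
| "cyc_scan w v m (Glue # C) = cyc_scan w v m C"

section \<open>Cutting words at spokes\<close>

lemma scan_append: "scan w \<phi> m (C @ D) = scan w (\<lambda>k. scan w \<phi> k D) m C"
  by (induction w \<phi> m C rule: scan.induct) auto

lemma scan_no_spoke: "Spoke \<notin> set C \<Longrightarrow> scan w \<phi> m C = \<phi> (m + num_new C)"
  by (induction w \<phi> m C rule: scan.induct) auto

lemma cyc_scan_no_spoke: "Spoke \<notin> set C \<Longrightarrow> cyc_scan w v m C = v (m + num_new C)"
  by (induction w v m C rule: cyc_scan.induct) auto

lemma scan_mult: "scan w (\<lambda>k. c * \<phi> k) m C = c * scan w \<phi> m C"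
  by (induction w \<phi> m C rule: scan.induct) (auto simp: mult_ac)

lemma scan_append_Spoke: "scan w \<phi> m (C @ Spoke # D) = scan w w m C * scan w \<phi> 0 D"
proof -
  have "scan w \<phi> m (C @ Spoke # D) = scan w (\<lambda>k. scan w \<phi> 0 D * w k) m C"
    by (simp add: scan_append mult.commute)
  then show ?thesis unfolding scan_mult by (simp add: mult.commute)
qed

lemma cyc_scan_first_spoke:
  "Spoke \<notin> set C \<Longrightarrow> cyc_scan w v m (C @ Spoke # D) = scan w (\<lambda>k. w (m + num_new C + k)) 0 D"
  by (induction w v m C rule: cyc_scan.induct) auto

text \<open>A spoke separates runs, so a cyclic word may be cut at any spoke and read linearly from
  there; \<open>v\<close> then never enters.\<close>

lemma cyc_scan_Spoke:
  "cyc_scan w v 0 (C @ Spoke # D) = scan w w 0 (D @ C)"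
proof (cases "Spoke \<in> set C")
  case False
  then show ?thesis
    by (simp add: cyc_scan_first_spoke scan_append scan_no_spoke add.commute)
next
  case True
  then obtain C1 C2 where C: "C = C1 @ Spoke # C2" "Spoke \<notin> set C1"
    using split_list_first by metis
  have "cyc_scan w v 0 (C @ Spoke # D)
      = scan w w 0 C2 * scan w (\<lambda>k. w (num_new C1 + k)) 0 D"
    using C by (simp add: cyc_scan_first_spoke scan_append_Spoke)
  also have "scan w (\<lambda>k. w (num_new C1 + k)) 0 D = scan w w 0 (D @ C1)"
    using C(2) by (simp add: scan_append scan_no_spoke add.commute)
  finally show ?thesis
    using C(1) scan_append_Spoke[of w w 0 "D @ C1" C2] by (simp add: mult.commute)
qed

text \<open>One side of palindromicity: \<open>x = T\<close> with the weights themselves, or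
  \<open>x = 1\<close> with reversed weights. The flag of \<open>ups\<close> is \<open>m > 0\<close>
  because a run without segments stands right after a spoke, or at the beginning of a path, where
  nothing can be glued.\<close>

definition up_sum :: "'a::comm_ring_1 \<Rightarrow> (nat \<Rightarrow> 'a) \<Rightarrow> (nat \<Rightarrow> 'a) \<Rightarrow> nat \<Rightarrow> token list \<Rightarrow> 'a" where
  "up_sum x w \<phi> m A = (\<Sum>C\<in>ups (m > 0) A. x ^ (num_new A - num_new C) * scan w \<phi> m C)"

lemma up_sum_Nil: "up_sum x w \<phi> m [] = \<phi> m"
  by (simp add: up_sum_def)

lemma up_sum_Spoke: "up_sum x w \<phi> m (Spoke # A) = w m * up_sum x w \<phi> 0 A"
  unfolding up_sum_def sum_ups_Cons compat_sets
  by (simp add: sum_distrib_left mult_ac)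

text \<open>With a nonempty run the letter is forced to \<open>Glue\<close>; with an empty one it is
  forced to \<open>Spoke\<close>, which closes a run of weight \<open>w 0\<close>.\<close>

lemma up_sum_Glue: "w 0 = 1 \<Longrightarrow> up_sum x w \<phi> m (Glue # A) = up_sum x w \<phi> m A"
  unfolding up_sum_def sum_ups_Cons compat_sets
  by (cases "m = 0") (simp_all add: sum_distrib_left mult_ac)

lemma up_sum_New:
  "up_sum x w \<phi> m (New # A) =
    x * w m * up_sum x w \<phi> 0 A + up_sum x w \<phi> (Suc m) A + (if m > 0 then x * up_sum x w \<phi> m A else 0)"
proof -
  have *: "(\<Sum>C\<in>ups b A. x ^ (Suc (num_new A) - num_new C) * f C)
     = x * (\<Sum>C\<in>ups b A. x ^ (num_new A - num_new C) * f C)" for b f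
    unfolding sum_distrib_left
    by (intro sum.cong) (auto simp: Suc_diff_le num_new_ups mult_ac)
  have **: "(\<Sum>C\<in>ups b A. x ^ (num_new A - num_new C) * (c * f C))
     = c * (\<Sum>C\<in>ups b A. x ^ (num_new A - num_new C) * f C)" for b f c
    by (simp add: sum_distrib_left mult_ac)
  show ?thesis
    unfolding up_sum_def sum_ups_Cons compat_sets
    by (cases "m = 0") (simp_all add: * ** mult.assoc)
qed

lemma up_sum_append_Spoke:
  "w 0 = 1 \<Longrightarrow> up_sum x w \<phi> m (A @ Spoke # B) = up_sum x w w m A * up_sum x w \<phi> 0 B"
proof (induction A arbitrary: m)
  case Nil
  then show ?case by (simp add: up_sum_Nil up_sum_Spoke)
next
  case (Cons a A)
  then show ?case
    by (cases a) (simp_all add: up_sum_Glue up_sum_Spoke up_sum_New algebra_simps)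
qed

lemma up_sum_no_spoke:
  "w 0 = 1 \<Longrightarrow> Spoke \<notin> set A \<Longrightarrow> up_sum x w \<phi> m A = up_sum x w \<phi> m (replicate (num_new A) New)"
proof (induction A arbitrary: m)
  case (Cons a A)
  then show ?case by (cases a) (auto simp: up_sum_Glue up_sum_New)
qed simp

text \<open>Forced spokes split the sum into factors and letters \<open>Glue\<close> can be erased,
  so words of only \<open>New\<close> suffice.\<close>

lemma up_sum_eq:
  assumes w: "w 0 = 1" "w' 0 = 1"
    and eq: "\<And>n. up_sum x w w 0 (replicate n New) = up_sum x' w' w' 0 (replicate n New)"
  shows "up_sum x w w 0 A = up_sum x' w' w' 0 A"
proof (induction "length A" arbitrary: A rule: less_induct)
  case less
  show ?case
  proof (cases "Spoke \<in> set A")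
    case True
    then obtain B C where A: "A = B @ Spoke # C" by (meson split_list)
    show ?thesis unfolding A up_sum_append_Spoke[of w, OF w(1)] up_sum_append_Spoke[of w', OF w(2)]
      using less[of B] less[of C] A by simp
  next
    case False
    then show ?thesis using eq up_sum_no_spoke[of w] up_sum_no_spoke[of w'] w by metis
  qed
qed

text \<open>The part of \<open>up_sum\<close> that comes from words without spokes above
  \<open>n\<close> letters \<open>New\<close>: each letter opens a segment or is glued at cost
  \<open>x\<close>, but an empty run cannot continue with \<open>Glue\<close>. Up to an index shift
  this is a binomial transform.\<close>

fun run_sum :: "'a::comm_ring_1 \<Rightarrow> (nat \<Rightarrow> 'a) \<Rightarrow> nat \<Rightarrow> nat \<Rightarrow> 'a" where
  "run_sum x \<phi> m 0 = \<phi> m"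
| "run_sum x \<phi> 0 (Suc n) = run_sum x \<phi> 1 n"
| "run_sum x \<phi> (Suc m) (Suc n) = run_sum x \<phi> (Suc (Suc m)) n + x * run_sum x \<phi> (Suc m) n"

lemma run_sum_eq:
  "run_sum x \<phi> (Suc m) n = (\<Sum>k\<le>n. of_nat (n choose k) * x ^ (n - k) * \<phi> (Suc m + k))"
proof (induction n arbitrary: m)
  case (Suc n)
  have "(\<Sum>k\<le>Suc n. of_nat (Suc n choose k) * x ^ (Suc n - k) * \<phi> (Suc m + k))
    = x ^ Suc n * \<phi> (Suc m) + (\<Sum>k\<le>n. of_nat (Suc n choose Suc k) * x ^ (n - k) * \<phi> (Suc m + Suc k))"
    by (subst sum.atMost_Suc_shift) simp
  also have "(\<Sum>k\<le>n. of_nat (Suc n choose Suc k) * x ^ (n - k) * \<phi> (Suc m + Suc k))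
    = (\<Sum>k\<le>n. of_nat (n choose k) * x ^ (n - k) * \<phi> (Suc (Suc m) + k))
    + (\<Sum>k\<le>n. of_nat (n choose Suc k) * x ^ (n - k) * \<phi> (Suc m + Suc k))"
    by (simp add: sum.distrib algebra_simps)
  also have "(\<Sum>k\<le>n. of_nat (n choose Suc k) * x ^ (n - k) * \<phi> (Suc m + Suc k))
    = (\<Sum>k<n. of_nat (n choose Suc k) * x ^ (n - k) * \<phi> (Suc m + Suc k))"
    by (rule sum.mono_neutral_right) (auto simp: le_less binomial_eq_0)
  also have "\<dots> = x * (\<Sum>k<n. of_nat (n choose Suc k) * x ^ (n - Suc k) * \<phi> (Suc m + Suc k))"
    unfolding sum_distrib_left
    by (intro sum.cong) (auto simp: Suc_diff_Suc[symmetric] mult_ac)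
  finally have "(\<Sum>k\<le>Suc n. of_nat (Suc n choose k) * x ^ (Suc n - k) * \<phi> (Suc m + k))
    = (\<Sum>k\<le>n. of_nat (n choose k) * x ^ (n - k) * \<phi> (Suc (Suc m) + k))
    + x * (x ^ n * \<phi> (Suc m) + (\<Sum>k<n. of_nat (n choose Suc k) * x ^ (n - Suc k) * \<phi> (Suc m + Suc k)))"
    by (simp add: algebra_simps)
  also have "x ^ n * \<phi> (Suc m) + (\<Sum>k<n. of_nat (n choose Suc k) * x ^ (n - Suc k) * \<phi> (Suc m + Suc k))
    = (\<Sum>k\<le>n. of_nat (n choose k) * x ^ (n - k) * \<phi> (Suc m + k))"
    by (subst sum.atMost_shift) simp
  finally show ?case using Suc.IH[of m] Suc.IH[of "Suc m"] by simp
qed simp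

lemma run_sum_shift: "run_sum x (\<lambda>k. run_sum x \<phi> k a) m n = run_sum x \<phi> m (n + a)"
proof (induction n arbitrary: m)
  case (Suc n)
  then show ?case by (cases m) simp_all
qed simp

text \<open>Words are sorted by the number \<open>l\<close> of letters before the first spoke; the
  spoke itself costs a factor \<open>x\<close>.\<close>

lemma up_sum_New_first_spoke:
  "up_sum x w \<phi> m (replicate n New) =
    run_sum x \<phi> m n + (\<Sum>l<n. run_sum x w m l * x * up_sum x w \<phi> 0 (replicate (n - 1 - l) New))"
proof (induction n arbitrary: m)
  case (Suc n)
  let ?U = "\<lambda>n. up_sum x w \<phi> 0 (replicate n New)"
  have "(\<Sum>l<Suc n. run_sum x w m l * x * ?U (Suc n - 1 - l))
     = w m * x * ?U n + (\<Sum>l<n. run_sum x w m (Suc l) * x * ?U (n - 1 - l))"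
    by (subst sum.lessThan_Suc_shift) simp
  then show ?case
    by (cases m) (simp_all add: up_sum_New Suc.IH sum.distrib sum_distrib_left algebra_simps)
qed (simp add: up_sum_Nil)

text \<open>Reversing a word does not preserve admissibility, since \<open>Glue\<close> refers to
  the preceding vertex. The mirror image of the first-spoke decomposition is therefore derived by
  strong induction, exchanging first and last spoke in a double sum.\<close>

lemma up_sum_New_last_spoke:
  "up_sum x w \<phi> 0 (replicate n New) =
    run_sum x \<phi> 0 n + (\<Sum>l<n. up_sum x w w 0 (replicate (n - 1 - l) New) * x * run_sum x \<phi> 0 l)"
proof (induction n rule: less_induct)
  case (less n)
  let ?U = "\<lambda>\<phi> n. up_sum x w \<phi> 0 (replicate n New)"
  let ?r = "\<lambda>\<phi> n. run_sum x \<phi> 0 n"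
  have sigma: "(\<Sum>l<n. \<Sum>k<n - 1 - l. g l k) = (\<Sum>(l, k)\<in>(SIGMA l:{..<n}. {..<n - 1 - l}). g l k)"
    for g :: "nat \<Rightarrow> nat \<Rightarrow> 'a"
    by (rule sum.Sigma) auto
  have "(\<Sum>l<n. ?r w l * x * ?U \<phi> (n - 1 - l))
     = (\<Sum>l<n. ?r w l * x * ?r \<phi> (n - 1 - l)) +
       (\<Sum>l<n. \<Sum>k<n - 1 - l. ?r w l * x * (?U w (n - 1 - l - 1 - k) * x * ?r \<phi> k))"
    unfolding sum.distrib[symmetric]
    by (intro sum.cong refl) (subst less.IH, auto simp: algebra_simps sum_distrib_left)
  also have "(\<Sum>l<n. \<Sum>k<n - 1 - l. ?r w l * x * (?U w (n - 1 - l - 1 - k) * x * ?r \<phi> k))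
     = (\<Sum>k<n. \<Sum>l<n - 1 - k. ?r w l * x * (?U w (n - 1 - k - 1 - l) * x * ?r \<phi> k))"
    unfolding sigma by (rule sum.reindex_bij_witness[of _ "\<lambda>(k, l). (l, k)" "\<lambda>(k, l). (l, k)"])
      (auto simp: diff_right_commute diff_commute add.commute)
  also have "(\<Sum>l<n. ?r w l * x * ?r \<phi> (n - 1 - l)) = (\<Sum>k<n. ?r w (n - 1 - k) * x * ?r \<phi> k)"
    by (rule sum.reindex_bij_witness[of _ "\<lambda>l. n - 1 - l" "\<lambda>l. n - 1 - l"]) auto
  finally have "(\<Sum>l<n. ?r w l * x * ?U \<phi> (n - 1 - l)) =
    (\<Sum>k<n. (?r w (n - 1 - k) + (\<Sum>l<n - 1 - k. ?r w l * x * ?U w (n - 1 - k - 1 - l))) * x * ?r \<phi> k)"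
    by (simp add: sum.distrib sum_distrib_left sum_distrib_right algebra_simps)
  also have "\<dots> = (\<Sum>k<n. ?U w (n - 1 - k) * x * ?r \<phi> k)"
    by (subst (2) up_sum_New_first_spoke) simp
  finally show ?case by (subst up_sum_New_first_spoke) simp
qed

section \<open>Cyclic words\<close>

lemma num_new_replicate [simp]: "num_new (replicate n New) = n"
  by (induction n) auto

text \<open>The initial state is the one the word itself leaves behind, since the last vertex
  precedes the first. The value \<open>False\<close> matters only for the empty word.\<close>

definition cyc_ups :: "token list \<Rightarrow> token list set" where
  "cyc_ups A = {C. C \<in> ups (open_after False C) A}"

lemma finite_cyc_ups: "finite (cyc_ups A)"
proof (rule finite_subset)
  show "cyc_ups A \<subseteq> ups True A \<union> ups False A"
    by (auto simp: cyc_ups_def) (metis (full_types))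
qed (simp add: finite_ups)

lemma length_cyc_ups: "C \<in> cyc_ups A \<Longrightarrow> length C = length A"
  by (auto simp: cyc_ups_def length_ups)

lemma num_new_cyc_ups: "C \<in> cyc_ups A \<Longrightarrow> num_new C \<le> num_new A"
  by (auto simp: cyc_ups_def num_new_ups)

lemma append_Spoke_in_cyc_ups:
  assumes "length C = length A" "compat (open_after (open_after False D) C) a Spoke"
  shows "C @ Spoke # D \<in> cyc_ups (A @ a # B) \<longleftrightarrow>
    C \<in> ups (open_after False D) A \<and> D \<in> ups False B"
  using assms by (simp add: cyc_ups_def append_in_ups open_after_append Cons_in_ups del: ups.simps)

lemma cyc_ups_split_Spoke:
  assumes "C \<in> cyc_ups (A @ Spoke # B)"
  shows "C = take (length A) C @ Spoke # drop (Suc (length A)) C"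
proof -
  have "length C = length (A @ Spoke # B)" using assms by (rule length_cyc_ups)
  then have l: "length A < length C" by simp
  have "compat (if length A = 0 then open_after False C else C ! (length A - 1) \<noteq> Spoke)
      ((A @ Spoke # B) ! length A) (C ! length A)"
    using assms l \<open>length C = _\<close> unfolding cyc_ups_def mem_Collect_eq in_ups_iff_nth by metis
  then have "C ! length A = Spoke" by simp
  then show ?thesis using id_take_nth_drop[OF l] by simp
qed

text \<open>A spoke of the bottom word persists in every word above it; cutting there and rotating
  gives a linear sum.\<close>

lemma sum_cyc_ups_Spoke:
  "(\<Sum>C\<in>cyc_ups (A @ Spoke # B). x ^ (num_new (A @ Spoke # B) - num_new C) * cyc_scan w v 0 C)
    = up_sum x w w 0 (B @ A)"
proof -
  have len: "length C = Suc (length A + length B)" if "C \<in> cyc_ups (A @ Spoke # B)" for C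
    using length_cyc_ups[OF that] by simp
  have split: "take (length A) C \<in> ups (open_after False (drop (Suc (length A)) C)) A \<and>
      drop (Suc (length A)) C \<in> ups False B" if "C \<in> cyc_ups (A @ Spoke # B)" for C
    using append_Spoke_in_cyc_ups[of "take (length A) C" A "drop (Suc (length A)) C" Spoke B]
      cyc_ups_split_Spoke[OF that] that len[OF that] by simp
  have split': "take (length B) D \<in> ups False B \<and>
      drop (length B) D \<in> ups (open_after False (take (length B) D)) A"
    if "D \<in> ups False (B @ A)" for D
    using append_in_ups[of "take (length B) D" B "drop (length B) D" False A] length_ups[OF that] that
    by simp
  show ?thesis
    unfolding up_sum_def
  proof (rule sum.reindex_bij_witness[of _
        "\<lambda>D. drop (length B) D @ Spoke # take (length B) D"
        "\<lambda>C. drop (Suc (length A)) C @ take (length A) C"])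
    fix C assume C: "C \<in> cyc_ups (A @ Spoke # B)"
    show "drop (length B) (drop (Suc (length A)) C @ take (length A) C)
      @ Spoke # take (length B) (drop (Suc (length A)) C @ take (length A) C) = C"
      using cyc_ups_split_Spoke[OF C] len[OF C] by simp
    show "drop (Suc (length A)) C @ take (length A) C \<in> ups (0 < (0::nat)) (B @ A)"
      using split[OF C] append_in_ups[of "drop (Suc (length A)) C" B "take (length A) C" False A] len[OF C]
      by simp
    have "cyc_scan w v 0 (take (length A) C @ Spoke # drop (Suc (length A)) C)
       = scan w w 0 (drop (Suc (length A)) C @ take (length A) C)" by (rule cyc_scan_Spoke)
    moreover have "num_new (take (length A) C @ Spoke # drop (Suc (length A)) C)
       = num_new (drop (Suc (length A)) C @ take (length A) C)" by simp
    ultimately show "x ^ (num_new (B @ A) - num_new (drop (Suc (length A)) C @ take (length A) C)) *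
       scan w w 0 (drop (Suc (length A)) C @ take (length A) C) =
       x ^ (num_new (A @ Spoke # B) - num_new C) * cyc_scan w v 0 C"
      using cyc_ups_split_Spoke[OF C] by (simp add: add.commute)
  next
    fix D assume D: "D \<in> ups (0 < (0::nat)) (B @ A)"
    then have l: "length D = length B + length A" using length_ups by fastforce
    then show "drop (Suc (length A)) (drop (length B) D @ Spoke # take (length B) D) @
       take (length A) (drop (length B) D @ Spoke # take (length B) D) = D" by simp
    show "drop (length B) D @ Spoke # take (length B) D \<in> cyc_ups (A @ Spoke # B)"
      using split'[of D] D l by (subst append_Spoke_in_cyc_ups) auto
  qed
qed

text \<open>Deletes from the second word the letters at glued positions of the first, that is,
  contracts the rim edges of the smaller flat. Those letters are forced by their
  predecessors.\<close>

fun contract :: "token list \<Rightarrow> token list \<Rightarrow> token list" where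
  "contract (a # A) (c # C) = (if a = Glue then contract A C else c # contract A C)"
| "contract _ _ = []"

lemma image_contract:
  "Spoke \<notin> set A \<Longrightarrow> contract A ` ups b A = ups b (replicate (num_new A) New)"
proof (induction A arbitrary: b)
  case (Cons a A)
  show ?case
  proof (cases a)
    case New
    have "contract (New # A) ` ups b (New # A)
      = (\<Union>c\<in>{c. compat b New c}. (#) c ` (contract A ` ups (c \<noteq> Spoke) A))"
      by (simp del: compat.simps add: image_UN image_image)
    then show ?thesis using Cons New by (simp del: compat.simps)
  next
    case Glue
    have "contract (Glue # A) ` ups b (Glue # A) = contract A ` ups b A"
      unfolding ups.simps compat_sets by (cases b) (auto simp: image_UN image_image)
    then show ?thesis using Cons Glue by simp
  qed (use Cons in auto)
qed simp

lemma inj_on_contract: "Spoke \<notin> set A \<Longrightarrow> inj_on (contract A) (ups b A)"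
proof (induction A arbitrary: b)
  case (Cons a A)
  show ?case
  proof (rule inj_onI)
    fix C D assume "C \<in> ups b (a # A)" "D \<in> ups b (a # A)" and eq: "contract (a # A) C = contract (a # A) D"
    then obtain c C' d D' where *: "C = c # C'" "compat b a c" "C' \<in> ups (c \<noteq> Spoke) A"
      "D = d # D'" "compat b a d" "D' \<in> ups (d \<noteq> Spoke) A" by auto
    then have "c = d" "contract A C' = contract A D'"
      using eq by (cases a; auto)+
    then show "C = D" using * Cons.IH[of "c \<noteq> Spoke"] Cons.prems by (auto dest: inj_onD)
  qed
qed simp

lemma num_new_contract: "C \<in> ups b A \<Longrightarrow> num_new (contract A C) = num_new C"
proof (induction A arbitrary: b C)
  case (Cons a A)
  then show ?case by (auto split: if_splits)
qed simp

lemma open_after_contract: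
  "Spoke \<notin> set A \<Longrightarrow> C \<in> ups b A \<Longrightarrow> open_after b (contract A C) = open_after b C"
proof (induction A arbitrary: b C)
  case (Cons a A)
  then show ?case by (cases a; cases b) auto
qed simp

lemma scan_contract:
  assumes "w 0 = 1"
  shows "Spoke \<notin> set A \<Longrightarrow> C \<in> ups (m > 0) A \<Longrightarrow> scan w \<phi> m (contract A C) = scan w \<phi> m C"
proof (induction A arbitrary: m C)
  case (Cons a A)
  then obtain c C' where *: "C = c # C'" "compat (m > 0) a c" "C' \<in> ups (c \<noteq> Spoke) A" by auto
  then show ?case
    using Cons assms by (cases a; cases c; cases "m = 0") (auto simp: token.exhaust)
qed simp

lemma cyc_scan_last_spoke:
  assumes "w 0 = 1" "C \<noteq> []" "last C = Spoke"
  shows "cyc_scan w v 0 C = scan w w 0 C"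
proof -
  obtain D where "C = D @ [Spoke]" using assms(2,3) by (metis append_butlast_last_id)
  then show ?thesis
    using cyc_scan_Spoke[of w v D "[]"] scan_append_Spoke[of w w 0 D "[]"] assms(1) by simp
qed

lemma cyc_scan_contract_open:
  assumes "w 0 = 1"
  shows "Spoke \<notin> set A \<Longrightarrow> C \<in> ups True A \<Longrightarrow> cyc_scan w v m (contract A C) = cyc_scan w v m C"
proof (induction A arbitrary: m C)
  case (Cons a A)
  then obtain c C' where *: "C = c # C'" "compat True a c" "C' \<in> ups (c \<noteq> Spoke) A" by auto
  then show ?case
    using Cons assms scan_contract[of w A C' 0] by (cases a; cases c) auto
qed simp

lemma contract_eq_Nil: "C \<in> ups b A \<Longrightarrow> num_new A > 0 \<Longrightarrow> contract A C \<noteq> []"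
proof (induction A arbitrary: b C)
  case (Cons a A)
  then show ?case by (cases a) (auto split: if_splits)
qed simp

lemma cyc_scan_contract:
  assumes w: "w 0 = 1" and A: "Spoke \<notin> set A" "num_new A > 0" and C: "C \<in> cyc_ups A"
  shows "cyc_scan w v 0 (contract A C) = cyc_scan w v 0 C"
proof (cases "open_after False C")
  case True
  then show ?thesis using cyc_scan_contract_open[of w A C, OF w A(1)] C by (simp add: cyc_ups_def)
next
  case False
  then have C: "C \<in> ups False A" using C by (simp add: cyc_ups_def)
  have ne: "contract A C \<noteq> []" by (rule contract_eq_Nil[OF C A(2)])
  then have "last (contract A C) = Spoke" "C \<noteq> []" "last C = Spoke"
    using open_after_contract[OF A(1) C] False by (auto simp: open_after_def split: if_splits)
  then show ?thesis
    using cyc_scan_last_spoke[of w "contract A C" v, OF w ne] cyc_scan_last_spoke[of w C v, OF w]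
      scan_contract[of w A C 0 w, OF w A(1)] C by simp
qed

text \<open>A deleted letter is \<open>Spoke\<close> only if the letter before it is. From an open
  start some spoke therefore survives; from a closed start the leading deleted letters may be the
  only spokes, hence the exception.\<close>

lemma Spoke_in_contract_aux:
  "Spoke \<notin> set A \<Longrightarrow> C \<in> ups b A \<Longrightarrow>
    (Spoke \<in> set (contract A C) \<longrightarrow> Spoke \<in> set C) \<and> (Spoke \<in> set C \<longrightarrow> Spoke \<in> set (contract A C) \<or> \<not> b)"
proof (induction A arbitrary: b C)
  case (Cons a A)
  then obtain c C' where *: "C = c # C'" "compat b a c" "C' \<in> ups (c \<noteq> Spoke) A" by auto
  have "Spoke \<notin> set A" using Cons.prems by simp
  from Cons.IH[OF this *(3)] show ?case
    using *(2) Cons.prems(1) unfolding *(1) by (cases a; cases c; cases b) simp_all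
qed simp

lemma Spoke_in_contract:
  assumes A: "Spoke \<notin> set A" "num_new A > 0" and C: "C \<in> cyc_ups A"
  shows "Spoke \<in> set (contract A C) \<longleftrightarrow> Spoke \<in> set C"
proof (cases "open_after False C")
  case True
  then show ?thesis using Spoke_in_contract_aux[OF A(1), of C True] C by (auto simp: cyc_ups_def)
next
  case False
  then have C: "C \<in> ups False A" using C by (simp add: cyc_ups_def)
  have "contract A C \<noteq> []" by (rule contract_eq_Nil[OF C A(2)])
  then have "last (contract A C) = Spoke"
    using open_after_contract[OF A(1) C] False by (auto simp: open_after_def split: if_splits)
  then show ?thesis
    using Spoke_in_contract_aux[OF A(1) C] \<open>contract A C \<noteq> []\<close> last_in_set by metis
qed

text \<open>Reduces the interval above a spokeless word to that of a smaller cyclic chain. The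
  condition on \<open>num_new A\<close> keeps the contracted word nonempty, so that its last letter
  still determines the state.\<close>

lemma bij_betw_contract:
  assumes A: "Spoke \<notin> set A" "num_new A > 0"
  shows "bij_betw (contract A) (cyc_ups A) (cyc_ups (replicate (num_new A) New))"
proof -
  have op: "open_after False (contract A C) = open_after False C" if "C \<in> ups b A" for b C
  proof -
    have "open_after b (contract A C) = open_after b C" by (rule open_after_contract[OF A(1) that])
    moreover have "contract A C \<noteq> []" "C \<noteq> []"
      using contract_eq_Nil[OF that A(2)] length_ups[OF that] A(2) by auto
    ultimately show ?thesis by (simp add: open_after_def)
  qed
  have "inj_on (contract A) (cyc_ups A)"
  proof (rule inj_onI)
    fix C D assume CD: "C \<in> cyc_ups A" "D \<in> cyc_ups A" "contract A C = contract A D"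
    then have "open_after False C = open_after False D" using op by (metis cyc_ups_def mem_Collect_eq)
    then show "C = D" using CD inj_onD[OF inj_on_contract[OF A(1)]] by (auto simp: cyc_ups_def)
  qed
  moreover have "contract A ` cyc_ups A = cyc_ups (replicate (num_new A) New)"
  proof (intro equalityI subsetI)
    fix D assume "D \<in> contract A ` cyc_ups A"
    then obtain C where C: "D = contract A C" "C \<in> ups (open_after False C) A"
      by (auto simp: cyc_ups_def)
    then have "D \<in> ups (open_after False C) (replicate (num_new A) New)"
      using image_contract[OF A(1)] by blast
    then show "D \<in> cyc_ups (replicate (num_new A) New)" using op[OF C(2)] C(1) by (simp add: cyc_ups_def)
  next
    fix D assume "D \<in> cyc_ups (replicate (num_new A) New)"
    then have "D \<in> contract A ` ups (open_after False D) A"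
      using image_contract[OF A(1)] by (simp add: cyc_ups_def)
    then obtain C where C: "D = contract A C" "C \<in> ups (open_after False D) A" by blast
    then show "D \<in> contract A ` cyc_ups A" using op[OF C(2)] by (auto simp: cyc_ups_def)
  qed
  ultimately show ?thesis by (simp add: bij_betw_def)
qed

section \<open>Sums over words without and with spokes\<close>

lemma sum_ups_no_spoke:
  fixes f :: "nat \<Rightarrow> 'a::comm_ring_1"
  shows "(\<Sum>C\<in>{C \<in> ups (m > 0) (replicate n New). Spoke \<notin> set C}. x ^ (n - num_new C) * f (m + num_new C))
    = run_sum x f m n"
proof (induction n arbitrary: m)
  case 0
  have "{C \<in> ups (m > 0) (replicate 0 New). Spoke \<notin> set C} = {[]}" by auto
  then show ?case by simp
next
  case (Suc n)
  let ?U = "\<lambda>b. {C \<in> ups b (replicate n New). Spoke \<notin> set C}"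
  have fin: "finite (?U b)" for b by (simp add: finite_ups)
  have *: "(\<Sum>C\<in>?U True. x ^ (Suc n - num_new C) * f (m + num_new C))
     = x * (\<Sum>C\<in>?U True. x ^ (n - num_new C) * f (m + num_new C))"
    unfolding sum_distrib_left
  proof (rule sum.cong)
    fix C assume "C \<in> ?U True"
    then have "num_new C \<le> n" using num_new_ups[of C True "replicate n New"] by simp
    then show "x ^ (Suc n - num_new C) * f (m + num_new C) = x * (x ^ (n - num_new C) * f (m + num_new C))"
      by (simp add: Suc_diff_le mult.assoc)
  qed simp
  have N: "(\<Sum>C\<in>(#) New ` ?U True. x ^ (Suc n - num_new C) * f (m + num_new C)) = run_sum x f (Suc m) n"
    using Suc.IH[of "Suc m"] by (simp add: sum.reindex)
  have G: "(\<Sum>C\<in>(#) Glue ` ?U True. x ^ (Suc n - num_new C) * f (m + num_new C)) = x * run_sum x f m n"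
    if "m > 0"
    using Suc.IH[of m] that * by (simp add: sum.reindex)
  show ?case
  proof (cases m)
    case 0
    then have "{C \<in> ups (m > 0) (replicate (Suc n) New). Spoke \<notin> set C} = (#) New ` ?U True"
      unfolding replicate_Suc ups.simps compat_sets by auto
    then show ?thesis using N 0 by simp
  next
    case (Suc m')
    then have "{C \<in> ups (m > 0) (replicate (Suc n) New). Spoke \<notin> set C}
       = (#) New ` ?U True \<union> (#) Glue ` ?U True"
      unfolding replicate_Suc ups.simps compat_sets by auto
    moreover have "sum g ((#) New ` ?U True \<union> (#) Glue ` ?U True)
       = sum g ((#) New ` ?U True) + sum g ((#) Glue ` ?U True)" for g :: "token list \<Rightarrow> 'a"
      by (rule sum.union_disjoint) (use fin in auto)
    ultimately show ?thesis using N G Suc by simp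
  qed
qed

lemma sum_cyc_ups_no_spoke:
  fixes f :: "nat \<Rightarrow> 'a::comm_ring_1"
  assumes "m > 0"
  shows "(\<Sum>C\<in>{C \<in> cyc_ups (replicate m New). Spoke \<notin> set C}. f (num_new C))
    = (\<Sum>k\<le>m. of_nat (m choose k) * f k)"
proof -
  have "C \<in> cyc_ups (replicate m New) \<longleftrightarrow> C \<in> ups True (replicate m New)" if "Spoke \<notin> set C" for C
  proof -
    have "open_after False C" if "length C = m"
      using that \<open>Spoke \<notin> set C\<close> assms by (metis last_in_set length_0_conv less_irrefl open_after_def)
    moreover have "C \<in> ups b (replicate m New) \<Longrightarrow> length C = m" for b using length_ups by fastforce
    ultimately show ?thesis by (auto simp: cyc_ups_def)
  qed
  then have "{C \<in> cyc_ups (replicate m New). Spoke \<notin> set C} = {C \<in> ups (1 > (0::nat)) (replicate m New). Spoke \<notin> set C}"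
    by auto
  \<comment> \<open>One fictitious initial segment makes the state open, as it is in a cyclic word
    without spokes; the shift in \<open>f\<close> removes that segment from the count.\<close>
  then show ?thesis
    using sum_ups_no_spoke[where m = 1 and n = m and x = 1 and f = "\<lambda>k. f (k - 1)"] run_sum_eq[of 1 "\<lambda>k. f (k - 1)" 0 m]
    by simp
qed

lemma scan_cong:
  "C \<in> ups (m > 0) A \<Longrightarrow> (\<And>k. (k > 0) = open_after (m > 0) C \<Longrightarrow> \<phi> k = \<psi> k) \<Longrightarrow>
    scan w \<phi> m C = scan w \<psi> m C"
proof (induction A arbitrary: m C)
  case (Cons a A)
  then obtain c C' where *: "C = c # C'" "compat (m > 0) a c" "C' \<in> ups (c \<noteq> Spoke) A" by auto
  have g: "c = Glue \<Longrightarrow> m > 0" using * by (cases a) (auto split: if_splits)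
  show ?case
    using * g Cons.IH[of C' 0] Cons.IH[of C' "Suc m"] Cons.IH[of C' m] Cons.prems(2) by (cases c) auto
qed auto

lemma scan_sum: "scan w (\<lambda>k. \<Sum>i\<in>I. f i k) m C = (\<Sum>i\<in>I. scan w (f i) m C)"
  by (induction C arbitrary: m) (auto simp: sum_distrib_left elim: scan.elims, case_tac a, auto simp: sum_distrib_left)

lemma replicate_split: "a < m \<Longrightarrow> replicate m x = replicate a x @ x # replicate (m - 1 - a) x"
  using replicate_add[of a "Suc (m - 1 - a)" x] by simp

text \<open>Decomposition at the first spoke, with \<open>a\<close> letters before it. Read
  cyclically, these letters continue the last run of the rest, which is why the final weight is
  itself a \<open>run_sum\<close> starting from the length of that run.\<close>

lemma sum_cyc_ups_spoked:
  assumes m: "m > 0"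
  shows "(\<Sum>C\<in>{C \<in> cyc_ups (replicate m New). Spoke \<in> set C}. x ^ (m - num_new C) * cyc_scan w v 0 C)
    = (\<Sum>a<m. x * up_sum x w (\<lambda>k. run_sum x w k a) 0 (replicate (m - 1 - a) New))"
proof -
  let ?c1 = "\<lambda>a D. {C \<in> ups (open_after False D) (replicate a New). Spoke \<notin> set C}"
  let ?c2 = "\<lambda>a. ups False (replicate (m - 1 - a) New)"
  have inner: "x * up_sum x w (\<lambda>k. run_sum x w k a) 0 (replicate (m - 1 - a) New)
     = (\<Sum>D\<in>?c2 a. \<Sum>C\<in>?c1 a D. x ^ (m - num_new (C @ Spoke # D)) * cyc_scan w v 0 (C @ Spoke # D))"
    if a: "a < m" for a
    unfolding up_sum_def sum_distrib_left
  proof (rule sum.cong)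
    fix D assume D: "D \<in> ?c2 a"
    have nD: "num_new D \<le> m - 1 - a" using num_new_ups[OF D] by simp
    have "scan w (\<lambda>k. run_sum x w k a) 0 D
       = scan w (\<lambda>k. \<Sum>C\<in>?c1 a D. x ^ (a - num_new C) * w (k + num_new C)) 0 D"
    \<comment> \<open>The admissible \<open>C\<close> depend on whether \<open>D\<close> ends in a
      spoke. Only values \<open>k\<close> that occur at the end of \<open>D\<close> matter, and for
      these \<open>k > 0\<close> expresses the same condition.\<close>
    proof (rule scan_cong)
      show "D \<in> ups (0 < (0::nat)) (replicate (m - 1 - a) New)" using D by simp
      show "run_sum x w k a = (\<Sum>C\<in>?c1 a D. x ^ (a - num_new C) * w (k + num_new C))"
        if "(k > 0) = open_after (0 < (0::nat)) D" for k
        using sum_ups_no_spoke[where m = k and n = a and x = x and f = w] that by simp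
    qed
    also have "\<dots> = (\<Sum>C\<in>?c1 a D. x ^ (a - num_new C) * scan w w 0 (D @ C))"
      unfolding scan_sum by (intro sum.cong refl) (simp add: scan_mult scan_append scan_no_spoke)
    finally have "x * (x ^ (num_new (replicate (m - 1 - a) New) - num_new D) * scan w (\<lambda>k. run_sum x w k a) 0 D)
       = (\<Sum>C\<in>?c1 a D. x * x ^ (m - 1 - a - num_new D) * x ^ (a - num_new C) * scan w w 0 (D @ C))"
      by (simp add: sum_distrib_left mult.assoc)
    also have "\<dots> = (\<Sum>C\<in>?c1 a D. x ^ (m - num_new (C @ Spoke # D)) * cyc_scan w v 0 (C @ Spoke # D))"
    proof (rule sum.cong)
      fix C assume "C \<in> ?c1 a D"
      then have nC: "num_new C \<le> a"
        using num_new_ups[of C "open_after False D" "replicate a New"] by simp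
      have "m - num_new (C @ Spoke # D) = Suc ((m - 1 - a - num_new D) + (a - num_new C))"
        using nC nD a by simp
      then show "x * x ^ (m - 1 - a - num_new D) * x ^ (a - num_new C) * scan w w 0 (D @ C)
        = x ^ (m - num_new (C @ Spoke # D)) * cyc_scan w v 0 (C @ Spoke # D)"
        by (simp add: cyc_scan_Spoke power_add mult_ac del: count_list_append)
    qed simp
    finally show "x * (x ^ (num_new (replicate (m - 1 - a) New) - num_new D) * scan w (\<lambda>k. run_sum x w k a) 0 D)
      = (\<Sum>C\<in>?c1 a D. x ^ (m - num_new (C @ Spoke # D)) * cyc_scan w v 0 (C @ Spoke # D))" .
  qed simp
  have "(\<Sum>C\<in>{C \<in> cyc_ups (replicate m New). Spoke \<in> set C}. x ^ (m - num_new C) * cyc_scan w v 0 C)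
     = (\<Sum>(a, D, C)\<in>(SIGMA a:{..<m}. SIGMA D:?c2 a. ?c1 a D).
        x ^ (m - num_new (C @ Spoke # D)) * cyc_scan w v 0 (C @ Spoke # D))"
  proof (rule sum.reindex_bij_witness[of _ "\<lambda>(a, D, C). C @ Spoke # D"
        "\<lambda>C. (length (takeWhile (\<lambda>c. c \<noteq> Spoke) C), tl (dropWhile (\<lambda>c. c \<noteq> Spoke) C), takeWhile (\<lambda>c. c \<noteq> Spoke) C)"])
    fix E assume E: "E \<in> {C \<in> cyc_ups (replicate m New). Spoke \<in> set C}"
    then obtain C D where CD: "E = C @ Spoke # D" "Spoke \<notin> set C"
      using split_list_first[of Spoke E] by auto
    have l: "length C + length D = m - 1" "length C < m"
      using E CD length_cyc_ups[of E "replicate m New"] by auto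
    from l(2) have "replicate m New = replicate (length C) New @ New # replicate (m - 1 - length C) New"
      by (rule replicate_split)
    then have "C \<in> ups (open_after False D) (replicate (length C) New) \<and> D \<in> ups False (replicate (m - 1 - length C) New)"
      using E CD append_Spoke_in_cyc_ups[of C "replicate (length C) New" D New "replicate (m - 1 - length C) New"]
      by simp
    moreover have t: "takeWhile (\<lambda>c. c \<noteq> Spoke) E = C" "dropWhile (\<lambda>c. c \<noteq> Spoke) E = Spoke # D"
      using CD by (auto simp: takeWhile_append dropWhile_append)
    ultimately show "(length (takeWhile (\<lambda>c. c \<noteq> Spoke) E), tl (dropWhile (\<lambda>c. c \<noteq> Spoke) E), takeWhile (\<lambda>c. c \<noteq> Spoke) E)
       \<in> (SIGMA a:{..<m}. SIGMA D:?c2 a. ?c1 a D)"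
      using l CD by simp
    show "(case (length (takeWhile (\<lambda>c. c \<noteq> Spoke) E), tl (dropWhile (\<lambda>c. c \<noteq> Spoke) E), takeWhile (\<lambda>c. c \<noteq> Spoke) E) of
       (a, D, C) \<Rightarrow> C @ Spoke # D) = E" using t CD by simp
    show "(case (length (takeWhile (\<lambda>c. c \<noteq> Spoke) E), tl (dropWhile (\<lambda>c. c \<noteq> Spoke) E), takeWhile (\<lambda>c. c \<noteq> Spoke) E) of
       (a, D, C) \<Rightarrow> x ^ (m - num_new (C @ Spoke # D)) * cyc_scan w v 0 (C @ Spoke # D))
       = x ^ (m - num_new E) * cyc_scan w v 0 E" using t CD by simp
  next
    fix p assume "p \<in> (SIGMA a:{..<m}. SIGMA D:?c2 a. ?c1 a D)"
    then obtain a C D where p: "p = (a, D, C)" "a < m" "D \<in> ?c2 a" "C \<in> ?c1 a D" by auto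
    then have lC: "length C = a" using length_ups by fastforce
    have "replicate m New = replicate a New @ New # replicate (m - 1 - a) New"
      using p(2) by (rule replicate_split)
    then have "C @ Spoke # D \<in> cyc_ups (replicate m New)"
      using p lC append_Spoke_in_cyc_ups[of C "replicate a New" D New "replicate (m - 1 - a) New"] by simp
    then show "(case p of (a, D, C) \<Rightarrow> C @ Spoke # D) \<in> {C \<in> cyc_ups (replicate m New). Spoke \<in> set C}"
      using p by simp
    show "(length (takeWhile (\<lambda>c. c \<noteq> Spoke) (case p of (a, D, C) \<Rightarrow> C @ Spoke # D)),
        tl (dropWhile (\<lambda>c. c \<noteq> Spoke) (case p of (a, D, C) \<Rightarrow> C @ Spoke # D)),
        takeWhile (\<lambda>c. c \<noteq> Spoke) (case p of (a, D, C) \<Rightarrow> C @ Spoke # D)) = p"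
      using p lC by (auto simp: takeWhile_append dropWhile_append)
  qed
  also have "\<dots> = (\<Sum>a<m. \<Sum>D\<in>?c2 a. \<Sum>C\<in>?c1 a D. x ^ (m - num_new (C @ Spoke # D)) * cyc_scan w v 0 (C @ Spoke # D))"
    by (simp add: sum.Sigma finite_ups)
  finally show ?thesis using inner by simp
qed

text \<open>Decomposing the rest at its last spoke isolates the run through the starting point of
  the cyclic word. In a run of \<open>l\<close> letters that point has \<open>Suc l\<close> possible
  places; likewise \<open>of_nat (Suc n)\<close> counts the positions of the spoke when there is
  only one.\<close>

lemma sum_cyc_ups_spoked_Suc:
  "(\<Sum>C\<in>{C \<in> cyc_ups (replicate (Suc n) New). Spoke \<in> set C}. x ^ (Suc n - num_new C) * cyc_scan w v 0 C)
    = x * (of_nat (Suc n) * run_sum x w 0 n +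
      (\<Sum>l<n. of_nat (Suc l) * x * run_sum x w 0 l * up_sum x w w 0 (replicate (n - 1 - l) New)))"
proof -
  let ?e = "\<lambda>n. up_sum x w w 0 (replicate n New)"
  let ?r = "run_sum x w 0"
  have "(\<Sum>C\<in>{C \<in> cyc_ups (replicate (Suc n) New). Spoke \<in> set C}. x ^ (Suc n - num_new C) * cyc_scan w v 0 C)
     = (\<Sum>a<Suc n. x * (?r n + (\<Sum>l<n - a. ?e (n - a - 1 - l) * x * ?r (l + a))))"
    unfolding sum_cyc_ups_spoked[OF zero_less_Suc] up_sum_New_last_spoke[of x w "\<lambda>k. run_sum x w k _"]
      run_sum_shift
    by (intro sum.cong) auto
  also have "\<dots> = x * (of_nat (Suc n) * ?r n + (\<Sum>a<Suc n. \<Sum>l<n - a. ?e (n - a - 1 - l) * x * ?r (l + a)))"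
    by (simp only: sum_distrib_left[symmetric] sum.distrib sum_constant card_lessThan)
  also have "(\<Sum>a<Suc n. \<Sum>l<n - a. ?e (n - a - 1 - l) * x * ?r (l + a))
     = (\<Sum>(a, l)\<in>(SIGMA a:{..<Suc n}. {..<n - a}). ?e (n - a - 1 - l) * x * ?r (l + a))"
    by (rule sum.Sigma) auto
  also have "\<dots> = (\<Sum>(s, a)\<in>(SIGMA s:{..<n}. {..<Suc s}). x * ?r s * ?e (n - 1 - s))"
    by (rule sum.reindex_bij_witness[of _ "\<lambda>(s, a). (a, s - a)" "\<lambda>(a, l). (a + l, a)"])
      (auto simp: mult_ac add.commute)
  also have "\<dots> = (\<Sum>s<n. \<Sum>a<Suc s. x * ?r s * ?e (n - 1 - s))"
    by (rule sum.Sigma[symmetric]) auto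
  also have "\<dots> = (\<Sum>l<n. of_nat (Suc l) * x * ?r l * ?e (n - 1 - l))"
    by (intro sum.cong refl) (simp only: sum_constant card_lessThan mult.assoc)
  finally show ?thesis .
qed

section \<open>Motzkin and Narayana polynomials\<close>

definition T :: "int poly" where "T = monom 1 1"

lemma T_power: "T ^ k = monom 1 k"
  by (simp add: T_def monom_power)

lemma coeff_T_power_mult: "coeff (T ^ k * p) j = (if k \<le> j then coeff p (j - k) else 0)"
  by (simp add: T_power coeff_monom_mult)

lemma coeff_T_power: "coeff (T ^ k) j = (if k = j then 1 else 0)"
  by (simp add: T_power)

lemma coeff_T_mult: "coeff (T * p) j = (if j = 0 then 0 else coeff p (j - 1))"
  using coeff_T_power_mult[of 1 p j] by auto

lemma coeff_of_nat_mult: "coeff (of_nat c * (p :: int poly)) j = of_nat c * coeff p j"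
  by (simp add: of_nat_poly)

lemma reverse_poly_sum:
  assumes "\<And>i. i \<in> I \<Longrightarrow> degree (f i) \<le> r"
  shows "reverse_poly r (sum f I) = (\<Sum>i\<in>I. reverse_poly r (f i))"
proof (rule poly_eqI)
  fix j
  have "degree (sum f I) \<le> r" using assms
    by (intro degree_le allI impI)
      (simp add: coeff_sum, intro sum.neutral ballI coeff_eq_0, rule le_less_trans[OF assms])
  then show "coeff (reverse_poly r (sum f I)) j = coeff (\<Sum>i\<in>I. reverse_poly r (f i)) j"
    using assms by (auto simp: coeff_reverse_poly coeff_sum)
qed

lemma reverse_poly_of_nat_T_power_mult:
  assumes "degree p \<le> k" "k \<le> r"
  shows "reverse_poly r (of_nat c * T ^ (r - k) * p) = of_nat c * reverse_poly k p"
    and "degree (of_nat c * T ^ (r - k) * p) \<le> r"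
proof -
  have z: "coeff p i = 0" if "i > k" for i using assms that by (simp add: coeff_eq_0)
  have c: "coeff (of_nat c * T ^ (r - k) * p) i = of_nat c * (if r - k \<le> i then coeff p (i - (r - k)) else 0)" for i
    by (simp only: mult.assoc coeff_of_nat_mult coeff_T_power_mult)
  show deg: "degree (of_nat c * T ^ (r - k) * p) \<le> r"
    by (rule degree_le) (use assms z in \<open>simp add: c\<close>)
  show "reverse_poly r (of_nat c * T ^ (r - k) * p) = of_nat c * reverse_poly k p"
  proof (rule poly_eqI)
    fix j
    show "coeff (reverse_poly r (of_nat c * T ^ (r - k) * p)) j = coeff (of_nat c * reverse_poly k p) j"
    proof (cases "j \<le> k")
      case True
      then have "r - j - (r - k) = k - j" "r - k \<le> r - j" "j \<le> r" using assms by auto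
      then show ?thesis
        using True assms(1) by (simp only: coeff_reverse_poly[OF deg] c coeff_of_nat_mult)
          (simp add: coeff_reverse_poly)
    next
      case False
      then show ?thesis
        using assms by (auto simp only: coeff_reverse_poly[OF deg] c coeff_of_nat_mult)
          (auto simp: coeff_reverse_poly)
    qed
  qed
qed

text \<open>As a difference of binomials it is an integer by construction; the quotient of
  factorials is proved next.\<close>

definition catalan :: "nat \<Rightarrow> int" where
  "catalan k = int (2 * k choose k) - int (2 * k choose Suc k)"

lemma of_int_catalan: "(of_int (catalan k) :: rat) = fact (2 * k) / (fact k * fact (Suc k))"
proof (cases k)
  case (Suc j)
  let ?a = "of_nat (2 * k choose k) :: rat" and ?b = "of_nat (2 * k choose Suc k) :: rat"
  let ?f = "fact j :: rat" and ?k = "of_nat k :: rat"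
  have "?a = fact (2 * k) / (fact k * fact k)"
    by (subst binomial_fact) auto
  moreover have "?b = fact (2 * k) / (fact (Suc k) * ?f)"
    using Suc by (subst binomial_fact) auto
  moreover have f: "fact k = ?k * ?f" "fact (Suc k) = (1 + ?k) * (?k * ?f)"
    using Suc by simp_all
  moreover have nz: "1 + ?k \<noteq> 0" "?k \<noteq> 0" using Suc by (simp_all add: add_eq_0_iff)
  ultimately have "?a * (?k * ?f * (?k * ?f)) = fact (2 * k)"
    "?b * ((1 + ?k) * (?k * ?f) * ?f) = fact (2 * k)"
    by (simp_all only: nonzero_eq_divide_eq mult_eq_0_iff fact_nonzero not_False_eq_True simp_thms)
  moreover have "(?a - ?b) * (?k * ?f * ((1 + ?k) * (?k * ?f)))
    = (1 + ?k) * (?a * (?k * ?f * (?k * ?f))) - ?k * (?b * ((1 + ?k) * (?k * ?f) * ?f))"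
    by (simp add: algebra_simps)
  ultimately have "(?a - ?b) * (?k * ?f * ((1 + ?k) * (?k * ?f))) = fact (2 * k)"
    by (simp add: algebra_simps)
  then show ?thesis
    unfolding catalan_def of_int_diff of_int_of_nat_eq f using nz by (simp add: eq_divide_eq)
qed (simp add: catalan_def)

text \<open>The Motzkin polynomials with index shifted by one; the value 1 at \<open>n = 0\<close>
  is the weight of an empty run.\<close>

definition fan_poly :: "nat \<Rightarrow> int poly" where
  "fan_poly n = (if n = 0 then 1 else \<Sum>k<n. monom (int (n - 1 choose (2 * k)) * catalan k) k)"

lemma fan_poly_0 [simp]: "fan_poly 0 = 1"
  by (simp add: fan_poly_def)

lemma coeff_fan_poly: "coeff (fan_poly (Suc n)) k = int (n choose (2 * k)) * catalan k"
proof -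
  have "coeff (fan_poly (Suc n)) k = (\<Sum>i<Suc n. if i = k then int (n choose (2 * i)) * catalan i else 0)"
    by (simp add: fan_poly_def coeff_sum)
  also have "\<dots> = (if k < Suc n then int (n choose (2 * k)) * catalan k else 0)" by simp
  finally show ?thesis by (auto simp: binomial_eq_0)
qed

lemma degree_fan_poly: "n > 0 \<Longrightarrow> 2 * degree (fan_poly n) < n"
proof -
  assume "n > 0"
  then obtain m where n: "n = Suc m" by (cases n) auto
  have "degree (fan_poly n) \<le> m div 2"
    by (rule degree_le) (auto simp: n coeff_fan_poly binomial_eq_0)
  then show ?thesis using n by auto
qed

lemma degree_fan_poly_le: "degree (fan_poly n) \<le> n"
  using degree_fan_poly[of n] by (cases "n = 0") auto

text \<open>The functional equation of the series, read coefficient by coefficient. The constant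
  term is 0, and \<open>narayana (Suc n)\<close> is the Narayana polynomial of degree
  \<open>n\<close>.\<close>

fun narayana :: "nat \<Rightarrow> int poly" where
  "narayana 0 = 0"
| "narayana (Suc n) = (if n = 0 then 1 else 0) + (1 + T) * narayana n
    + T * (\<Sum>i\<in>{..n}. narayana i * narayana (n - i))"

declare narayana.simps(2) [simp del]

section \<open>The Narayana series and Lagrange inversion\<close>

definition narayana_fps :: "int poly fps" where
  "narayana_fps = Abs_fps narayana"

lemma narayana_fps_eq:
  "narayana_fps = fps_X * (1 + fps_const (1 + T) * narayana_fps + fps_const T * narayana_fps ^ 2)"
proof (rule fps_ext)
  fix n
  show "fps_nth narayana_fps n =
      fps_nth (fps_X * (1 + fps_const (1 + T) * narayana_fps + fps_const T * narayana_fps ^ 2)) n"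
  proof (cases n)
    case (Suc m)
    have "fps_nth (narayana_fps ^ 2) m = (\<Sum>i\<le>m. narayana i * narayana (m - i))"
      by (simp add: narayana_fps_def power2_eq_square fps_mult_nth atLeast0AtMost)
    then show ?thesis using Suc
      by (simp add: fps_X_mult_nth) (simp add: narayana_fps_def narayana.simps(2))
  qed (simp add: narayana_fps_def)
qed

text \<open>Lagrange inversion: \<open>n [u^n] X^k = k [z^(n-k)] \<phi>(z)^n\<close> for the solution of \<open>X = u \<phi>(X)\<close>, here
  with \<open>\<phi>(z) = (1 + z)(1 + t z)\<close>.\<close>
definition kernel :: "int poly poly" where
  "kernel = [:1, 1 + T, T:]"

definition kernel_coeff :: "nat \<Rightarrow> nat \<Rightarrow> int poly" where
  "kernel_coeff n k = (if k \<le> n then coeff (kernel ^ n) (n - k) else 0)"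

text \<open>Multiplication by one more factor \<open>kernel\<close>; powers of the series satisfy
  the same three-term recurrence.\<close>

lemma kernel_coeff_Suc:
  "kernel_coeff (Suc n) (Suc k) =
    kernel_coeff n k + (1 + T) * kernel_coeff n (Suc k) + T * kernel_coeff n (Suc (Suc k))"
proof -
  have c: "coeff (kernel * p) j = coeff p j + (1 + T) * (if j \<ge> 1 then coeff p (j - 1) else 0)
      + T * (if j \<ge> 2 then coeff p (j - 2) else 0)" for p j
    by (cases j; cases "j - 1") (auto simp: kernel_def numeral_2_eq_2)
  show ?thesis
  proof (cases "k \<le> n")
    case True
    have "n - k \<ge> 1 \<longleftrightarrow> Suc k \<le> n" "n - k \<ge> 2 \<longleftrightarrow> Suc (Suc k) \<le> n"
      "n - k - 1 = n - Suc k" "n - k - 2 = n - Suc (Suc k)" using True by auto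
    then show ?thesis using True unfolding kernel_coeff_def power_Suc c by simp
  qed (simp add: kernel_coeff_def)
qed

text \<open>Comparison of coefficients in the derivative of \<open>kernel ^ Suc n\<close>. It
  supplies the relation that the recurrence alone does not give.\<close>

lemma kernel_coeff_deriv:
  assumes "k \<le> n"
  shows "of_nat (n - k) * kernel_coeff (Suc n) (Suc k) =
    of_nat (Suc n) * ((1 + T) * kernel_coeff n (Suc k) + 2 * T * kernel_coeff n (Suc (Suc k)))"
proof (cases "n - k")
  case 0
  then show ?thesis using assms by (simp add: kernel_coeff_def)
next
  case (Suc j)
  have pd: "pderiv kernel = [:1 + T, 2 * T:]"
    by (simp add: kernel_def pderiv_pCons)
  have "of_nat (Suc j) * coeff (kernel ^ Suc n) (Suc j) = coeff (pderiv (kernel ^ Suc n)) j"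
    by (simp only: coeff_pderiv)
  also have "\<dots> = of_nat (Suc n) * coeff (pderiv kernel * kernel ^ n) j"
    unfolding pderiv_power_Suc by (simp add: mult.commute del: of_nat_Suc)
  also have "coeff (pderiv kernel * kernel ^ n) j = (1 + T) * coeff (kernel ^ n) j
      + 2 * T * (if j \<ge> 1 then coeff (kernel ^ n) (j - 1) else 0)"
    unfolding pd by (cases j) auto
  finally have "of_nat (Suc j) * coeff (kernel ^ Suc n) (Suc j) = of_nat (Suc n) *
      ((1 + T) * coeff (kernel ^ n) j + 2 * T * (if j \<ge> 1 then coeff (kernel ^ n) (j - 1) else 0))" .
  moreover have "n - Suc k = j" "j \<ge> 1 \<longleftrightarrow> Suc (Suc k) \<le> n" "n - Suc (Suc k) = j - 1" "Suc k \<le> n"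
    using Suc assms by auto
  ultimately show ?thesis using Suc by (simp add: kernel_coeff_def del: of_nat_Suc power_Suc)
qed

text \<open>Induction on \<open>n\<close> for all \<open>k\<close> at once and without division: the
  recurrence for powers of the series is multiplied by \<open>n\<close>, and the derivative identity
  accounts for the surplus that arises from the factors \<open>Suc j\<close> and
  \<open>Suc (Suc j)\<close>.\<close>

lemma narayana_fps_power:
  "n > 0 \<Longrightarrow> of_nat n * fps_nth (narayana_fps ^ k) n = of_nat k * kernel_coeff n k"
proof (induction n arbitrary: k)
  case (Suc n)
  show ?case
  proof (cases k)
    case (Suc j)
    have "narayana_fps ^ Suc j
      = narayana_fps ^ j * (fps_X * (1 + fps_const (1 + T) * narayana_fps + fps_const T * narayana_fps ^ 2))"
      using narayana_fps_eq by (simp only: power_Suc2)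
    also have "\<dots> = fps_X * (narayana_fps ^ j + fps_const (1 + T) * narayana_fps ^ Suc j
        + fps_const T * narayana_fps ^ Suc (Suc j))"
      by (simp only: distrib_left distrib_right power2_eq_square power_Suc2 mult_ac mult_1_right)
    finally have eq: "narayana_fps ^ Suc j = fps_X * (narayana_fps ^ j + fps_const (1 + T) * narayana_fps ^ Suc j
        + fps_const T * narayana_fps ^ Suc (Suc j))" .
    have "fps_nth (narayana_fps ^ Suc j) (Suc n)
      = fps_nth (fps_X * (narayana_fps ^ j + fps_const (1 + T) * narayana_fps ^ Suc j
        + fps_const T * narayana_fps ^ Suc (Suc j))) (Suc n)"
      by (rule arg_cong[OF eq])
    also have "\<dots> = fps_nth (narayana_fps ^ j) n
        + (1 + T) * fps_nth (narayana_fps ^ Suc j) n + T * fps_nth (narayana_fps ^ Suc (Suc j)) n"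
      by (simp add: fps_X_mult_nth del: power_Suc)
    finally have step: "fps_nth (narayana_fps ^ Suc j) (Suc n) = fps_nth (narayana_fps ^ j) n
        + (1 + T) * fps_nth (narayana_fps ^ Suc j) n + T * fps_nth (narayana_fps ^ Suc (Suc j)) n" .
    show ?thesis
    proof (cases "n = 0")
      case True
      have z0: "fps_nth narayana_fps 0 = 0" by (simp add: narayana_fps_def)
      then have "fps_nth (narayana_fps ^ i) 0 = (if i = 0 then 1 else 0)" for i
        by (simp add: fps_power_zeroth)
      then have "fps_nth (narayana_fps ^ Suc j) (Suc 0) = (if j = 0 then 1 else 0)"
        using step True z0 by simp
      moreover have "kernel_coeff (Suc 0) (Suc j) = (if j = 0 then 1 else 0)"
        by (simp add: kernel_coeff_def kernel_def)
      ultimately show ?thesis using True Suc by simp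
    next
      case False
      have z: "kernel_coeff (Suc n) (Suc j) = 0" "kernel_coeff n j = 0" "kernel_coeff n (Suc j) = 0"
        "kernel_coeff n (Suc (Suc j)) = 0" if "j > n" using that by (simp_all add: kernel_coeff_def)
      have "of_nat n * fps_nth (narayana_fps ^ Suc j) (Suc n) = of_nat j * kernel_coeff n j
          + (1 + T) * (of_nat (Suc j) * kernel_coeff n (Suc j))
          + T * (of_nat (Suc (Suc j)) * kernel_coeff n (Suc (Suc j)))"
        using Suc.IH[of j] Suc.IH[of "Suc j"] Suc.IH[of "Suc (Suc j)"] False
        unfolding step by (simp add: distrib_left mult.left_commute del: power_Suc of_nat_Suc)
      also have "\<dots> = of_nat j * kernel_coeff (Suc n) (Suc j)
          + ((1 + T) * kernel_coeff n (Suc j) + 2 * T * kernel_coeff n (Suc (Suc j)))"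
        by (simp add: kernel_coeff_Suc algebra_simps)
      finally have "of_nat n * (of_nat (Suc n) * fps_nth (narayana_fps ^ Suc j) (Suc n))
          = of_nat (Suc n) * of_nat j * kernel_coeff (Suc n) (Suc j)
          + of_nat (Suc n) * ((1 + T) * kernel_coeff n (Suc j) + 2 * T * kernel_coeff n (Suc (Suc j)))"
        by (simp only: mult.left_commute[of "of_nat n" "of_nat (Suc n)"] distrib_left mult.assoc)
      also have "\<dots> = of_nat n * (of_nat (Suc j) * kernel_coeff (Suc n) (Suc j))"
      proof (cases "j \<le> n")
        case True
        \<comment> \<open>By \<open>kernel_coeff_deriv\<close> the second summand is
          \<open>n - j\<close> times the coefficient, and
          \<open>Suc n * j + (n - j) = n * Suc j\<close>.\<close>
        then have "(of_nat n :: int poly) = of_nat j + of_nat (n - j)" by (simp flip: of_nat_add)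
        then show ?thesis 
          unfolding kernel_coeff_deriv[OF True, symmetric]
          by (simp only: of_nat_Suc) (simp add: distrib_left distrib_right mult_ac add_ac)
      qed (use z in simp)
      finally show ?thesis unfolding Suc using False
        by (simp only: mult_cancel_left of_nat_eq_0_iff simp_thms)
    qed
  qed (simp add: kernel_coeff_def)
qed simp

text \<open>Lagrange inversion for \<open>k = 1\<close>, with \<open>kernel\<close> factored into
  two linear polynomials whose powers expand binomially.\<close>

lemma coeff_narayana:
  "int n * coeff (narayana n) j = int (n choose j) * int (n choose Suc j)"
proof (cases n)
  case (Suc m)
  have k: "kernel = [:1, T:] * [:1, 1:]" by (simp add: kernel_def)
  have "of_nat n * narayana n = kernel_coeff n 1"
    using narayana_fps_power[of n 1] Suc by (simp add: narayana_fps_def)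
  also have "\<dots> = coeff ([:1, T:] ^ n * [:1, 1:] ^ n) m"
    unfolding kernel_coeff_def k power_mult_distrib using Suc by (simp del: power_Suc)
  also have "\<dots> = (\<Sum>i\<le>m. of_nat (n choose i) * (T ^ i * of_nat (n choose (m - i))))"
    unfolding coeff_mult using Suc
    by (intro sum.cong refl) (simp add: coeff_linear_poly_power mult.assoc del: power_Suc)
  finally have "int n * coeff (narayana n) j
      = coeff (\<Sum>i\<le>m. of_nat (n choose i) * (T ^ i * of_nat (n choose (m - i)))) j"
    by (simp only: coeff_of_nat_mult[symmetric] of_nat_id)
  also have "\<dots> = (\<Sum>i\<le>m. if i = j then int (n choose i) * int (n choose (m - i)) else 0)"
    unfolding coeff_sum by (intro sum.cong refl)
      (auto simp: coeff_of_nat_mult coeff_T_power of_nat_poly mult.commute[of "T ^ _"])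
  also have "\<dots> = (if j \<le> m then int (n choose j) * int (n choose (m - j)) else 0)" by simp
  also have "\<dots> = int (n choose j) * int (n choose Suc j)"
    using Suc binomial_symmetric[of "Suc j" n] by (auto simp: binomial_eq_0)
  finally show ?thesis .
qed simp

lemma narayana_1 [simp]: "narayana (Suc 0) = 1"
  by (simp add: narayana.simps(2))

lemma degree_narayana_le: "degree (narayana n) \<le> n"
proof (cases "n = 0")
  case False
  have "coeff (narayana n) j = 0" if "j > n" for j
    using coeff_narayana[of n j] that False by (simp add: binomial_eq_0)
  then show ?thesis by (intro degree_le) auto
qed simp

text \<open>With \<open>a = j - i\<close> and \<open>b = l - j - i\<close>, both sides equal the
  factorial of \<open>Suc l\<close> divided by the factorials of \<open>a\<close>, \<open>b\<close>,
  \<open>i\<close> and \<open>Suc i\<close>.\<close>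

lemma fan_binomial_product:
  assumes "i \<le> j" "i \<le> l - j" "j \<le> l"
  shows "int (Suc l) * (int (l choose (l - j + i)) * (int (l - j + i choose (2 * i)) * catalan i))
    = int (Suc l choose j) * (int (j choose i) * int (Suc l - j choose Suc i))"
proof -
  define a b where "a = j - i" and "b = l - j - i"
  have l: "l = a + b + 2 * i" and j: "j = a + i" using assms by (auto simp: a_def b_def)
  have 1: "l - j + i = b + 2 * i" "Suc l - j = Suc (b + i)" using l j by auto
  have "rat_of_nat (Suc l) * (rat_of_nat (l choose (b + 2 * i)) * (rat_of_nat (b + 2 * i choose (2 * i)) * of_int (catalan i)))
    = rat_of_nat (Suc l choose j) * (rat_of_nat (j choose i) * rat_of_nat (Suc (b + i) choose Suc i))"
  proof -
    define F where "F = (fact (Suc (b + i)) :: rat)"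
    have "F \<noteq> 0" by (simp add: F_def)
    moreover have "rat_of_nat (l choose (b + 2 * i)) = fact l / (fact (b + 2 * i) * fact a)"
      by (subst binomial_fact) (auto simp: l)
    moreover have "rat_of_nat (b + 2 * i choose (2 * i)) = fact (b + 2 * i) / (fact (2 * i) * fact b)"
      by (subst binomial_fact) auto
    moreover have "rat_of_nat (Suc l choose j) = fact (Suc l) / (fact j * F)"
      unfolding F_def by (subst binomial_fact) (simp_all add: l j add.commute[of i b] del: fact_Suc)
    moreover have "rat_of_nat (j choose i) = fact j / (fact i * fact a)"
      by (subst binomial_fact) (auto simp: j)
    moreover have "rat_of_nat (Suc (b + i) choose Suc i) = F / (fact (Suc i) * fact b)"
      unfolding F_def by (subst binomial_fact) auto
    moreover have "(fact (Suc l) :: rat) = rat_of_nat (Suc l) * fact l" by (rule fact_Suc)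
    ultimately show ?thesis unfolding of_int_catalan by (simp add: add_ac del: fact_Suc of_nat_Suc)
  qed
  then have "rat_of_int (int (Suc l) * (int (l choose (b + 2 * i)) * (int (b + 2 * i choose (2 * i)) * catalan i)))
    = rat_of_int (int (Suc l choose j) * (int (j choose i) * int (Suc (b + i) choose Suc i)))"
    by (simp del: of_nat_Suc)
  then show ?thesis unfolding 1 of_int_eq_iff .
qed

text \<open>The left-hand side is a binomial transform; coefficientwise, the claim is Vandermonde's identity.\<close>
lemma run_sum_fan_poly: "run_sum T fan_poly 0 (Suc l) = narayana (Suc l)"
proof (rule poly_eqI)
  fix j
  have "run_sum T fan_poly 0 (Suc l) = (\<Sum>k\<le>l. of_nat (l choose k) * (T ^ (l - k) * fan_poly (Suc k)))"
    by (simp add: run_sum_eq mult.assoc)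
  then have c: "coeff (run_sum T fan_poly 0 (Suc l)) j = (\<Sum>k\<le>l. int (l choose k) *
      (if l - k \<le> j then int (k choose (2 * (j - (l - k)))) * catalan (j - (l - k)) else 0))"
    unfolding coeff_fan_poly[symmetric] by (simp add: coeff_sum coeff_of_nat_mult coeff_T_power_mult)
  have "int (Suc l) * coeff (run_sum T fan_poly 0 (Suc l)) j = int (Suc l choose j) * int (Suc l choose Suc j)"
  proof (cases "j \<le> l")
    case True
    have "(\<Sum>k\<le>l. int (l choose k) *
        (if l - k \<le> j then int (k choose (2 * (j - (l - k)))) * catalan (j - (l - k)) else 0))
      = (\<Sum>i\<le>j. int (l choose (l - j + i)) * (int (l - j + i choose (2 * i)) * catalan i))"
    proof -
      have "(\<Sum>k\<le>l. int (l choose k) *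
          (if l - k \<le> j then int (k choose (2 * (j - (l - k)))) * catalan (j - (l - k)) else 0))
        = (\<Sum>k\<in>{l - j..l}. int (l choose k) * (int (k choose (2 * (j - (l - k)))) * catalan (j - (l - k))))"
        by (rule sum.mono_neutral_cong_right) auto
      also have "\<dots> = (\<Sum>i\<le>j. int (l choose (l - j + i)) * (int (l - j + i choose (2 * i)) * catalan i))"
        by (rule sum.reindex_bij_witness[of _ "\<lambda>i. l - j + i" "\<lambda>k. j - (l - k)"]) (use True in auto)
      finally show ?thesis .
    qed
    then have "int (Suc l) * coeff (run_sum T fan_poly 0 (Suc l)) j =
       (\<Sum>i\<le>j. int (Suc l) * (int (l choose (l - j + i)) * (int (l - j + i choose (2 * i)) * catalan i)))"
      unfolding c by (simp only: sum_distrib_left)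
    also have "\<dots> = (\<Sum>i\<le>j. int (Suc l choose j) * (int (j choose i) * int (Suc l - j choose Suc i)))"
    proof (rule sum.cong)
      fix i assume "i \<in> {..j}"
      then show "int (Suc l) * (int (l choose (l - j + i)) * (int (l - j + i choose (2 * i)) * catalan i))
        = int (Suc l choose j) * (int (j choose i) * int (Suc l - j choose Suc i))"
        using True by (cases "i \<le> l - j") (simp_all only: fan_binomial_product atMost_iff, simp add: binomial_eq_0)
    qed simp
    also have "\<dots> = int (Suc l choose j) * int (\<Sum>i\<le>j. (j choose i) * (Suc l - j choose Suc i))"
      by (simp add: sum_distrib_left)
    also have "(\<Sum>i\<le>j. (j choose i) * (Suc l - j choose Suc i)) = Suc l choose Suc j"
    proof -
      have "(\<Sum>i\<le>j. (j choose i) * (Suc l - j choose Suc i)) = (\<Sum>i\<le>j. (j choose i) * (Suc l - j choose (Suc j - i)))"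
        by (rule sum.reindex_bij_witness[of _ "\<lambda>i. j - i" "\<lambda>i. j - i"])
          (auto simp: binomial_symmetric[symmetric] Suc_diff_le)
      also have "\<dots> = (\<Sum>i\<le>Suc j. (j choose i) * (Suc l - j choose (Suc j - i)))" by simp
      also have "\<dots> = (j + (Suc l - j)) choose Suc j" by (rule vandermonde)
      finally show ?thesis using True by simp
    qed
    finally show ?thesis .
  next
    case False
    have "coeff (run_sum T fan_poly 0 (Suc l)) j = 0"
      unfolding c by (rule sum.neutral) (use False in \<open>auto simp: binomial_eq_0\<close>)
    then show ?thesis using False by (simp add: binomial_eq_0)
  qed
  then show "coeff (run_sum T fan_poly 0 (Suc l)) j = coeff (narayana (Suc l)) j"
    using coeff_narayana[of "Suc l" j] by (metis mult_cancel_left of_nat_eq_0_iff nat.distinct(1))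
qed

section \<open>Palindromicity for linear words\<close>

definition rev_weight :: "(nat \<Rightarrow> int poly) \<Rightarrow> nat \<Rightarrow> int poly" where
  "rev_weight p m = reverse_poly m (p m)"

text \<open>Reversal turns the binomial transform with powers of \<open>T\<close> into the plain
  one. The Narayana polynomial is symmetric of degree \<open>l\<close>, so reversing it at
  \<open>Suc l\<close> only adds a factor \<open>T\<close>.\<close>

lemma run_sum_rev_fan_poly: "run_sum 1 (rev_weight fan_poly) 0 (Suc l) = T * narayana (Suc l)"
proof -
  have "run_sum 1 (rev_weight fan_poly) 0 (Suc l)
     = (\<Sum>k\<le>l. of_nat (l choose k) * reverse_poly (Suc k) (fan_poly (Suc k)))"
    by (simp add: run_sum_eq rev_weight_def)
  also have "\<dots> = (\<Sum>k\<le>l. reverse_poly (Suc l) (of_nat (l choose k) * T ^ (l - k) * fan_poly (Suc k)))"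
    using reverse_poly_of_nat_T_power_mult(1)[OF degree_fan_poly_le[of "Suc _"], of _ "Suc l"]
    by (intro sum.cong) auto
  also have "\<dots> = reverse_poly (Suc l) (\<Sum>k\<le>l. of_nat (l choose k) * T ^ (l - k) * fan_poly (Suc k))"
    using reverse_poly_of_nat_T_power_mult(2)[OF degree_fan_poly_le[of "Suc _"], of _ "Suc l"]
    by (intro reverse_poly_sum[symmetric]) auto
  also have "\<dots> = reverse_poly (Suc l) (narayana (Suc l))"
    unfolding run_sum_fan_poly[symmetric] by (simp add: run_sum_eq)
  also have "\<dots> = T * narayana (Suc l)"
  proof (rule poly_eqI)
    fix j
    have n: "int (Suc l) * coeff (narayana (Suc l)) i = int (Suc l choose i) * int (Suc l choose Suc i)" for i
      by (rule coeff_narayana)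
    have "int (Suc l) * coeff (reverse_poly (Suc l) (narayana (Suc l))) j = int (Suc l) * coeff (T * narayana (Suc l)) j"
    proof (cases "j = 0 \<or> j > Suc l")
      case True
      then show ?thesis using n[of "Suc l"] n[of "j - 1"]
        by (auto simp: coeff_reverse_poly degree_narayana_le coeff_T_mult binomial_eq_0)
    next
      case False
      then have "Suc (Suc l - j) = Suc l - (j - 1)" "j \<le> Suc l" "j - 1 \<le> Suc l" by auto
      then have "(Suc l choose (Suc l - j)) = (Suc l choose j)"
        "(Suc l choose Suc (Suc l - j)) = (Suc l choose (j - 1))"
        by (simp_all only: binomial_symmetric[symmetric])
      then show ?thesis using n[of "Suc l - j"] n[of "j - 1"] False
        by (simp add: coeff_reverse_poly degree_narayana_le coeff_T_mult mult.commute del: of_nat_Suc binomial_Suc_Suc)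
    qed
    then show "coeff (reverse_poly (Suc l) (narayana (Suc l))) j = coeff (T * narayana (Suc l)) j"
      by (metis mult_cancel_left of_nat_eq_0_iff nat.distinct(1))
  qed
  finally show ?thesis .
qed

lemma narayana_Suc_Suc:
  "narayana (Suc (Suc n)) = (1 + T) * narayana (Suc n)
    + T * (\<Sum>l<n. narayana (Suc l) * narayana (n - l))"
proof -
  have "(\<Sum>i\<in>{..Suc n}. narayana i * narayana (Suc n - i)) = (\<Sum>l\<le>n. narayana (Suc l) * narayana (n - l))"
    by (subst sum.atMost_Suc_shift) simp
  also have "\<dots> = (\<Sum>l<n. narayana (Suc l) * narayana (n - l))"
    by (simp add: lessThan_Suc_atMost[symmetric])
  finally show ?thesis by (simp add: narayana.simps(2)[of "Suc n"])
qed

text \<open>The decomposition at the first spoke is the quadratic recursion of the Narayana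
  polynomials. The empty run has weight 1, not \<open>narayana 0\<close>, and this produces the
  \<open>T\<close> in the factor \<open>1 + T\<close>.\<close>

lemma up_sum_fan_poly: "up_sum T fan_poly fan_poly 0 (replicate n New) = narayana (Suc n)"
proof (induction n rule: less_induct)
  case (less n)
  show ?case
  proof (cases n)
    case (Suc m)
    have "(\<Sum>l<n. run_sum T fan_poly 0 l * T * up_sum T fan_poly fan_poly 0 (replicate (n - 1 - l) New))
      = (\<Sum>l<Suc m. run_sum T fan_poly 0 l * T * narayana (Suc (m - l)))"
      using less Suc by (intro sum.cong) auto
    also have "\<dots> = T * narayana (Suc m) + T * (\<Sum>l<m. narayana (Suc l) * narayana (m - l))"
      unfolding sum_distrib_left
      by (subst sum.lessThan_Suc_shift)
        (auto simp: run_sum_fan_poly Suc_diff_Suc mult_ac simp del: run_sum.simps(2) intro!: sum.cong)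
    finally show ?thesis
      using Suc unfolding up_sum_New_first_spoke[of T fan_poly fan_poly 0 n]
      by (simp add: run_sum_fan_poly narayana_Suc_Suc algebra_simps del: run_sum.simps(2))
  qed (simp add: up_sum_Nil)
qed

lemma rev_weight_0 [simp]: "p 0 = 1 \<Longrightarrow> rev_weight p 0 = 1"
  by (simp add: rev_weight_def)

text \<open>The same recursion with the two linear terms exchanged: now nonempty runs carry the
  factor \<open>T\<close> and spokes do not.\<close>

lemma up_sum_rev_fan_poly:
  "up_sum 1 (rev_weight fan_poly) (rev_weight fan_poly) 0 (replicate n New) = narayana (Suc n)"
proof (induction n rule: less_induct)
  case (less n)
  let ?w = "rev_weight fan_poly"
  show ?case
  proof (cases n)
    case (Suc m)
    have "(\<Sum>l<n. run_sum 1 ?w 0 l * 1 * up_sum 1 ?w ?w 0 (replicate (n - 1 - l) New))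
      = (\<Sum>l<Suc m. run_sum 1 ?w 0 l * narayana (Suc (m - l)))"
      using less Suc by (intro sum.cong) auto
    also have "\<dots> = narayana (Suc m) + T * (\<Sum>l<m. narayana (Suc l) * narayana (m - l))"
      unfolding sum_distrib_left
      by (subst sum.lessThan_Suc_shift)
        (auto simp: run_sum_rev_fan_poly Suc_diff_Suc mult_ac simp del: run_sum.simps(2) intro!: sum.cong)
    finally show ?thesis
      using Suc unfolding up_sum_New_first_spoke[of 1 ?w ?w 0 n]
      by (simp add: run_sum_rev_fan_poly narayana_Suc_Suc algebra_simps del: run_sum.simps(2))
  qed (simp add: up_sum_Nil)
qed

lemma up_sum_fan_palindromic:
  "up_sum 1 (rev_weight fan_poly) (rev_weight fan_poly) 0 A = up_sum T fan_poly fan_poly 0 A"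
  by (rule up_sum_eq) (simp_all add: up_sum_fan_poly up_sum_rev_fan_poly)

section \<open>Squares of binomials and the words with spokes\<close>

definition square_binomial_poly :: "nat \<Rightarrow> int poly" where
  "square_binomial_poly n = (\<Sum>k\<le>n. monom (int (n choose k) * int (n choose k)) k)"

lemma coeff_square_binomial_poly:
  "coeff (square_binomial_poly n) k = int (n choose k) * int (n choose k)"
proof -
  have "coeff (square_binomial_poly n) k = (\<Sum>i\<le>n. if i = k then int (n choose i) * int (n choose i) else 0)"
    by (simp add: square_binomial_poly_def coeff_sum)
  also have "\<dots> = (if k \<le> n then int (n choose k) * int (n choose k) else 0)" by simp
  finally show ?thesis by (auto simp: binomial_eq_0)
qed

text \<open>Both \<open>p + q\<close> and \<open>p + s\<close> are binomials in
  \<open>n + 1\<close>, hence rational multiples of \<open>p\<close>; multiplying by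
  \<open>(k + 1) * (n - k + 1)\<close> clears the denominators.\<close>

lemma square_binomial_identity:
  fixes n k :: nat
  defines "p \<equiv> int (n choose k)" and "s \<equiv> int (n choose Suc k)"
  defines "q \<equiv> (if k = 0 then 0 else int (n choose (k - 1)))"
  shows "(int n + 2) * ((p + q) * (p + s)) = (int n + 1) * (2 * (p * p) + p * s + q * p)"
proof (cases "k \<le> n")
  case True
  have s: "(int k + 1) * s = (int n - int k) * p"
  proof -
    have "Suc k * (n choose Suc k) = (n choose k) * (n - k)" by (simp only: binomial_absorb_comp binomial_absorption times_binomial_minus1_eq mult.commute[of "n choose k"])
    then have "int (Suc k * (n choose Suc k)) = int ((n choose k) * (n - k))" by simp
    then show ?thesis using True by (simp add: p_def s_def of_nat_diff algebra_simps)
  qed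
  have q: "(int n - int k + 1) * q = int k * p"
  proof (cases k)
    case (Suc j)
    have "Suc j * (n choose Suc j) = (n choose j) * (n - j)" by (simp only: binomial_absorb_comp binomial_absorption times_binomial_minus1_eq mult.commute[of "n choose j"])
    then have "int (Suc j * (n choose Suc j)) = int ((n choose j) * (n - j))" by simp
    then show ?thesis using True Suc by (simp add: p_def q_def of_nat_diff algebra_simps)
  qed (simp add: q_def)
  let ?c = "(int k + 1) * (int n - int k + 1)"
  have 1: "(p + q) * (int n - int k + 1) = p * (int n + 1)" using q by (simp add: algebra_simps)
  have 2: "(p + s) * (int k + 1) = p * (int n + 1)" using s by (simp add: algebra_simps)
  have "?c * ((int n + 2) * ((p + q) * (p + s)))
      = (int n + 2) * (((p + q) * (int n - int k + 1)) * ((p + s) * (int k + 1)))"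
    by (simp only: mult_ac)
  also have "\<dots> = (int n + 2) * ((p * (int n + 1)) * (p * (int n + 1)))" unfolding 1 2 ..
  also have "\<dots> = (int n + 1) * p * ((int n - int k + 1) * (p * (int n + 1)) + (int k + 1) * (p * (int n + 1)))"
    by (simp add: algebra_simps)
  also have "\<dots> = (int n + 1) * p * ((int n - int k + 1) * ((p + s) * (int k + 1)) + (int k + 1) * ((p + q) * (int n - int k + 1)))"
    unfolding 1 2 ..
  also have "\<dots> = ?c * ((int n + 1) * (2 * (p * p) + p * s + q * p))"
    by (simp add: algebra_simps)
  finally show ?thesis using True by (simp only: mult_cancel_left) auto
next
  case False
  then show ?thesis by (auto simp: p_def s_def q_def binomial_eq_0)
qed

text \<open>The right side is what remains of the symmetrized sum over cyclic words once the
  convolution is eliminated by the Narayana recursion.\<close>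

lemma double_square_binomial_poly:
  "2 * square_binomial_poly n = of_nat (n + 2) * narayana (Suc n) - of_nat n * (1 + T) * narayana n"
proof (rule poly_eqI)
  fix k
  define p s q where "p = int (n choose k)" and "s = int (n choose Suc k)"
    and "q = (if k = 0 then 0 else int (n choose (k - 1)))"
  have 1: "int (Suc n) * coeff (narayana (Suc n)) k = (p + q) * (p + s)"
    unfolding coeff_narayana p_def q_def s_def by (cases k) auto
  have 2: "int n * coeff (narayana n) k = p * s" by (simp add: coeff_narayana p_def s_def)
  have 3: "int n * coeff (T * narayana n) k = q * p"
    using coeff_narayana[of n "k - 1"] by (auto simp: coeff_T_mult p_def q_def)
  have 4: "(int n + 2) * ((p + q) * (p + s)) = (int n + 1) * (2 * (p * p) + p * s + q * p)"
    unfolding p_def s_def q_def by (rule square_binomial_identity)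
  have c: "coeff (of_nat (n + 2) * narayana (Suc n) - of_nat n * (1 + T) * narayana n) k
     = (int n + 2) * coeff (narayana (Suc n)) k - (int n * coeff (narayana n) k + int n * coeff (T * narayana n) k)"
  proof -
    have "of_nat (n + 2) * narayana (Suc n) - of_nat n * (1 + T) * narayana n
       = of_nat (n + 2) * narayana (Suc n) - (of_nat n * narayana n + of_nat n * (T * narayana n))"
      by (simp add: algebra_simps)
    then show ?thesis by (simp only: coeff_diff coeff_add coeff_of_nat_mult) simp
  qed
  have two: "coeff (2 * square_binomial_poly n) k = 2 * (p * p)"
    using coeff_of_nat_mult[of 2 "square_binomial_poly n" k]
    by (simp add: coeff_square_binomial_poly p_def)
  have "(int n + 1) * coeff (of_nat (n + 2) * narayana (Suc n) - of_nat n * (1 + T) * narayana n) k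
     = (int n + 2) * (int (Suc n) * coeff (narayana (Suc n)) k)
       - (int n + 1) * (int n * coeff (narayana n) k + int n * coeff (T * narayana n) k)"
    unfolding c by (simp add: algebra_simps)
  also have "\<dots> = (int n + 2) * ((p + q) * (p + s)) - (int n + 1) * (p * s + q * p)"
    unfolding 1 2 3 ..
  also have "\<dots> = (int n + 1) * coeff (2 * square_binomial_poly n) k"
    unfolding 4 two by (simp add: algebra_simps)
  finally have "(int n + 1) * coeff (of_nat (n + 2) * narayana (Suc n) - of_nat n * (1 + T) * narayana n) k
     = (int n + 1) * coeff (2 * square_binomial_poly n) k" .
  then show "coeff (2 * square_binomial_poly n) k
     = coeff (of_nat (n + 2) * narayana (Suc n) - of_nat n * (1 + T) * narayana n) k"
    by (simp only: mult_cancel_left) auto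
qed

text \<open>The contribution to palindromicity of the flats that contain a spoke.\<close>
lemma spoked_difference:
  "(\<Sum>C\<in>{C \<in> cyc_ups (replicate (Suc n) New). Spoke \<in> set C}. T ^ (Suc n - num_new C) * cyc_scan fan_poly v 0 C)
   - (\<Sum>C\<in>{C \<in> cyc_ups (replicate (Suc n) New). Spoke \<in> set C}. cyc_scan (rev_weight fan_poly) v' 0 C)
   = (T - 1) * square_binomial_poly n" (is "?T - ?U = _")
proof -
  let ?w = "rev_weight fan_poly"
  define N where "N l = narayana l" for l
  have T: "?T = T * (of_nat (Suc n) * run_sum T fan_poly 0 n +
      (\<Sum>l<n. of_nat (Suc l) * T * run_sum T fan_poly 0 l * N (n - l)))"
    unfolding sum_cyc_ups_spoked_Suc up_sum_fan_poly N_def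
    by (intro arg_cong[where f = "\<lambda>p. T * (_ + p)"] sum.cong) (auto simp: Suc_diff_Suc)
  have U: "?U = of_nat (Suc n) * run_sum 1 ?w 0 n +
      (\<Sum>l<n. of_nat (Suc l) * run_sum 1 ?w 0 l * N (n - l))"
    using sum_cyc_ups_spoked_Suc[where n = n and x = 1 and w = ?w and v = v'] unfolding up_sum_rev_fan_poly N_def
    by (simp add: Suc_diff_Suc del: of_nat_Suc)
  show ?thesis
  proof (cases n)
    case 0
    have "square_binomial_poly 0 = 1" by (simp add: square_binomial_poly_def)
    then show ?thesis using T U 0 by simp
  next
    case (Suc m)
    define S where "S = (\<Sum>l\<le>n. of_nat (Suc l) * (N l * N (n - l)))"
    have N0: "N 0 = 0" by (simp add: N_def)
    have R: "run_sum T fan_poly 0 (Suc l) = N (Suc l)" "run_sum 1 ?w 0 (Suc l) = T * N (Suc l)" for l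
      by (simp_all only: N_def run_sum_fan_poly run_sum_rev_fan_poly)
    have S: "S = (\<Sum>l<m. of_nat (Suc (Suc l)) * (N (Suc l) * N (m - l)))"
    proof -
      have "S = (\<Sum>l\<le>m. of_nat (Suc (Suc l)) * (N (Suc l) * N (m - l)))"
        unfolding S_def Suc by (subst sum.atMost_Suc_shift) (simp add: N0)
      then show ?thesis by (simp add: lessThan_Suc_atMost[symmetric] N0)
    qed
    have sT: "(\<Sum>l<n. of_nat (Suc l) * T * run_sum T fan_poly 0 l * N (n - l)) = T * N n + T * S"
      unfolding S Suc sum_distrib_left
      by (subst sum.lessThan_Suc_shift) (auto simp: R mult_ac simp del: run_sum.simps(2) of_nat_Suc intro!: sum.cong)
    have sU: "(\<Sum>l<n. of_nat (Suc l) * run_sum 1 ?w 0 l * N (n - l)) = N n + T * S"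
      unfolding S Suc sum_distrib_left
      by (subst sum.lessThan_Suc_shift) (auto simp: R mult_ac simp del: run_sum.simps(2) of_nat_Suc intro!: sum.cong)
    define c where "c = (\<Sum>l\<le>n. N l * N (n - l))"
    \<comment> \<open>Reflecting \<open>l\<close> to \<open>n - l\<close> averages the linear
      factor, so twice the sum is a multiple of the plain convolution \<open>c\<close>.\<close>
    have "S = (\<Sum>l\<le>n. of_nat (Suc (n - l)) * (N (n - l) * N l))"
      unfolding S_def by (rule sum.reindex_bij_witness[of _ "\<lambda>l. n - l" "\<lambda>l. n - l"]) auto
    then have "2 * S = S + (\<Sum>l\<le>n. of_nat (Suc (n - l)) * (N (n - l) * N l))" by simp
    also have "\<dots> = (\<Sum>l\<le>n. of_nat (n + 2) * (N l * N (n - l)))"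
      unfolding S_def sum.distrib[symmetric]
    proof (rule sum.cong)
      fix l assume "l \<in> {..n}"
      then have "(of_nat (n + 2) :: int poly) = of_nat (Suc l) + of_nat (Suc (n - l))"
        unfolding of_nat_add[symmetric] by simp
      then show "of_nat (Suc l) * (N l * N (n - l)) + of_nat (Suc (n - l)) * (N (n - l) * N l)
        = of_nat (n + 2) * (N l * N (n - l))" by (simp only: distrib_right mult.commute[of "N l"])
    qed simp
    also have "\<dots> = of_nat (n + 2) * c" unfolding c_def by (simp only: sum_distrib_left)
    finally have S2: "2 * S = of_nat (n + 2) * c" .
    have c: "T * c = N (Suc n) - (1 + T) * N n"
      using narayana.simps(2)[of n] Suc by (simp add: c_def N_def)
    have R': "run_sum T fan_poly 0 n = N n" "run_sum 1 ?w 0 n = T * N n"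
      using R[of m] Suc by simp_all
    have "2 * (?T - ?U) = 2 * (T * T - 1) * N n + (T - 1) * T * (2 * S)"
      unfolding T U sT sU R' by (simp add: algebra_simps)
    also have "\<dots> = 2 * (T * T - 1) * N n + (T - 1) * of_nat (n + 2) * (T * c)"
      unfolding S2 by (simp only: mult_ac)
    also have "\<dots> = (T - 1) * (of_nat (n + 2) * N (Suc n) - of_nat n * (1 + T) * N n)"
      unfolding c by (simp add: algebra_simps)
    also have "\<dots> = 2 * ((T - 1) * square_binomial_poly n)"
      unfolding N_def double_square_binomial_poly[symmetric] by (simp add: mult_ac)
    finally show ?thesis by (simp only: mult_cancel_left) simp
  qed
qed

section \<open>Polynomials of wheels and whirls\<close>

text \<open>The contribution of the cyclic words without spokes above \<open>m\<close> letters
  \<open>New\<close>: \<open>k\<close> positions remain segments, the others are glued.\<close>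

definition binomial_transform :: "(nat \<Rightarrow> int poly) \<Rightarrow> nat \<Rightarrow> int poly" where
  "binomial_transform p m = (\<Sum>k\<le>m. of_nat (m choose k) * T ^ (m - k) * p k)"

lemma coeff_binomial_transform:
  assumes p: "\<And>k. degree (p k) \<le> k"
  shows "coeff (binomial_transform p m) j =
    (if j \<le> m then \<Sum>i\<le>j. int (m choose (m - j + i)) * coeff (p (m - j + i)) i else 0)"
proof -
  have c: "coeff (binomial_transform p m) j =
      (\<Sum>k\<le>m. int (m choose k) * (if m - k \<le> j then coeff (p k) (j - (m - k)) else 0))"
    by (simp add: binomial_transform_def coeff_sum mult.assoc coeff_of_nat_mult coeff_T_power_mult)
  show ?thesis
  proof (cases "j \<le> m")
    case True
    have "coeff (binomial_transform p m) j = (\<Sum>k\<in>{m - j..m}. int (m choose k) * coeff (p k) (j - (m - k)))"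
      unfolding c by (rule sum.mono_neutral_cong_right) auto
    also have "\<dots> = (\<Sum>i\<le>j. int (m choose (m - j + i)) * coeff (p (m - j + i)) i)"
      by (rule sum.reindex_bij_witness[of _ "\<lambda>i. m - j + i" "\<lambda>k. j - (m - k)"]) (use True in auto)
    finally show ?thesis using True by simp
  next
    case False
    have z: "coeff (p k) (j - (m - k)) = 0" if "k \<le> m" for k
      using that False by (intro coeff_eq_0 le_less_trans[OF p]) auto
    have "coeff (binomial_transform p m) j = 0"
      unfolding c by (rule sum.neutral) (use z in auto)
    then show ?thesis using False by simp
  qed
qed

lemma degree_binomial_transform:
  "(\<And>k. degree (p k) \<le> k) \<Longrightarrow> degree (binomial_transform p m) \<le> m"
  by (intro degree_le) (simp add: coeff_binomial_transform)

lemma reverse_binomial_transform: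
  assumes p: "\<And>k. degree (p k) \<le> k"
  shows "reverse_poly m (binomial_transform p m) = (\<Sum>k\<le>m. of_nat (m choose k) * rev_weight p k)"
  unfolding binomial_transform_def rev_weight_def
  by (subst reverse_poly_sum) (auto simp: reverse_poly_of_nat_T_power_mult[OF p] intro!: sum.cong)

lemma coeff_reverse_binomial_transform:
  assumes p: "\<And>k. degree (p k) \<le> k"
  shows "coeff (reverse_poly m (binomial_transform p m)) j =
    (if j \<le> m then coeff (binomial_transform p m) (m - j) else 0)"
  by (rule coeff_reverse_poly[OF degree_binomial_transform[OF p]])

text \<open>Frees the first factor from the summation index: for \<open>k = m - j + c\<close> it
  becomes \<open>m choose j\<close>, and Vandermonde's identity applies to the rest.\<close>

lemma choose_mult_complement:
  assumes "c \<le> k" "k \<le> m"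
  shows "(m choose k) * (k choose c) = (m choose (m - k + c)) * (m - k + c choose c)"
proof -
  have "(m choose k) * (k choose c) = (m choose c) * (m - c choose (k - c))"
    by (rule choose_mult[OF assms])
  also have "m - c choose (k - c) = (m - c choose (m - c - (k - c)))"
    using assms by (intro binomial_symmetric) auto
  also have "m - c - (k - c) = m - k + c - c" using assms by auto
  also have "(m choose c) * (m - c choose (m - k + c - c)) = (m choose (m - k + c)) * (m - k + c choose c)"
    using assms by (intro choose_mult[symmetric]) auto
  finally show ?thesis .
qed

text \<open>The coefficient is the integer form of the quotient in the theorem. At
  \<open>m = 0\<close> the sum is empty, although the product would give 1.\<close>

definition whirl_poly :: "nat \<Rightarrow> int poly" where
  "whirl_poly m = (\<Sum>k<m. monom (int ((m choose k) * (m - k - 1 choose k))) k)"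

lemma coeff_whirl_poly:
  "coeff (whirl_poly m) k = (if m = 0 then 0 else int ((m choose k) * (m - k - 1 choose k)))"
proof -
  have "coeff (whirl_poly m) k = (\<Sum>i<m. if i = k then int ((m choose i) * (m - i - 1 choose i)) else 0)"
    by (simp add: whirl_poly_def coeff_sum del: of_nat_mult)
  also have "\<dots> = (if k < m then int ((m choose k) * (m - k - 1 choose k)) else 0)" by simp
  finally show ?thesis by (auto simp: binomial_eq_0 not_less le_less)
qed

lemma degree_whirl_poly: "m > 0 \<Longrightarrow> 2 * degree (whirl_poly m) < m"
proof -
  assume m: "m > 0"
  have "degree (whirl_poly m) \<le> (m - 1) div 2"
  proof (rule degree_le, intro allI impI)
    fix i assume "(m - 1) div 2 < i"
    then have "m - i - 1 < i" by auto
    then show "coeff (whirl_poly m) i = 0" by (simp add: coeff_whirl_poly binomial_eq_0)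
  qed
  then show ?thesis using m by auto
qed

lemma whirl_poly_0 [simp]: "whirl_poly 0 = 0" and whirl_poly_1 [simp]: "whirl_poly (Suc 0) = 1"
  by (simp_all add: whirl_poly_def)

lemma degree_whirl_poly_le: "degree (whirl_poly m) \<le> m"
  using degree_whirl_poly[of m] by (cases "m = 0") auto

lemma coeff_binomial_transform_whirl:
  assumes "m > 0"
  shows "coeff (binomial_transform whirl_poly m) j = int ((m choose j) * (m - 1 choose j))"
proof (cases "j < m")
  case True
  have "coeff (binomial_transform whirl_poly m) j
     = (\<Sum>i\<le>j. int (m choose (m - j + i)) * coeff (whirl_poly (m - j + i)) i)"
    using True by (simp add: coeff_binomial_transform degree_whirl_poly_le)
  also have "\<dots> = (\<Sum>i\<le>j. int ((m choose j) * ((j choose i) * (m - j - 1 choose (j - (j - i))))))"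
  proof (rule sum.cong)
    fix i assume i: "i \<in> {..j}"
    have "(m choose (m - j + i)) * (m - j + i choose i) = (m choose j) * (j choose i)"
      using choose_mult_complement[of i "m - j + i" m] i True by simp
    then have *: "int (m choose (m - j + i)) * int (m - j + i choose i) = int (m choose j) * int (j choose i)"
      by (simp only: of_nat_mult[symmetric])
    have "m - j + i - i - 1 = m - j - 1" "j - (j - i) = i" "m - j + i \<noteq> 0" using i True by auto
    then show "int (m choose (m - j + i)) * coeff (whirl_poly (m - j + i)) i
      = int ((m choose j) * ((j choose i) * (m - j - 1 choose (j - (j - i)))))"
      using * True by (simp add: coeff_whirl_poly mult.assoc[symmetric])
  qed simp
  also have "\<dots> = int ((m choose j) * (\<Sum>i\<le>j. (j choose i) * (m - j - 1 choose (j - (j - i)))))"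
    by (simp add: sum_distrib_left)
  also have "(\<Sum>i\<le>j. (j choose i) * (m - j - 1 choose (j - (j - i))))
     = (\<Sum>i\<le>j. (j choose i) * (m - j - 1 choose (j - i)))"
    by (rule sum.reindex_bij_witness[of _ "\<lambda>i. j - i" "\<lambda>i. j - i"]) (auto simp: binomial_symmetric[symmetric])
  also have "\<dots> = (j + (m - j - 1)) choose j" by (rule vandermonde)
  finally show ?thesis using True by simp
next
  case False
  show ?thesis
  proof (cases "j = m")
    case True
    have "coeff (whirl_poly i) i = 0" for i
      by (cases "i = 0") (auto simp: coeff_whirl_poly)
    then show ?thesis using True assms by (simp add: coeff_binomial_transform degree_whirl_poly_le)
  qed (use False in \<open>simp add: coeff_binomial_transform degree_whirl_poly_le\<close>)
qed

text \<open>At exponent \<open>j\<close> the left side is \<open>Suc n choose j\<close> times the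
  difference of two neighbouring binomials in \<open>n\<close>; by Pascal's rule the first factor is
  their sum, which gives a difference of squares.\<close>

lemma whirl_identity:
  "binomial_transform whirl_poly (Suc n) - reverse_poly (Suc n) (binomial_transform whirl_poly (Suc n))
    = (1 - T) * square_binomial_poly n"
proof (rule poly_eqI)
  fix j
  let ?b = "binomial_transform whirl_poly (Suc n)"
  have b: "coeff ?b j = int ((Suc n choose j) * (n choose j))" for j
    using coeff_binomial_transform_whirl[of "Suc n" j] by simp
  have r: "coeff (reverse_poly (Suc n) ?b) j = (if j = 0 then 0 else int ((Suc n choose j) * (n choose (j - 1))))"
  proof (cases "j = 0 \<or> j > Suc n")
    case True
    then show ?thesis using b[of "Suc n - j"]
      by (auto simp: coeff_reverse_binomial_transform degree_whirl_poly_le binomial_eq_0)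
  next
    case False
    then have "j \<le> Suc n" "j - 1 \<le> n" "n - (j - 1) = Suc n - j" by auto
    then have "(Suc n choose (Suc n - j)) = (Suc n choose j)" "(n choose (Suc n - j)) = (n choose (j - 1))"
      using binomial_symmetric[of j "Suc n"] binomial_symmetric[of "j - 1" n] by (simp_all del: binomial_Suc_Suc)
    then show ?thesis using b[of "Suc n - j"] False
      by (simp add: coeff_reverse_binomial_transform degree_whirl_poly_le del: binomial_Suc_Suc)
  qed
  have "(1 - T) * square_binomial_poly n = square_binomial_poly n - T * square_binomial_poly n"
    by (simp add: algebra_simps)
  then have "coeff ((1 - T) * square_binomial_poly n) j
    = int (n choose j) * int (n choose j) - (if j = 0 then 0 else int (n choose (j - 1)) * int (n choose (j - 1)))"
    by (simp add: coeff_T_mult coeff_square_binomial_poly)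
  then show "coeff (?b - reverse_poly (Suc n) ?b) j = coeff ((1 - T) * square_binomial_poly n) j"
    unfolding coeff_diff r b by (cases j) (auto simp: algebra_simps)
qed

text \<open>The guard enforces the degree bound where truncated subtraction would break it: at
  \<open>m = 2\<close>, \<open>k = 1\<close> the first product would be 1.\<close>

definition relaxation_coeff :: "nat \<Rightarrow> nat \<Rightarrow> int" where
  "relaxation_coeff m k = (if k = 0 \<or> m \<le> 2 * k then 0
    else int ((m choose Suc k) * (m - k - 2 choose (k - 1))) - int ((m choose (k - 1)) * (m - k choose Suc k)))"

text \<open>The effect on the Kazhdan--Lusztig polynomial of relaxing the rim of the wheel.\<close>
definition relaxation_poly :: "nat \<Rightarrow> int poly" where
  "relaxation_poly m = (\<Sum>k<m. monom (relaxation_coeff m k) k)"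

lemma coeff_relaxation_poly: "coeff (relaxation_poly m) k = relaxation_coeff m k"
proof -
  have "coeff (relaxation_poly m) k = (\<Sum>i<m. if i = k then relaxation_coeff m i else 0)"
    by (simp add: relaxation_poly_def coeff_sum)
  also have "\<dots> = (if k < m then relaxation_coeff m k else 0)" by simp
  finally show ?thesis by (auto simp: relaxation_coeff_def)
qed

lemma degree_relaxation_poly: "m > 0 \<Longrightarrow> 2 * degree (relaxation_poly m) < m"
proof -
  assume m: "m > 0"
  have "degree (relaxation_poly m) \<le> (m - 1) div 2"
    by (rule degree_le) (auto simp: coeff_relaxation_poly relaxation_coeff_def)
  then show ?thesis using m by auto
qed

lemma relaxation_poly_0 [simp]: "relaxation_poly 0 = 0"
  and relaxation_poly_1 [simp]: "relaxation_poly (Suc 0) = 0"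
  by (simp_all add: relaxation_poly_def relaxation_coeff_def)

lemma degree_relaxation_poly_le: "degree (relaxation_poly m) \<le> m"
  using degree_relaxation_poly[of m] by (cases "m = 0") auto

text \<open>Each of the two products is summed by Vandermonde's identity as for the whirl; the
  summation starts at 1 because \<open>relaxation_coeff\<close> vanishes at 0.\<close>

lemma coeff_binomial_transform_relaxation:
  "coeff (binomial_transform relaxation_poly m) j =
    (if 0 < j \<and> j + 2 \<le> m then int ((m choose Suc j) * (m - 1 choose (j - 1))) - int ((m choose (j - 1)) * (m - 1 choose Suc j)) else 0)"
proof (cases "0 < j \<and> j + 2 \<le> m")
  case False
  then have "relaxation_coeff (m - j + i) i = 0" if "i \<le> j" "j \<le> m" for i
    using that by (auto simp: relaxation_coeff_def)
  then show ?thesis using False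
    by (auto simp: coeff_binomial_transform degree_relaxation_poly_le coeff_relaxation_poly)
next
  case True
  then obtain J where j: "j = Suc J" by (cases j) auto
  have "coeff (binomial_transform relaxation_poly m) j
     = (\<Sum>i\<le>j. int (m choose (m - j + i)) * relaxation_coeff (m - j + i) i)"
    using True by (simp add: coeff_binomial_transform degree_relaxation_poly_le coeff_relaxation_poly)
  also have "\<dots> = (\<Sum>i\<le>J. int (m choose (m - j + Suc i)) * relaxation_coeff (m - j + Suc i) (Suc i))"
    unfolding j by (subst sum.atMost_Suc_shift) (simp add: relaxation_coeff_def)
  also have "\<dots> = (\<Sum>i\<le>J. int ((m choose Suc j) * ((m - j - 2 choose i) * (Suc j choose (J - i))))
       - int ((m choose J) * ((J choose (J - i)) * (m - j choose (Suc (Suc i))))))"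
  proof (rule sum.cong)
    fix i assume i: "i \<in> {..J}"
    let ?k = "m - j + Suc i"
    show "int (m choose ?k) * relaxation_coeff ?k (Suc i)
      = int ((m choose Suc j) * ((m - j - 2 choose i) * (Suc j choose (J - i))))
       - int ((m choose J) * ((J choose (J - i)) * (m - j choose (Suc (Suc i)))))"
    proof (cases "?k \<le> 2 * Suc i")
      case True': True
      then have "m - j - 2 < i" "m - j < Suc (Suc i)" using True by auto
      then show ?thesis using True' by (simp add: relaxation_coeff_def binomial_eq_0)
    next
      case False
      have k: "?k - Suc i - 2 = m - j - 2" "?k - Suc i = m - j" "m - ?k + Suc (Suc i) = Suc j" "m - ?k + i = J"
        using i j True by auto
      have "(m choose ?k) * (?k choose Suc (Suc i)) = (m choose Suc j) * (Suc j choose Suc (Suc i))"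
        using choose_mult_complement[of "Suc (Suc i)" ?k m] k i j True False by simp
      moreover have "(Suc j choose Suc (Suc i)) = (Suc j choose (J - i))"
        using binomial_symmetric[of "Suc (Suc i)" "Suc j"] i j by simp
      moreover have "(m choose ?k) * (?k choose i) = (m choose J) * (J choose i)"
        using choose_mult_complement[of i ?k m] k i j True by simp
      moreover have "(J choose i) = (J choose (J - i))"
        using binomial_symmetric[of i J] i by simp
      ultimately have
        1: "int (m choose ?k) * int (?k choose Suc (Suc i)) = int (m choose Suc j) * int (Suc j choose (J - i))"
        and 2: "int (m choose ?k) * int (?k choose i) = int (m choose J) * int (J choose (J - i))"
        by (simp_all only: of_nat_mult[symmetric])
      have "relaxation_coeff ?k (Suc i) = int (?k choose Suc (Suc i)) * int (m - j - 2 choose i)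
          - int (?k choose i) * int (m - j choose Suc (Suc i))"
        using False k unfolding relaxation_coeff_def by (simp only: diff_Suc_1 of_nat_mult) simp
      then have "int (m choose ?k) * relaxation_coeff ?k (Suc i)
         = (int (m choose ?k) * int (?k choose Suc (Suc i))) * int (m - j - 2 choose i)
          - (int (m choose ?k) * int (?k choose i)) * int (m - j choose Suc (Suc i))"
        by (simp only: right_diff_distrib mult.assoc)
      then show ?thesis unfolding 1 2 by (simp only: of_nat_mult mult_ac)
    qed
  qed simp
  also have "\<dots> = int ((m choose Suc j) * (\<Sum>i\<le>J. (m - j - 2 choose i) * (Suc j choose (J - i))))
      - int ((m choose J) * (\<Sum>i\<le>J. (J choose (J - i)) * (m - j choose (Suc (Suc i)))))"
    by (simp only: sum_subtractf of_nat_mult of_nat_sum sum_distrib_left)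
  also have "(\<Sum>i\<le>J. (m - j - 2 choose i) * (Suc j choose (J - i))) = (m - 1 choose J)"
  proof -
    have "m - j - 2 + Suc j = m - 1" using True by auto
    then show ?thesis using vandermonde[of "m - j - 2" "Suc j" J] by (simp only:)
  qed
  also have "(\<Sum>i\<le>J. (J choose (J - i)) * (m - j choose (Suc (Suc i)))) = (m - 1 choose Suc j)"
  proof -
    have "(\<Sum>i\<le>J. (J choose (J - i)) * (m - j choose (Suc (Suc i))))
       = (\<Sum>i\<le>J. (J choose i) * (m - j choose (Suc j - i)))"
      by (rule sum.reindex_bij_witness[of _ "\<lambda>i. J - i" "\<lambda>i. J - i"]) (auto simp: j Suc_diff_le)
    also have "\<dots> = (\<Sum>i\<le>Suc j. (J choose i) * (m - j choose (Suc j - i)))"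
      by (rule sum.mono_neutral_left) (auto simp: j binomial_eq_0)
    also have "\<dots> = (J + (m - j)) choose Suc j" by (rule vandermonde)
    also have "J + (m - j) = m - 1" using True j by auto
    finally show ?thesis .
  qed
  finally show ?thesis using True j by simp
qed

text \<open>The transform is symmetric under \<open>j\<close> to \<open>m - j\<close> for
  \<open>2 <= j <= m - 2\<close> and cancels there. At \<open>j = 1\<close> and
  \<open>j = m - 1\<close> one of the two coefficients is cut off to 0, and for
  \<open>m >= 3\<close> the other is \<open>m - 1\<close>.\<close>

lemma relaxation_identity:
  assumes "m \<ge> 2"
  shows "binomial_transform relaxation_poly m - reverse_poly m (binomial_transform relaxation_poly m)
    = of_nat (m - 1) * (T - T ^ (m - 1))"
proof (rule poly_eqI)
  fix j
  let ?b = "binomial_transform relaxation_poly m"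
  define q where "q j = int ((m choose Suc j) * (m - 1 choose (j - 1))) - int ((m choose (j - 1)) * (m - 1 choose Suc j))" for j
  have b: "coeff ?b j = (if 0 < j \<and> j + 2 \<le> m then q j else 0)" for j
    by (simp add: coeff_binomial_transform_relaxation q_def)
  have r: "coeff (reverse_poly m ?b) j = (if 2 \<le> j \<and> j < m then q (m - j) else 0)"
    using assms by (auto simp: coeff_reverse_binomial_transform degree_relaxation_poly_le b)
  obtain n where n: "m = Suc (Suc n)" using assms by (metis add_2_eq_Suc le_Suc_ex)
  have q1: "q 1 = int (m - 1)" if "m \<ge> 3"
  proof -
    have "(m choose 2) = (m - 1) + (m - 1 choose 2)"
      by (simp add: n numeral_2_eq_2)
    then show ?thesis by (simp add: q_def numeral_2_eq_2)
  qed
  have sym: "q j = q (m - j)" if j: "2 \<le> j" "j + 2 \<le> m"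
  proof -
    obtain i where i: "j = Suc (Suc i)" using j by (metis add_2_eq_Suc le_Suc_ex)
    have s: "(m choose Suc (m - j)) = (m choose Suc i)" "(m choose (m - j - 1)) = (m choose Suc j)"
      "(m - 1 choose (m - j - 1)) = (m - 1 choose j)" "(m - 1 choose Suc (m - j)) = (m - 1 choose i)"
      using binomial_symmetric[of "Suc i" m] binomial_symmetric[of "Suc j" m]
        binomial_symmetric[of j "m - 1"] binomial_symmetric[of i "m - 1"] i j
      by (simp_all add: Suc_diff_le Suc_diff_Suc del: binomial_Suc_Suc)
    have e: "m = Suc (m - 1)" using j by simp
    have p1: "(m choose Suc j) = (m - 1 choose j) + (m - 1 choose Suc j)" by (subst e) simp
    have p2: "(m choose Suc i) = (m - 1 choose i) + (m - 1 choose Suc i)" by (subst e) simp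
    show ?thesis unfolding q_def s using p1 p2 i by (simp add: algebra_simps)
  qed
  have rhs: "coeff (of_nat (m - 1) * (T - T ^ (m - 1))) j
    = int (m - 1) * ((if j = 1 then 1 else 0) - (if j = m - 1 then 1 else 0))"
    using coeff_T_power[of 1 j] coeff_T_power[of "m - 1" j] by (simp add: coeff_of_nat_mult del: of_nat_diff)
  show "coeff (?b - reverse_poly m ?b) j = coeff (of_nat (m - 1) * (T - T ^ (m - 1))) j"
  proof (cases "2 \<le> j \<and> j + 2 \<le> m")
    case True
    then show ?thesis unfolding coeff_diff rhs b r using sym by auto
  next
    case False
    show ?thesis
    proof (cases "m = 2")
      case True
      then show ?thesis unfolding coeff_diff rhs b r by auto
    next
      case m: False
      have "j = 1 \<or> j = m - 1 \<or> j = 0 \<or> j \<ge> m" using False by auto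
      moreover have "m - (m - 1) = 1" using assms by auto
      ultimately show ?thesis unfolding coeff_diff rhs b r using m assms q1 by auto
    qed
  qed
qed

definition wheel_poly :: "nat \<Rightarrow> int poly" where
  "wheel_poly m = whirl_poly m - relaxation_poly m"

lemma degree_wheel_poly: "m > 0 \<Longrightarrow> 2 * degree (wheel_poly m) < m"
  using degree_whirl_poly[of m] degree_relaxation_poly[of m] degree_diff_le_max[of "whirl_poly m" "relaxation_poly m"]
  by (auto simp: wheel_poly_def)

text \<open>The flat with \<open>k = 0\<close> segments is the rim, of corank 1; the sets with one segment are not flats.\<close>
lemma wheel_identity:
  assumes m: "m = Suc n" "n > 0"
  shows "(\<Sum>k\<le>m. of_nat (m choose k) * (if k = 0 then T ^ (m - 1) - T else if k = 1 then 0
      else T ^ (m - k) * wheel_poly k - rev_weight wheel_poly k)) = (1 - T) * square_binomial_poly n"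
proof -
  define h where "h p k = T ^ (m - k) * p k - rev_weight p k" for p :: "nat \<Rightarrow> int poly" and k
  have H: "(\<Sum>k\<le>m. of_nat (m choose k) * h p k) = binomial_transform p m - reverse_poly m (binomial_transform p m)"
    if "\<And>k. degree (p k) \<le> k" for p
    unfolding h_def reverse_binomial_transform[OF that]
    unfolding binomial_transform_def sum_subtractf[symmetric]
    by (intro sum.cong) (auto simp: algebra_simps)
  have h_wheel: "h wheel_poly k = h whirl_poly k - h relaxation_poly k" for k
  proof -
    have "rev_weight wheel_poly k = rev_weight whirl_poly k - rev_weight relaxation_poly k"
      unfolding rev_weight_def wheel_poly_def
    proof (rule poly_eqI)
      fix i
      have "degree (whirl_poly k - relaxation_poly k) \<le> k"
        using degree_diff_le[OF degree_whirl_poly_le[of k] degree_relaxation_poly_le[of k]] .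
      then show "coeff (reverse_poly k (whirl_poly k - relaxation_poly k)) i =
        coeff (reverse_poly k (whirl_poly k) - reverse_poly k (relaxation_poly k)) i"
        by (simp add: coeff_reverse_poly degree_whirl_poly_le degree_relaxation_poly_le)
    qed
    then show ?thesis by (simp add: h_def wheel_poly_def algebra_simps)
  qed
  have h1: "h wheel_poly 1 = T ^ (m - 1) - T"
    by (simp add: h_def wheel_poly_def rev_weight_def T_def)
  have h0: "h wheel_poly 0 = 0"
    by (simp add: h_def wheel_poly_def rev_weight_def)
  have split: "(\<Sum>k\<le>m. of_nat (m choose k) * f k) = f 0 + of_nat m * f 1 +
      (\<Sum>k\<in>{2..m}. of_nat (m choose k) * f k)" for f :: "nat \<Rightarrow> int poly"
  proof -
    have "{..m} = insert 0 (insert 1 {2..m})" using m by auto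
    then show ?thesis by simp
  qed
  have "(\<Sum>k\<le>m. of_nat (m choose k) * h wheel_poly k)
     = (\<Sum>k\<le>m. of_nat (m choose k) * h whirl_poly k) - (\<Sum>k\<le>m. of_nat (m choose k) * h relaxation_poly k)"
    unfolding h_wheel by (simp add: algebra_simps sum_subtractf)
  also have "\<dots> = (1 - T) * square_binomial_poly n - of_nat (m - 1) * (T - T ^ (m - 1))"
    using whirl_identity[of n] relaxation_identity[of m] m
    unfolding H[OF degree_whirl_poly_le] H[OF degree_relaxation_poly_le] by simp
  finally have "of_nat m * (T ^ (m - 1) - T) + (\<Sum>k\<in>{2..m}. of_nat (m choose k) * h wheel_poly k)
     = (1 - T) * square_binomial_poly n - of_nat (m - 1) * (T - T ^ (m - 1))"
    unfolding split h0 h1 by simp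
  \<comment> \<open>The \<open>m\<close> omitted terms for one segment, less the
    \<open>m - 1\<close> contributed by the relaxation, leave exactly one
    \<open>T ^ (m - 1) - T\<close>, the term assigned to the rim.\<close>
  moreover have "(of_nat m :: int poly) = of_nat (m - 1) + 1" using m by simp
  ultimately have "T ^ (m - 1) - T + (\<Sum>k\<in>{2..m}. of_nat (m choose k) * h wheel_poly k)
     = (1 - T) * square_binomial_poly n"
    by (simp add: algebra_simps)
  then show ?thesis unfolding split h_def by (simp cong: sum.cong_simp)
qed

text \<open>Reversal is multiplicative when each factor is reversed at its own length, and the run
  lengths add up to \<open>m + num_new C\<close>.\<close>

lemma scan_reverse:
  assumes w: "\<And>k. degree (w k) \<le> k" and \<phi>: "\<And>k. degree (\<phi> k) \<le> k"
  shows "degree (scan w \<phi> m C) \<le> m + num_new C"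
    and "reverse_poly (m + num_new C) (scan w \<phi> m C) = scan (rev_weight w) (rev_weight \<phi>) m C"
proof -
  have "degree (scan w \<phi> m C) \<le> m + num_new C \<and>
    reverse_poly (m + num_new C) (scan w \<phi> m C) = scan (rev_weight w) (rev_weight \<phi>) m C"
  proof (induction C arbitrary: m)
    case (Cons c C)
    have "degree (w m * scan w \<phi> 0 C) \<le> m + num_new C"
      using degree_mult_le[of "w m" "scan w \<phi> 0 C"] w[of m] Cons.IH[of 0] by simp
    moreover have "reverse_poly (m + num_new C) (w m * scan w \<phi> 0 C)
        = rev_weight w m * scan (rev_weight w) (rev_weight \<phi>) 0 C"
      using reverse_poly_mult[OF w[of m], of "scan w \<phi> 0 C" "num_new C"] Cons.IH[of 0]
      by (simp add: rev_weight_def[of w m])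
    ultimately show ?case using Cons.IH[of m] Cons.IH[of "Suc m"] by (cases c) auto
  qed (use \<phi> in \<open>simp add: rev_weight_def\<close>)
  then show "degree (scan w \<phi> m C) \<le> m + num_new C"
    and "reverse_poly (m + num_new C) (scan w \<phi> m C) = scan (rev_weight w) (rev_weight \<phi>) m C"
    by auto
qed

text \<open>Truncated subtraction lets the bound hold for the empty run too, and the bounds of the
  runs add up to at most the stated one.\<close>

lemma degree_scan:
  assumes w: "\<And>k. 2 * degree (w k) \<le> k - 1"
  shows "2 * degree (scan w w m C) \<le> m + num_new C - 1"
proof (induction C arbitrary: m)
  case (Cons c C)
  have "2 * degree (w m * scan w w 0 C) \<le> m + num_new C - 1"
    using degree_mult_le[of "w m" "scan w w 0 C"] w[of m] Cons.IH[of 0] by simp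
  then show ?case using Cons.IH[of m] Cons.IH[of "Suc m"] by (cases c) auto
qed (use w in simp)

lemma double_degree_fan_poly: "2 * degree (fan_poly k) \<le> k - 1"
  using degree_fan_poly[of k] by (cases "k = 0") auto

lemma reverse_scan_fan:
  "reverse_poly (num_new C) (scan fan_poly fan_poly 0 C)
    = scan (rev_weight fan_poly) (rev_weight fan_poly) 0 C"
  using scan_reverse(2)[of fan_poly fan_poly 0 C] degree_fan_poly_le by simp

lemma sum_scan_palindromic:
  "(\<Sum>C\<in>ups False A. reverse_poly (num_new C) (scan fan_poly fan_poly 0 C))
    = (\<Sum>C\<in>ups False A. T ^ (num_new A - num_new C) * scan fan_poly fan_poly 0 C)"
  using up_sum_fan_palindromic[of A] by (simp add: up_sum_def reverse_scan_fan)

lemma cyc_scan_spoked: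
  assumes "Spoke \<in> set C"
  shows "\<exists>D. num_new D = num_new C \<and> (\<forall>w v :: nat \<Rightarrow> int poly. cyc_scan w v 0 C = scan w w 0 D)"
proof -
  obtain A B where C: "C = A @ Spoke # B" using split_list[OF assms] by auto
  then show ?thesis using cyc_scan_Spoke by (intro exI[of _ "B @ A"]) auto
qed

lemma degree_cyc_scan_fan:
  "Spoke \<in> set C \<Longrightarrow> 2 * degree (cyc_scan fan_poly v 0 C) \<le> num_new C - 1"
  using cyc_scan_spoked[of C] degree_scan[of fan_poly 0, OF double_degree_fan_poly] by (metis add_0)

lemma reverse_cyc_scan_fan:
  "Spoke \<in> set C \<Longrightarrow> reverse_poly (num_new C) (cyc_scan fan_poly v 0 C) = cyc_scan (rev_weight fan_poly) v' 0 C"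
  using cyc_scan_spoked[of C] reverse_scan_fan by metis

lemma Spoke_in_cyc_ups: "C \<in> cyc_ups A \<Longrightarrow> Spoke \<in> set A \<Longrightarrow> Spoke \<in> set C"
  using cyc_ups_split_Spoke split_list[of Spoke A] by (metis in_set_conv_decomp)

lemma ups_Glue: "ups b (replicate n Glue) = {replicate n (if b then Glue else Spoke)}"
  by (induction n arbitrary: b) auto

text \<open>Above the rim lie only the rim and the ground set: one spoke forces the next one all
  around.\<close>

lemma cyc_ups_Glue: "n > 0 \<Longrightarrow> cyc_ups (replicate n Glue) = {replicate n Glue, replicate n Spoke}"
  by (auto simp: cyc_ups_def ups_Glue open_after_def)

lemma no_spoke_no_new: "Spoke \<notin> set A \<Longrightarrow> num_new A = 0 \<Longrightarrow> A = replicate (length A) Glue"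
proof (induction A)
  case (Cons a A)
  then show ?case by (cases a) auto
qed simp

lemma scan_replicate_Spoke: "w 0 = 1 \<Longrightarrow> \<phi> 0 = 1 \<Longrightarrow> scan w \<phi> 0 (replicate n Spoke) = 1"
  by (induction n) auto

lemma cyc_scan_replicate_Spoke: "w 0 = 1 \<Longrightarrow> n > 0 \<Longrightarrow> cyc_scan w v 0 (replicate n Spoke) = 1"
  by (cases n) (auto simp: scan_replicate_Spoke)

text \<open>A flat with a spoke has \<open>num_new C\<close> as its corank. For sets without spokes that have \<open>k\<close>
  segments, \<open>ok k\<close> says whether they are flats and \<open>c k\<close> is their corank.\<close>
definition corank_word :: "(nat \<Rightarrow> nat) \<Rightarrow> token list \<Rightarrow> nat" where
  "corank_word c C = (if Spoke \<in> set C then num_new C else c (num_new C))"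

definition flat_word :: "(nat \<Rightarrow> bool) \<Rightarrow> token list \<Rightarrow> bool" where
  "flat_word ok C \<longleftrightarrow> Spoke \<in> set C \<or> ok (num_new C)"

text \<open>Three shapes of the bottom word. With a spoke, the sum is linear. Without spokes but
  with segments, it is contracted to a word of only \<open>New\<close>, where
  \<open>identity\<close> cancels the contribution of the words with spokes. The remaining case is
  the rim, with just two words above it.\<close>

lemma sum_cyc_scan_palindromic:
  fixes v :: "nat \<Rightarrow> int poly"
  assumes c: "\<And>k. ok k \<Longrightarrow> k > 0 \<Longrightarrow> c k = k"
    and zero: "ok 0 \<Longrightarrow> c 0 = 1 \<and> v 0 = 1"
    and identity: "\<And>n. ok (Suc n) \<Longrightarrow>
      (\<Sum>k\<le>Suc n. of_nat (Suc n choose k) * (if ok k then T ^ (Suc n - c k) * v k - reverse_poly (c k) (v k) else 0))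
      = (1 - T) * square_binomial_poly n"
    and A: "flat_word ok A" "A \<noteq> []"
  shows "(\<Sum>C\<in>{C \<in> cyc_ups A. flat_word ok C}. reverse_poly (corank_word c C) (cyc_scan fan_poly v 0 C))
    = (\<Sum>C\<in>{C \<in> cyc_ups A. flat_word ok C}. T ^ (corank_word c A - corank_word c C) * cyc_scan fan_poly v 0 C)"
proof -
  consider "Spoke \<in> set A" | n where "Spoke \<notin> set A" "num_new A = Suc n" | "Spoke \<notin> set A" "num_new A = 0"
    by (cases "num_new A") auto
  then show ?thesis
  proof cases
    case 1
    then have *: "{C \<in> cyc_ups A. flat_word ok C} = cyc_ups A" "\<And>C. C \<in> cyc_ups A \<Longrightarrow> Spoke \<in> set C"
      using Spoke_in_cyc_ups by (auto simp: flat_word_def)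
    obtain B D where BD: "A = B @ Spoke # D" using 1 by (meson split_list)
    have "(\<Sum>C\<in>cyc_ups A. reverse_poly (corank_word c C) (cyc_scan fan_poly v 0 C))
       = (\<Sum>C\<in>cyc_ups A. 1 ^ (num_new A - num_new C) * cyc_scan (rev_weight fan_poly) v 0 C)"
      using *(2) reverse_cyc_scan_fan[of _ v v] by (intro sum.cong) (auto simp: corank_word_def)
    also have "\<dots> = up_sum 1 (rev_weight fan_poly) (rev_weight fan_poly) 0 (D @ B)"
      unfolding BD by (rule sum_cyc_ups_Spoke)
    also have "\<dots> = up_sum T fan_poly fan_poly 0 (D @ B)" by (rule up_sum_fan_palindromic)
    also have "\<dots> = (\<Sum>C\<in>cyc_ups A. T ^ (num_new A - num_new C) * cyc_scan fan_poly v 0 C)"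
      unfolding BD by (rule sum_cyc_ups_Spoke[symmetric])
    also have "\<dots> = (\<Sum>C\<in>cyc_ups A. T ^ (corank_word c A - corank_word c C) * cyc_scan fan_poly v 0 C)"
      using *(2) 1 by (intro sum.cong) (auto simp: corank_word_def)
    finally show ?thesis unfolding *(1) .
  next
    case 2
    define m where "m = Suc n"
    have ok: "ok m" using A 2 by (simp add: flat_word_def m_def)
    then have cA: "corank_word c A = m" using 2 c by (simp add: corank_word_def m_def)
    define f where "f k = (if ok k then T ^ (m - c k) * v k - reverse_poly (c k) (v k) else 0)" for k
    let ?N = "replicate m New"
    define D where "D C = (if Spoke \<in> set C
      then T ^ (m - num_new C) * cyc_scan fan_poly v 0 C - cyc_scan (rev_weight fan_poly) v 0 C
      else f (num_new C))" for C
    have D: "T ^ (corank_word c A - corank_word c C) * cyc_scan fan_poly v 0 C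
        - reverse_poly (corank_word c C) (cyc_scan fan_poly v 0 C) = D C" if "flat_word ok C" for C
      unfolding cA using that reverse_cyc_scan_fan[of C v v]
      by (auto simp: D_def f_def corank_word_def flat_word_def cyc_scan_no_spoke)
    have "(\<Sum>C\<in>{C \<in> cyc_ups A. flat_word ok C}. T ^ (corank_word c A - corank_word c C) * cyc_scan fan_poly v 0 C)
        - (\<Sum>C\<in>{C \<in> cyc_ups A. flat_word ok C}. reverse_poly (corank_word c C) (cyc_scan fan_poly v 0 C))
        = (\<Sum>C\<in>{C \<in> cyc_ups A. flat_word ok C}. D C)"
      unfolding sum_subtractf[symmetric] using D by (intro sum.cong) auto
    \<comment> \<open>\<open>D\<close> vanishes on words that are not flats, so the sum may run over
      all cyclic words, on which the contraction is a bijection.\<close>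
    also have "\<dots> = (\<Sum>C\<in>cyc_ups A. D C)"
      by (rule sum.mono_neutral_left) (auto simp: finite_cyc_ups flat_word_def D_def f_def)
    also have "\<dots> = (\<Sum>C\<in>cyc_ups A. D (contract A C))"
    proof (rule sum.cong)
      fix C assume C: "C \<in> cyc_ups A"
      have pos: "num_new A > 0" using 2 by simp
      have "num_new (contract A C) = num_new C"
        using C by (auto simp: cyc_ups_def num_new_contract)
      then show "D C = D (contract A C)"
        unfolding D_def using Spoke_in_contract[OF 2(1) pos C]
          cyc_scan_contract[of fan_poly A C v, OF _ 2(1) pos C]
          cyc_scan_contract[of "rev_weight fan_poly" A C v, OF _ 2(1) pos C]
        by (simp only: rev_weight_0 fan_poly_0)
    qed simp
    also have "\<dots> = (\<Sum>C\<in>cyc_ups ?N. D C)"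
      using bij_betw_contract[OF 2(1)] 2(2) by (intro sum.reindex_bij_betw) (simp add: m_def)
    also have "\<dots> = (\<Sum>C\<in>{C \<in> cyc_ups ?N. Spoke \<in> set C}. D C) + (\<Sum>C\<in>{C \<in> cyc_ups ?N. Spoke \<notin> set C}. D C)"
      by (subst sum.union_disjoint[symmetric]) (auto simp: finite_cyc_ups intro!: sum.cong)
    also have "(\<Sum>C\<in>{C \<in> cyc_ups ?N. Spoke \<in> set C}. D C) = (T - 1) * square_binomial_poly n"
      using spoked_difference[of n v v] by (simp add: D_def m_def sum_subtractf)
    also have "(\<Sum>C\<in>{C \<in> cyc_ups ?N. Spoke \<notin> set C}. D C) = (\<Sum>k\<le>m. of_nat (m choose k) * f k)"
      using sum_cyc_ups_no_spoke[of m f] by (simp add: D_def m_def)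
    also have "\<dots> = (1 - T) * square_binomial_poly n"
      using identity[of n] ok by (simp only: f_def m_def)
    also have "(T - 1) * square_binomial_poly n + (1 - T) * square_binomial_poly n = 0"
      by (simp add: algebra_simps)
    finally show ?thesis by simp
  next
    case 3
    then have okc: "c 0 = 1" "v 0 = 1" "ok 0" using A zero by (auto simp: flat_word_def)
    define n where "n = length A"
    have n: "n > 0" using A by (simp add: n_def)
    have A': "A = replicate n Glue" unfolding n_def by (rule no_spoke_no_new) (use 3 in auto)
    have num: "num_new (replicate n Glue) = 0" "num_new (replicate n Spoke) = 0" by (induction n) auto
    have cs: "corank_word c (replicate n Glue) = 1" "corank_word c (replicate n Spoke) = 0"
      using n okc num by (auto simp: corank_word_def)
    have S: "{C \<in> cyc_ups A. flat_word ok C} = {replicate n Glue, replicate n Spoke}"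
      unfolding A' cyc_ups_Glue[OF n] using okc n num by (auto simp: flat_word_def)
    have ne: "replicate n Glue \<noteq> replicate n Spoke" using n by (cases n) auto
    have s: "cyc_scan fan_poly v 0 (replicate n Glue) = 1" "cyc_scan fan_poly v 0 (replicate n Spoke) = 1"
      using n okc num by (auto simp: cyc_scan_no_spoke cyc_scan_replicate_Spoke)
    show ?thesis unfolding S unfolding A' using ne by (simp add: cs s T_def)
  qed
qed

section \<open>Chains of triangles\<close>

definition succ_mod :: "nat \<Rightarrow> nat \<Rightarrow> nat" where
  "succ_mod n i = Suc i mod n"

definition pred_mod :: "nat \<Rightarrow> nat \<Rightarrow> nat" where
  "pred_mod n i = (if i = 0 then n - 1 else i - 1)"

lemma succ_mod_less: "i < n \<Longrightarrow> succ_mod n i < n"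
  by (simp add: succ_mod_def)

lemma pred_mod_less: "i < n \<Longrightarrow> pred_mod n i < n"
  by (auto simp: pred_mod_def)

lemma succ_pred_mod: "i < n \<Longrightarrow> succ_mod n (pred_mod n i) = i"
  by (auto simp: pred_mod_def succ_mod_def)

lemma pred_succ_mod: "i < n \<Longrightarrow> pred_mod n (succ_mod n i) = i"
  by (cases "Suc i = n") (auto simp: pred_mod_def succ_mod_def)

text \<open>Matroids glued from triangles \<open>{d i, e i, d (i + 1)}\<close> in a path or, if \<open>cyclic\<close>, in a cycle.
  For fans and wheels, \<open>d\<close> enumerates the spokes and \<open>e\<close> the rim.\<close>
locale triangle_chain = is_matroid M for M :: "'a matroid" +
  fixes n :: nat and d e :: "nat \<Rightarrow> 'a" and cyclic :: bool and rim :: "nat set"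
  assumes n_pos: "0 < n"
    and cyclic_n: "cyclic \<Longrightarrow> 3 \<le> n"
    and rim_def: "rim = {..<if cyclic then n else n - 1}"
    and loopless: "loopless_matroid M"
    and inj_d: "inj_on d {..<n}"
    and inj_e: "inj_on e rim"
    and d_neq_e: "\<And>i j. i < n \<Longrightarrow> j \<in> rim \<Longrightarrow> d i \<noteq> e j"
    and ground_eq: "ground M = d ` {..<n} \<union> e ` rim"
    and rank_ge: "n \<le> rk M"
    and triangle: "\<And>i. i \<in> rim \<Longrightarrow> {d i, e i, d (succ_mod n i)} \<notin> indeps M"
    and pair1: "\<And>i. i \<in> rim \<Longrightarrow> {d i, e i} \<in> indeps M"
    and pair2: "\<And>i. i \<in> rim \<Longrightarrow> {d i, d (succ_mod n i)} \<in> indeps M"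
    and pair3: "\<And>i. i \<in> rim \<Longrightarrow> {e i, d (succ_mod n i)} \<in> indeps M"
begin

abbreviation nx :: "nat \<Rightarrow> nat" where "nx \<equiv> succ_mod n"
abbreviation pv :: "nat \<Rightarrow> nat" where "pv \<equiv> pred_mod n"

lemma rim_less: "i \<in> rim \<Longrightarrow> i < n"
  using rim_def by (auto split: if_splits)

lemma d_ground: "i < n \<Longrightarrow> d i \<in> ground M" and e_ground: "i \<in> rim \<Longrightarrow> e i \<in> ground M"
  by (auto simp: ground_eq)

lemma ground_cases: "x \<in> ground M \<Longrightarrow> (\<exists>i<n. x = d i) \<or> (\<exists>j\<in>rim. x = e j)"
  by (auto simp: ground_eq)

lemma d_eq_iff: "i < n \<Longrightarrow> j < n \<Longrightarrow> d i = d j \<longleftrightarrow> i = j"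
  using inj_d by (auto simp: inj_on_def)

lemma e_eq_iff: "i \<in> rim \<Longrightarrow> j \<in> rim \<Longrightarrow> e i = e j \<longleftrightarrow> i = j"
  using inj_e by (auto simp: inj_on_def)

lemma in_cl_of_circuit:
  assumes "insert c I \<notin> indeps M" "I \<in> indeps M" "c \<in> ground M"
  shows "c \<in> cl I"
proof -
  have fin: "finite I" using assms(2) finite_indep by blast
  have "c \<notin> I" using assms by (auto simp: insert_absorb)
  moreover have "rank_of M (insert c I) \<noteq> card (insert c I)"
    using assms(1) indep_iff_rank fin by auto
  moreover have "rank_of M (insert c I) \<le> card (insert c I)" using fin by (intro rank_le_card) auto
  ultimately have "rank_of M (insert c I) \<le> card I" using fin by auto
  then have "rank_of M (insert c I) = rank_of M I"
    using rank_indep[OF assms(2)] rank_mono[OF subset_insertI, of I c] by simp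
  then show ?thesis using assms by (simp add: cl_def)
qed

lemma triangle_cl:
  assumes "i \<in> rim"
  shows "d (nx i) \<in> cl {d i, e i}" "e i \<in> cl {d i, d (nx i)}" "d i \<in> cl {e i, d (nx i)}"
proof -
  have i: "i < n" "nx i < n" using assms rim_less succ_mod_less by auto
  have "insert (d (nx i)) {d i, e i} \<notin> indeps M" "insert (e i) {d i, d (nx i)} \<notin> indeps M"
    "insert (d i) {e i, d (nx i)} \<notin> indeps M"
    using triangle[OF assms] by (simp_all only: insert_commute not_False_eq_True)
  then show "d (nx i) \<in> cl {d i, e i}" "e i \<in> cl {d i, d (nx i)}" "d i \<in> cl {e i, d (nx i)}"
    using in_cl_of_circuit pair1[OF assms] pair2[OF assms] pair3[OF assms] d_ground i e_ground[OF assms]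
    by blast+
qed

lemma triangle_mem_cl:
  assumes "i \<in> rim"
  shows "d i \<in> cl X \<Longrightarrow> e i \<in> cl X \<Longrightarrow> d (nx i) \<in> cl X"
    and "d i \<in> cl X \<Longrightarrow> d (nx i) \<in> cl X \<Longrightarrow> e i \<in> cl X"
    and "e i \<in> cl X \<Longrightarrow> d (nx i) \<in> cl X \<Longrightarrow> d i \<in> cl X"
  using triangle_cl[OF assms] cl_least[of "{_, _}" X] by blast+

definition closed :: "'a set \<Rightarrow> bool" where
  "closed F \<longleftrightarrow> F \<subseteq> ground M \<and> (\<forall>i\<in>rim.
    (d i \<in> F \<longrightarrow> e i \<in> F \<longrightarrow> d (nx i) \<in> F) \<and> (d i \<in> F \<longrightarrow> d (nx i) \<in> F \<longrightarrow> e i \<in> F) \<and>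
    (e i \<in> F \<longrightarrow> d (nx i) \<in> F \<longrightarrow> d i \<in> F))"

lemma closedD:
  assumes "closed F" "i \<in> rim"
  shows "d i \<in> F \<Longrightarrow> e i \<in> F \<Longrightarrow> d (nx i) \<in> F" "d i \<in> F \<Longrightarrow> d (nx i) \<in> F \<Longrightarrow> e i \<in> F"
    "e i \<in> F \<Longrightarrow> d (nx i) \<in> F \<Longrightarrow> d i \<in> F"
  using assms by (auto simp: closed_def)

lemma closed_subset: "closed F \<Longrightarrow> F \<subseteq> ground M"
  by (simp add: closed_def)

lemma flat_closed: "F \<in> flats M \<Longrightarrow> closed F"
  unfolding closed_def using triangle_mem_cl[of _ F] by (auto simp: flats_iff_cl)

text \<open>For a vertex index \<open>i\<close>, the test \<open>pv i \<in> rim\<close> fails only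
  at the first vertex of a path, which no rim edge precedes.\<close>

definition tok :: "'a set \<Rightarrow> nat \<Rightarrow> token" where
  "tok F i = (if d i \<in> F then Spoke else if pv i \<in> rim \<and> e (pv i) \<in> F then Glue else New)"

lemma tok_Spoke_iff: "tok F i = Spoke \<longleftrightarrow> d i \<in> F"
  and tok_Glue_iff: "tok F i = Glue \<longleftrightarrow> d i \<notin> F \<and> pv i \<in> rim \<and> e (pv i) \<in> F"
  by (auto simp: tok_def)

definition word :: "'a set \<Rightarrow> token list" where
  "word F = map (tok F) [0..<n]"

lemma length_word [simp]: "length (word F) = n" and nth_word: "i < n \<Longrightarrow> word F ! i = tok F i"
  by (simp_all add: word_def)

lemma num_new_eq_card: "length C = n \<Longrightarrow> num_new C = card {i. i < n \<and> C ! i = New}"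
  by (simp add: count_list_eq_length_filter length_filter_conv_card eq_commute[of New])

lemma num_new_word: "num_new (word F) = card {i. i < n \<and> tok F i = New}"
  by (simp add: num_new_eq_card nth_word cong: conj_cong)

lemma Spoke_in_word: "Spoke \<in> set (word F) \<longleftrightarrow> (\<exists>i<n. d i \<in> F)"
  by (auto simp: word_def tok_def image_iff split: if_splits)

text \<open>From a spoke in the closure one walks around the chain: each glued vertex gets its spoke
  from the triangle shared with its predecessor.\<close>

lemma spanning:
  assumes i0: "i0 < n" "d i0 \<in> cl X"
    and step: "\<And>i. i < n \<Longrightarrow> d i \<in> cl X \<or> (pv i \<in> rim \<and> e (pv i) \<in> cl X)"
  shows "ground M \<subseteq> cl X"
proof -
  have "d ((i0 + k) mod n) \<in> cl X" for k
  proof (induction k)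
    case (Suc k)
    let ?i = "(i0 + k) mod n"
    have i: "?i < n" "nx ?i < n" using n_pos succ_mod_less by auto
    have eq: "(i0 + Suc k) mod n = nx ?i" by (simp add: succ_mod_def mod_Suc_eq)
    show ?case
      using step[OF i(2)] Suc triangle_mem_cl(1)[of ?i X] unfolding pred_succ_mod[OF i(1)] eq by auto
  qed (use i0 in simp)
  note walk = this
  have d: "d i \<in> cl X" if "i < n" for i
  proof -
    have "(i0 + (i + n - i0)) mod n = i" using i0(1) that by simp
    then show ?thesis using walk[of "i + n - i0"] by simp
  qed
  then show ?thesis
    using triangle_mem_cl(2)[of _ X] rim_less succ_mod_less by (auto simp: ground_eq)
qed

text \<open>Adding the spokes at the \<open>New\<close> vertices makes the set spanning. The walk
  needs an unglued vertex to start from; among closed sets, only the rim of a cyclic chain has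
  none.\<close>

lemma rank_lower:
  assumes F: "F \<subseteq> ground M" and i0: "i0 < n" "tok F i0 \<noteq> Glue"
  shows "n \<le> rank_of M F + num_new (word F)"
proof -
  let ?D = "d ` {i. i < n \<and> tok F i = New}"
  have X: "F \<union> ?D \<subseteq> ground M" using F d_ground by auto
  have "ground M \<subseteq> cl (F \<union> ?D)"
  proof (rule spanning[OF i0(1)])
    have mem: "d i \<in> F \<union> ?D" if "i < n" "tok F i \<noteq> Glue" for i
      using that by (cases "tok F i") (auto simp: tok_Spoke_iff)
    show "d i0 \<in> cl (F \<union> ?D)" using subset_cl[OF X] mem[OF i0] by blast
    show "d i \<in> cl (F \<union> ?D) \<or> (pv i \<in> rim \<and> e (pv i) \<in> cl (F \<union> ?D))" if "i < n" for i
      using subset_cl[OF X] mem[OF that] tok_Glue_iff[of F i] by blast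
  qed
  then have "rk M \<le> rank_of M (F \<union> ?D)" unfolding rk_def by (rule rank_le_of_subset_cl)
  also have "\<dots> \<le> rank_of M F + card ?D"
    using rank_Un_le[of F ?D] rank_le_card[of ?D] by auto
  also have "card ?D = num_new (word F)"
    unfolding num_new_word using inj_d by (intro card_image) (auto simp: inj_on_def)
  finally show ?thesis using rank_ge by linarith
qed

text \<open>One representative for each vertex that is not \<open>New\<close>, its spoke or the rim
  edge before it, spans the closed set: rim edges between two spokes come from their
  triangle.\<close>

lemma rank_upper:
  assumes F: "closed F"
  shows "rank_of M F + num_new (word F) \<le> n"
proof -
  let ?I = "{i. i < n \<and> tok F i \<noteq> New}" and ?N = "{i. i < n \<and> tok F i = New}"
  let ?y = "\<lambda>i. if tok F i = Spoke then d i else e (pv i)"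
  let ?Y = "?y ` ?I"
  have FE: "F \<subseteq> ground M" using F by (simp add: closed_def)
  have Y: "?Y \<subseteq> ground M" using FE by (auto simp: tok_def split: if_splits)
  have dY: "d i \<in> cl ?Y" if "i < n" "d i \<in> F" for i
  proof -
    have "d i \<in> ?Y" using that by (intro image_eqI[of _ _ i]) (auto simp: tok_def)
    then show ?thesis using subset_cl[OF Y] by blast
  qed
  have "F \<subseteq> cl ?Y"
  proof
    fix x assume x: "x \<in> F"
    then consider i where "i < n" "x = d i" | j where "j \<in> rim" "x = e j"
      using FE ground_cases by blast
    then show "x \<in> cl ?Y"
    proof cases
      case 2
      then have j: "j < n" "nx j < n" using rim_less succ_mod_less by auto
      show ?thesis
      proof (cases "d (nx j) \<in> F")
        case True
        then have "d j \<in> F" using closedD(3)[OF F 2(1)] x 2 by simp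
        then show ?thesis using triangle_mem_cl(2)[OF 2(1)] dY j True 2 by simp
      next
        case False
        then have "tok F (nx j) = Glue" using x 2 j by (simp add: tok_def pred_succ_mod)
        then have "x \<in> ?Y" using j 2 by (intro image_eqI[of _ _ "nx j"]) (auto simp: pred_succ_mod)
        then show ?thesis using subset_cl[OF Y] by blast
      qed
    qed (use dY x in auto)
  qed
  then have "rank_of M F \<le> rank_of M ?Y" by (rule rank_le_of_subset_cl)
  also have "\<dots> \<le> card ?Y" by (rule rank_le_card) simp
  also have "\<dots> \<le> card ?I" by (rule card_image_le) simp
  finally have "rank_of M F \<le> card ?I" .
  moreover have "card ?I + card ?N = card (?I \<union> ?N)"
    by (subst card_Un_disjoint) auto
  moreover have "?I \<union> ?N = {..<n}" by auto
  ultimately show ?thesis by (simp add: num_new_word)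
qed

lemma rank_closed:
  assumes "closed F" "i0 < n" "tok F i0 \<noteq> Glue"
  shows "rank_of M F + num_new (word F) = n"
  using rank_lower[of F i0] rank_upper[of F] assms by (auto simp: closed_def)

lemma closed_ground: "closed (ground M)"
  using d_ground e_ground rim_less succ_mod_less by (auto simp: closed_def)

lemma tok_ground: "i < n \<Longrightarrow> tok (ground M) i = Spoke"
  by (simp add: tok_def d_ground)

lemma rk_eq: "rk M = n"
  using rank_upper[OF closed_ground] rank_ge unfolding rk_def by linarith

lemma word_ground: "word (ground M) = replicate n Spoke"
  by (rule nth_equalityI) (auto simp: nth_word tok_ground)

lemma word_empty: "word {} = replicate n New"
  by (rule nth_equalityI) (auto simp: nth_word tok_def)

section \<open>The order on closed sets in terms of words\<close>

definition up :: "token list \<Rightarrow> token list set" where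
  "up A = (if cyclic then cyc_ups A else ups False A)"

lemma pred_mod_in_rim: "i < n \<Longrightarrow> pv i \<in> rim \<longleftrightarrow> cyclic \<or> i > 0"
  using n_pos by (auto simp: rim_def pred_mod_def)

lemma in_up_iff:
  assumes "length A = n"
  shows "C \<in> up A \<longleftrightarrow> length C = n \<and> (\<forall>i<n. compat (pv i \<in> rim \<and> C ! (pv i) \<noteq> Spoke) (A ! i) (C ! i))"
proof (cases "length C = n")
  case True
  then have op: "open_after False C \<longleftrightarrow> C ! (n - 1) \<noteq> Spoke"
    using n_pos by (auto simp: open_after_def last_conv_nth)
  have "(if i = 0 then cyclic \<and> open_after False C else C ! (i - 1) \<noteq> Spoke) = (pv i \<in> rim \<and> C ! (pv i) \<noteq> Spoke)"
    if "i < n" for i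
    using that op pred_mod_in_rim[OF that] by (auto simp: pred_mod_def)
  moreover have "C \<in> up A \<longleftrightarrow> C \<in> ups (cyclic \<and> open_after False C) A"
    by (simp add: up_def cyc_ups_def)
  ultimately show ?thesis using True assms by (simp add: in_ups_iff_nth)
next
  case False
  then show ?thesis using assms by (auto simp: up_def cyc_ups_def in_ups_iff_nth)
qed

text \<open>Tokens do not record rim edges that lead to a vertex with a spoke; closedness supplies
  these when tokens are compared vertex by vertex.\<close>

lemma word_in_up_iff:
  assumes F: "closed F" and G: "closed G"
  shows "word G \<in> up (word F) \<longleftrightarrow> F \<subseteq> G"
proof -
  have "word G \<in> up (word F) \<longleftrightarrow> (\<forall>i<n. compat (pv i \<in> rim \<and> tok G (pv i) \<noteq> Spoke) (tok F i) (tok G i))"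
    using pred_mod_less by (simp add: in_up_iff nth_word)
  also have "\<dots> \<longleftrightarrow> F \<subseteq> G"
  proof
    assume *: "\<forall>i<n. compat (pv i \<in> rim \<and> tok G (pv i) \<noteq> Spoke) (tok F i) (tok G i)"
    have d: "d i \<in> G" if "i < n" "d i \<in> F" for i
      using *[rule_format, OF that(1)] that by (auto simp: tok_def split: if_splits)
    show "F \<subseteq> G"
    proof
      fix x assume x: "x \<in> F"
      then consider i where "i < n" "x = d i" | j where "j \<in> rim" "x = e j"
        using closed_subset[OF F] ground_cases by blast
      then show "x \<in> G"
      proof cases
        case 2
        then have j: "j < n" "nx j < n" "pv (nx j) = j" using rim_less succ_mod_less pred_succ_mod by auto
        show ?thesis
        proof (cases "d (nx j) \<in> F")
          case True
          then have "d j \<in> F" using closedD(3)[OF F 2(1)] x 2 by simp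
          then show ?thesis using closedD(2)[OF G 2(1)] d j True 2 by simp
        next
          case False
          then have "tok F (nx j) = Glue" using x 2 j by (simp add: tok_def)
          then have c: "compat (j \<in> rim \<and> tok G j \<noteq> Spoke) Glue (tok G (nx j))"
            using *[rule_format, OF j(2)] j(3) by simp
          show ?thesis
          proof (cases "d j \<in> G")
            case True
            then have "d (nx j) \<in> G" using c by (auto simp: tok_def split: if_splits)
            then show ?thesis using closedD(2)[OF G 2(1) True] 2 by simp
          next
            case False
            then have "tok G (nx j) = Glue" using c 2 by (auto simp: tok_def split: if_splits)
            then show ?thesis using 2 j by (auto simp: tok_def split: if_splits)
          qed
        qed
      qed (use d x in auto)
    qed
  next
    assume FG: "F \<subseteq> G"
    show "\<forall>i<n. compat (pv i \<in> rim \<and> tok G (pv i) \<noteq> Spoke) (tok F i) (tok G i)"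
    proof (intro allI impI)
      fix i assume i: "i < n"
      have nxpv: "nx (pv i) = i" by (rule succ_pred_mod[OF i])
      show "compat (pv i \<in> rim \<and> tok G (pv i) \<noteq> Spoke) (tok F i) (tok G i)"
      proof (cases "tok F i")
        case Spoke
        then show ?thesis using FG by (auto simp: tok_def split: if_splits)
      next
        case New
        have "d (pv i) \<notin> G" if "pv i \<in> rim" "e (pv i) \<in> G" "d i \<notin> G"
          using closedD(1)[OF G that(1), unfolded nxpv] that by blast
        then show ?thesis using New by (auto simp: tok_def[of G] split: if_splits)
      next
        case Glue
        then have r: "pv i \<in> rim" and eG: "e (pv i) \<in> G" using FG by (auto simp: tok_def split: if_splits)
        have "d i \<in> G \<longleftrightarrow> d (pv i) \<in> G"
          using closedD[OF G r, unfolded nxpv] eG by blast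
        then show ?thesis using Glue r eG by (auto simp: tok_def[of G])
      qed
    qed
  qed
  finally show ?thesis .
qed

text \<open>Words express inclusion, so equal words mean inclusion both ways.\<close>

lemma word_inj: "closed F \<Longrightarrow> closed G \<Longrightarrow> word F = word G \<Longrightarrow> F = G"
  using word_in_up_iff[of F F] word_in_up_iff[of G G] word_in_up_iff[of F G] word_in_up_iff[of G F] by auto

lemma compat_imp_New: "compat b a c \<Longrightarrow> compat b New c"
  by (cases a) (auto split: if_splits)

lemma word_surj:
  assumes C: "C \<in> up A" "length A = n"
  shows "\<exists>F. closed F \<and> word F = C"
proof -
  \<comment> \<open>A rim edge belongs to the set when \<open>Glue\<close> records it, or when the
    spokes at both its ends force it.\<close>
  define F where "F = d ` {i. i < n \<and> C ! i = Spoke} \<union>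
    e ` {j \<in> rim. C ! nx j = Glue \<or> C ! j = Spoke \<and> C ! nx j = Spoke}"
  have l: "length C = n" using C in_up_iff by auto
  have c: "C ! i = Glue \<Longrightarrow> pv i \<in> rim \<and> C ! (pv i) \<noteq> Spoke" if "i < n" for i
    using C(1) that compat_imp_New unfolding in_up_iff[OF C(2)] by fastforce
  have dF: "d i \<in> F \<longleftrightarrow> C ! i = Spoke" if "i < n" for i
  proof
    assume "d i \<in> F"
    then consider k where "k < n" "C ! k = Spoke" "d i = d k" | j where "j \<in> rim" "d i = e j"
      unfolding F_def by blast
    then show "C ! i = Spoke"
    proof cases
      case 1
      then show ?thesis using d_eq_iff[OF that 1(1)] by simp
    next
      case 2
      then show ?thesis using d_neq_e[OF that 2(1)] by simp
    qed
  qed (use that in \<open>auto simp: F_def\<close>)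
  have eF: "e j \<in> F \<longleftrightarrow> C ! nx j = Glue \<or> C ! j = Spoke \<and> C ! nx j = Spoke" if "j \<in> rim" for j
  proof
    assume "e j \<in> F"
    then consider i where "i < n" "e j = d i"
      | k where "k \<in> rim" "C ! nx k = Glue \<or> C ! k = Spoke \<and> C ! nx k = Spoke" "e j = e k"
      unfolding F_def by blast
    then show "C ! nx j = Glue \<or> C ! j = Spoke \<and> C ! nx j = Spoke"
    proof cases
      case 1
      then show ?thesis using d_neq_e[OF 1(1) that] by simp
    next
      case 2
      then show ?thesis using e_eq_iff[OF that 2(1)] by simp
    qed
  qed (use that in \<open>auto simp: F_def\<close>)
  have "closed F"
    unfolding closed_def
  proof (intro conjI ballI)
    show "F \<subseteq> ground M" by (auto simp: F_def ground_eq)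
    fix j assume j: "j \<in> rim"
    then have jn: "j < n" "nx j < n" "pv (nx j) = j" using rim_less succ_mod_less pred_succ_mod by auto
    show "d j \<in> F \<longrightarrow> e j \<in> F \<longrightarrow> d (nx j) \<in> F" "d j \<in> F \<longrightarrow> d (nx j) \<in> F \<longrightarrow> e j \<in> F"
      "e j \<in> F \<longrightarrow> d (nx j) \<in> F \<longrightarrow> d j \<in> F"
      using dF jn eF[OF j] c[of "nx j"] by auto
  qed
  moreover have "word F = C"
  proof (rule nth_equalityI)
    fix i assume "i < length (word F)"
    then have i: "i < n" by simp
    have "pv i \<in> rim \<Longrightarrow> e (pv i) \<in> F \<longleftrightarrow> C ! i = Glue \<or> C ! (pv i) = Spoke \<and> C ! i = Spoke"
      using eF[of "pv i"] succ_pred_mod[OF i] by simp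
    then show "word F ! i = C ! i"
      using i c[OF i] dF[OF i] by (cases "C ! i") (auto simp: nth_word tok_def)
  qed (use l in simp)
  ultimately show ?thesis by blast
qed

text \<open>Equal counts fix the \<open>New\<close> vertices, and walking on from an unglued vertex
  the tokens of \<open>G\<close> follow those of \<open>F\<close>. Applied to a closed set and its
  closure, this shows that closed sets are flats.\<close>

lemma closed_eqI:
  assumes F: "closed F" and G: "closed G" and "F \<subseteq> G"
    and num: "num_new (word F) = num_new (word G)" and i0: "i0 < n" "tok F i0 \<noteq> Glue"
  shows "F = G"
proof -
  have c: "compat (pv i \<in> rim \<and> tok G (pv i) \<noteq> Spoke) (tok F i) (tok G i)" if "i < n" for i
    using word_in_up_iff[OF F G] \<open>F \<subseteq> G\<close> that by (simp add: in_up_iff nth_word pred_mod_less)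
  have "tok F i = New" if "i < n" "tok G i = New" for i
    using c[OF that(1)] that by (cases "tok F i") (auto split: if_splits)
  then have "{i. i < n \<and> tok G i = New} \<subseteq> {i. i < n \<and> tok F i = New}" by auto
  then have "{i. i < n \<and> tok G i = New} = {i. i < n \<and> tok F i = New}"
    using num unfolding num_new_word by (intro card_subset_eq) auto
  then have new: "tok G i = New \<longleftrightarrow> tok F i = New" if "i < n" for i using that by blast
  have "tok G ((i0 + k) mod n) = tok F ((i0 + k) mod n)" for k
  proof (induction k)
    case 0
    then show ?case using c[OF i0(1)] new[OF i0(1)] i0 by (cases "tok F i0") auto
  next
    case (Suc k)
    let ?j = "(i0 + k) mod n"
    have j: "?j < n" "nx ?j < n" "pv (nx ?j) = ?j" using n_pos succ_mod_less pred_succ_mod by auto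
    have eq: "(i0 + Suc k) mod n = nx ?j" by (simp add: succ_mod_def mod_Suc_eq)
    show ?case unfolding eq
    proof (cases "tok F (nx ?j)")
      case Spoke
      then show "tok G (nx ?j) = tok F (nx ?j)" using c[OF j(2)] by simp
    next
      case New
      then show "tok G (nx ?j) = tok F (nx ?j)" using new[OF j(2)] by simp
    next
      case Glue
      then have "?j \<in> rim" "e ?j \<in> F" "d (nx ?j) \<notin> F" using j by (auto simp: tok_def split: if_splits)
      then have "d ?j \<notin> F" using closedD(1)[OF F] by blast
      then have "tok G ?j \<noteq> Spoke" using Suc by (auto simp: tok_def split: if_splits)
      then show "tok G (nx ?j) = tok F (nx ?j)" using c[OF j(2)] Glue \<open>?j \<in> rim\<close> j(3) by simp
    qed
  qed
  note walk = this
  have "tok G i = tok F i" if "i < n" for i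
  proof -
    have "(i0 + (i + n - i0)) mod n = i" using i0(1) that by simp
    then show ?thesis using walk[of "i + n - i0"] by simp
  qed
  then have "word F = word G" by (auto intro: nth_equalityI simp: nth_word)
  then show ?thesis using word_inj F G by blast
qed

lemma bij_betw_word:
  assumes A: "closed A"
  shows "bij_betw word {F. closed F \<and> A \<subseteq> F} (up (word A))"
  unfolding bij_betw_def
proof
  show "inj_on word {F. closed F \<and> A \<subseteq> F}" using word_inj by (auto simp: inj_on_def)
  show "word ` {F. closed F \<and> A \<subseteq> F} = up (word A)"
  proof (intro equalityI subsetI)
    fix C assume "C \<in> up (word A)"
    moreover then obtain F where "closed F" "word F = C" using word_surj[of C "word A"] by auto
    ultimately show "C \<in> word ` {F. closed F \<and> A \<subseteq> F}" using word_in_up_iff[OF A] by auto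
  qed (use word_in_up_iff[OF A] in auto)
qed

text \<open>Transports the verification principle from flats to words; \<open>ok\<close> singles out
  the words of flats among those of closed sets.\<close>

lemma KL_poly_of_words:
  assumes flats: "\<And>F. F \<in> flats M \<longleftrightarrow> closed F \<and> ok (word F)"
    and corank: "\<And>F. F \<in> flats M \<Longrightarrow> rank_of M F + corank (word F) = n"
    and top: "g (replicate n Spoke) = 1"
    and deg: "\<And>C. length C = n \<Longrightarrow> ok C \<Longrightarrow> corank C > 0 \<Longrightarrow> 2 * degree (g C) < corank C"
    and pal: "\<And>A. length A = n \<Longrightarrow> ok A \<Longrightarrow>
      (\<Sum>C\<in>{C \<in> up A. ok C}. reverse_poly (corank C) (g C))
      = (\<Sum>C\<in>{C \<in> up A. ok C}. T ^ (corank A - corank C) * g C)"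
  shows "KL_poly M = g (replicate n New)"
proof -
  have "KL_poly M = g (word {})"
  proof (rule KL_poly_eqI[OF loopless, where g = "\<lambda>F. g (word F)"])
    show "g (word (ground M)) = 1" using top word_ground by simp
    show "2 * degree (g (word F)) < rk M - rank_of M F" if F: "F \<in> flats M" "F \<noteq> ground M" for F
    proof -
      have "rank_of M F < rk M"
        using flat_rank_less[OF F(1), of "ground M"] F flat_subset by (auto simp: rk_def)
      then show ?thesis using corank[OF F(1)] deg[of "word F"] flats[of F] F by (simp add: rk_eq)
    qed
    show "(\<Sum>F\<in>{F \<in> flats M. A \<subseteq> F}. reverse_poly (rk M - rank_of M F) (g (word F))) =
        (\<Sum>F\<in>{F \<in> flats M. A \<subseteq> F}. monom 1 (rank_of M F - rank_of M A) * g (word F))"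
      if A: "A \<in> flats M" for A
    proof -
      have cA: "closed A" and okA: "ok (word A)" using A flats by auto
      have bij: "bij_betw word {F \<in> flats M. A \<subseteq> F} {C \<in> up (word A). ok C}"
      proof -
        have "bij_betw word {F \<in> {F. closed F \<and> A \<subseteq> F}. ok (word F)} {C \<in> up (word A). ok C}"
          using bij_betw_word[OF cA] unfolding bij_betw_def
          by (auto intro: inj_on_subset)
        moreover have "{F \<in> {F. closed F \<and> A \<subseteq> F}. ok (word F)} = {F \<in> flats M. A \<subseteq> F}"
          using flats by auto
        ultimately show ?thesis by simp
      qed
      have r: "rk M - rank_of M F = corank (word F)"
        "rank_of M F - rank_of M A = corank (word A) - corank (word F)" if "F \<in> flats M" for F
        using corank[OF that] corank[OF A] by (auto simp: rk_eq)
      have "(\<Sum>F\<in>{F \<in> flats M. A \<subseteq> F}. reverse_poly (rk M - rank_of M F) (g (word F)))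
         = (\<Sum>F\<in>{F \<in> flats M. A \<subseteq> F}. reverse_poly (corank (word F)) (g (word F)))"
        using r by (intro sum.cong) auto
      also have "\<dots> = (\<Sum>C\<in>{C \<in> up (word A). ok C}. reverse_poly (corank C) (g C))"
        by (rule sum.reindex_bij_betw[OF bij])
      also have "\<dots> = (\<Sum>C\<in>{C \<in> up (word A). ok C}. T ^ (corank (word A) - corank C) * g C)"
        by (rule pal) (use okA in auto)
      also have "\<dots> = (\<Sum>F\<in>{F \<in> flats M. A \<subseteq> F}. T ^ (corank (word A) - corank (word F)) * g (word F))"
        by (rule sum.reindex_bij_betw[OF bij, symmetric])
      also have "\<dots> = (\<Sum>F\<in>{F \<in> flats M. A \<subseteq> F}. monom 1 (rank_of M F - rank_of M A) * g (word F))"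
        using r by (intro sum.cong) (auto simp: T_power)
      finally show ?thesis .
    qed
  qed
  then show ?thesis by (simp add: word_empty)
qed

lemma KL_poly_linear:
  assumes "\<not> cyclic"
  shows "KL_poly M = fan_poly n"
proof -
  \<comment> \<open>In a path no rim edge precedes the first vertex, so there is no exceptional
    closed set and every closed set is a flat.\<close>
  have t0: "tok F 0 \<noteq> Glue" for F
    using assms n_pos pred_mod_in_rim[of 0] by (auto simp: tok_def)
  have r: "rank_of M F + num_new (word F) = n" if "closed F" for F
    using rank_closed[OF that n_pos t0] .
  have "KL_poly M = scan fan_poly fan_poly 0 (replicate n New)"
  proof (rule KL_poly_of_words[where ok = "\<lambda>_. True" and corank = num_new])
    show "F \<in> flats M \<longleftrightarrow> closed F \<and> True" for F
    proof
      assume "closed F \<and> True"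
      then have F: "closed F" "F \<subseteq> ground M" by (auto simp: closed_def)
      have cl: "closed (cl F)" by (rule flat_closed[OF cl_flat[OF F(2)]])
      have "F = cl F"
        using r[OF F(1)] r[OF cl] rank_cl[OF F(2)] subset_cl[OF F(2)]
        by (intro closed_eqI[OF F(1) cl _ _ n_pos t0]) auto
      then show "F \<in> flats M" using cl_flat[OF F(2)] by simp
    qed (use flat_closed in auto)
    show "rank_of M F + num_new (word F) = n" if "F \<in> flats M" for F
      using r[OF flat_closed[OF that]] .
    show "2 * degree (scan fan_poly fan_poly 0 C) < num_new C" if "num_new C > 0" for C
      using degree_scan[of fan_poly 0 C, OF double_degree_fan_poly] that by linarith
    show "(\<Sum>C\<in>{C \<in> up A. True}. reverse_poly (num_new C) (scan fan_poly fan_poly 0 C))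
      = (\<Sum>C\<in>{C \<in> up A. True}. T ^ (num_new A - num_new C) * scan fan_poly fan_poly 0 C)" for A
      unfolding up_def using assms sum_scan_palindromic[of A] by simp
  qed (simp add: scan_replicate_Spoke)
  also have "\<dots> = fan_poly n" by (subst scan_no_spoke) auto
  finally show ?thesis .
qed

end

context triangle_chain
begin

section \<open>The rim of a cyclic chain\<close>

lemma closed_rim: "closed (e ` rim)"
  using d_neq_e rim_less succ_mod_less e_ground by (auto simp: closed_def)

lemma rim_eqI:
  assumes cyclic and F: "closed F" and glue: "\<And>i. i < n \<Longrightarrow> tok F i = Glue"
  shows "F = e ` rim"
proof (intro equalityI subsetI)
  fix x assume x: "x \<in> F"
  then have "(\<exists>i<n. x = d i) \<or> (\<exists>j\<in>rim. x = e j)"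
    using ground_cases closed_subset[OF F] by blast
  moreover have "x \<noteq> d i" if "i < n" for i
    using x glue[OF that] tok_Spoke_iff[of F i] by auto
  ultimately show "x \<in> e ` rim" by blast
next
  fix x assume "x \<in> e ` rim"
  then obtain j where j: "j \<in> rim" "x = e j" by auto
  then have "tok F (nx j) = Glue" "pv (nx j) = j"
    using glue rim_less succ_mod_less pred_succ_mod by auto
  then show "x \<in> F" using j tok_Glue_iff by metis
qed

lemma tok_rim: "cyclic \<Longrightarrow> i < n \<Longrightarrow> tok (e ` rim) i = Glue"
  using d_neq_e[of i] pred_mod_in_rim[of i] by (auto simp: tok_Glue_iff)

lemma word_rim: "cyclic \<Longrightarrow> word (e ` rim) = replicate n Glue"
  by (rule nth_equalityI) (auto simp: nth_word tok_rim)

lemma num_new_replicate_Glue: "num_new (replicate k Glue) = 0"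
  by (induction k) auto

lemma closed_cases:
  assumes cyclic "closed F"
  obtains "F = e ` rim" | i where "F \<noteq> e ` rim" "i < n" "tok F i \<noteq> Glue"
  using rim_eqI[OF assms] by metis

lemma rank_not_rim:
  assumes cyclic "closed F" "F \<noteq> e ` rim"
  shows "rank_of M F + num_new (word F) = n"
  using assms closed_cases[OF assms(1,2)] rank_closed[OF assms(2)] by metis

lemma not_rim_iff:
  assumes cyclic "closed F"
  shows "F \<noteq> e ` rim \<longleftrightarrow> flat_word (\<lambda>k. k \<noteq> 0) (word F)"
proof
  assume "F \<noteq> e ` rim"
  then obtain i where i: "i < n" "tok F i \<noteq> Glue" using closed_cases[OF assms] by metis
  show "flat_word (\<lambda>k. k \<noteq> 0) (word F)"
  proof (cases "tok F i")
    case Spoke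
    then show ?thesis using i by (auto simp: flat_word_def Spoke_in_word tok_Spoke_iff)
  next
    case New
    then have "{i. i < n \<and> tok F i = New} \<noteq> {}" using i by auto
    then have "card {i. i < n \<and> tok F i = New} \<noteq> 0" by (simp only: card_eq_0_iff) simp
    then show ?thesis unfolding flat_word_def num_new_word by blast
  qed (use i in simp)
next
  assume "flat_word (\<lambda>k. k \<noteq> 0) (word F)"
  then show "F \<noteq> e ` rim"
    using word_rim[OF assms(1)] num_new_replicate_Glue by (auto simp: flat_word_def)
qed

lemma cl_closed: "F \<subseteq> ground M \<Longrightarrow> closed (cl F)"
  using flat_closed[OF cl_flat] .

text \<open>The closure has the same rank, hence the same number of \<open>New\<close>. The rim is
  excluded on both sides because its rank is not given by its word.\<close>

lemma cl_eq_of_not_rim: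
  assumes cyclic and F: "closed F" "F \<noteq> e ` rim" and cl: "cl F \<noteq> e ` rim"
  shows "cl F = F"
proof -
  have FE: "F \<subseteq> ground M" by (rule closed_subset[OF F(1)])
  obtain i where i: "i < n" "tok F i \<noteq> Glue" using closed_cases[OF assms(1) F(1)] F(2) by metis
  have "num_new (word F) = num_new (word (cl F))"
    using rank_not_rim[OF assms(1) F] rank_not_rim[OF assms(1) cl_closed[OF FE] cl] rank_cl[OF FE] by simp
  then show ?thesis using closed_eqI[OF F(1) cl_closed[OF FE] subset_cl[OF FE] _ i] by simp
qed

lemma KL_poly_whirl:
  assumes cyclic and indep: "e ` rim \<in> indeps M"
  shows "KL_poly M = whirl_poly n"
proof -
  have card_rim: "card (e ` rim) = n" using inj_e assms(1) by (simp add: card_image rim_def)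
  have rank_rim: "rank_of M (e ` rim) = n" using rank_indep[OF indep] card_rim by simp
  \<comment> \<open>An independent rim has full rank, so it cannot be a proper flat.\<close>
  have rim_not_flat: "e ` rim \<notin> flats M"
  proof
    assume "e ` rim \<in> flats M"
    moreover have "e ` rim \<subset> ground M"
    proof -
      have "d 0 \<notin> e ` rim" using d_neq_e[OF n_pos] by auto
      then show ?thesis using e_ground d_ground[OF n_pos] by auto
    qed
    ultimately show False
      using flat_rank_less[of "e ` rim" "ground M"] rank_rim rk_eq by (simp add: rk_def)
  qed
  have flats: "F \<in> flats M \<longleftrightarrow> closed F \<and> flat_word (\<lambda>k. k \<noteq> 0) (word F)" for F
  proof
    assume "F \<in> flats M"
    then show "closed F \<and> flat_word (\<lambda>k. k \<noteq> 0) (word F)"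
      using rim_not_flat flat_closed not_rim_iff[OF assms(1)] by blast
  next
    assume *: "closed F \<and> flat_word (\<lambda>k. k \<noteq> 0) (word F)"
    then have F: "closed F" "F \<noteq> e ` rim" using not_rim_iff[OF assms(1)] by auto
    have fl: "cl F \<in> flats M" by (rule cl_flat[OF closed_subset[OF F(1)]])
    then have "cl F = F" using rim_not_flat by (intro cl_eq_of_not_rim[OF assms(1) F]) auto
    then show "F \<in> flats M" using fl by simp
  qed
  have "KL_poly M = cyc_scan fan_poly whirl_poly 0 (replicate n New)"
  proof (rule KL_poly_of_words[OF flats, where corank = "corank_word (\<lambda>k. k)"])
    show "rank_of M F + corank_word (\<lambda>k. k) (word F) = n" if "F \<in> flats M" for F
      using that flats rank_not_rim[OF assms(1)] not_rim_iff[OF assms(1)] by (simp add: corank_word_def)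
    show "cyc_scan fan_poly whirl_poly 0 (replicate n Spoke) = 1"
      by (rule cyc_scan_replicate_Spoke) (use n_pos in auto)
    show "2 * degree (cyc_scan fan_poly whirl_poly 0 C) < corank_word (\<lambda>k. k) C"
      if "corank_word (\<lambda>k. k) C > 0" for C
      using that degree_cyc_scan_fan[of C whirl_poly] degree_whirl_poly[of "num_new C"]
      by (cases "Spoke \<in> set C") (auto simp: corank_word_def cyc_scan_no_spoke)
    show "(\<Sum>C\<in>{C \<in> up A. flat_word (\<lambda>k. k \<noteq> 0) C}. reverse_poly (corank_word (\<lambda>k. k) C) (cyc_scan fan_poly whirl_poly 0 C))
      = (\<Sum>C\<in>{C \<in> up A. flat_word (\<lambda>k. k \<noteq> 0) C}. T ^ (corank_word (\<lambda>k. k) A - corank_word (\<lambda>k. k) C) * cyc_scan fan_poly whirl_poly 0 C)"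
      if "length A = n" "flat_word (\<lambda>k. k \<noteq> 0) A" for A
    proof -
      have "(\<Sum>k\<le>Suc m. of_nat (Suc m choose k) *
          (if k \<noteq> 0 then T ^ (Suc m - k) * whirl_poly k - reverse_poly k (whirl_poly k) else 0))
        = (1 - T) * square_binomial_poly m" for m
      proof -
        have "(\<Sum>k\<le>Suc m. of_nat (Suc m choose k) *
          (if k \<noteq> 0 then T ^ (Suc m - k) * whirl_poly k - reverse_poly k (whirl_poly k) else 0))
          = (\<Sum>k\<le>Suc m. of_nat (Suc m choose k) * T ^ (Suc m - k) * whirl_poly k
            - of_nat (Suc m choose k) * rev_weight whirl_poly k)"
          by (intro sum.cong) (auto simp: rev_weight_def algebra_simps)
        then show ?thesis using whirl_identity[of m]
          unfolding reverse_binomial_transform[OF degree_whirl_poly_le]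
          by (simp add: binomial_transform_def sum_subtractf del: sum.atMost_Suc)
      qed
      then show ?thesis
        using sum_cyc_scan_palindromic[of "\<lambda>k. k \<noteq> 0" "\<lambda>k. k" whirl_poly A] that n_pos assms(1)
        unfolding up_def by fastforce
    qed
  qed
  then show ?thesis by (simp add: cyc_scan_no_spoke)
qed

text \<open>Exactly one vertex is \<open>New\<close>, so the rank formula gives
  \<open>n - 1\<close>, which is also the number of elements.\<close>

lemma rim_minus:
  assumes cyclic and j: "j \<in> rim"
  shows "closed (e ` rim - {e j})" "Spoke \<notin> set (word (e ` rim - {e j}))"
    "num_new (word (e ` rim - {e j})) = 1" "rank_of M (e ` rim - {e j}) = n - 1"
    "e ` rim - {e j} \<in> indeps M"
proof -
  let ?F = "e ` rim - {e j}"
  have jn: "j < n" "nx j < n" using rim_less[OF j] succ_mod_less by auto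
  show c: "closed ?F"
    using d_neq_e rim_less succ_mod_less e_ground by (auto simp: closed_def)
  show "Spoke \<notin> set (word ?F)" using d_neq_e by (auto simp: Spoke_in_word)
  have tok: "tok ?F i = (if i = nx j then New else Glue)" if "i < n" for i
  proof -
    have "pv i \<in> rim" using assms(1) that pred_mod_in_rim by simp
    moreover have "pv i = j \<longleftrightarrow> i = nx j" using that succ_pred_mod pred_succ_mod[OF jn(1)] by metis
    moreover have "d i \<notin> ?F" using d_neq_e[OF that] by auto
    ultimately show ?thesis using e_eq_iff[of "pv i" j] j by (auto simp: tok_def)
  qed
  have "{i. i < n \<and> tok ?F i = New} = {nx j}" using tok jn by (auto split: if_splits)
  then show one: "num_new (word ?F) = 1" by (simp add: num_new_word)
  have "tok ?F (nx j) \<noteq> Glue" using tok[OF jn(2)] by simp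
  from rank_closed[OF c jn(2) this] show r: "rank_of M ?F = n - 1" using one by simp
  have "card (e ` rim) = n" using inj_e assms(1) by (simp add: card_image rim_def)
  then have "card ?F = n - 1" using j by (simp add: card_Diff_singleton)
  moreover have "finite ?F" by (simp add: rim_def)
  ultimately show "?F \<in> indeps M" using r indep_iff_rank by simp
qed

text \<open>The closure of the rim minus an edge contains no spoke: it is that set itself or the
  whole rim. So any spoke raises the rank; this is the exchange condition for relaxing the
  rim.\<close>

lemma rim_minus_insert_spoke:
  assumes cyclic and j: "j \<in> rim" and y: "y \<in> ground M - e ` rim"
  shows "insert y (e ` rim - {e j}) \<in> indeps M"
proof -
  let ?F = "e ` rim - {e j}"
  note F = rim_minus[OF assms(1) j]
  obtain i where i: "i < n" "y = d i" using y ground_cases[of y] by auto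
  have FE: "?F \<subseteq> ground M" by (rule closed_subset[OF F(1)])
  have "y \<notin> cl ?F"
  proof
    assume yc: "y \<in> cl ?F"
    then have "cl ?F \<noteq> e ` rim" using y by auto
    moreover have "?F \<noteq> e ` rim" using j by auto
    ultimately have "cl ?F = ?F" by (intro cl_eq_of_not_rim[OF assms(1) F(1)])
    then show False using yc y by auto
  qed
  then have "rank_of M (insert y ?F) \<noteq> n - 1" using y F(4) by (simp add: cl_def)
  then have "n \<le> rank_of M (insert y ?F)" using rank_mono[OF subset_insertI, of ?F y] F(4) by linarith
  moreover have fin: "finite ?F" by (simp add: rim_def)
  moreover have "card (insert y ?F) = n"
    using rank_indep[OF F(5)] F(4) y fin n_pos by simp
  ultimately show ?thesis using rank_le_card[of "insert y ?F"] indep_iff_rank[of "insert y ?F"] by simp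
qed

lemma rank_rim:
  assumes cyclic "e ` rim \<notin> indeps M" shows "rank_of M (e ` rim) = n - 1"
proof -
  have card_rim: "card (e ` rim) = n" using inj_e assms(1) by (simp add: card_image rim_def)
  have fin: "finite (e ` rim)" by (simp add: rim_def)
  have 0: "0 \<in> rim" using assms(1) n_pos by (simp add: rim_def)
  have "n - 1 \<le> rank_of M (e ` rim)"
    using rim_minus(4)[OF assms(1) 0] rank_mono[of "e ` rim - {e 0}" "e ` rim"] by auto
  moreover have "rank_of M (e ` rim) \<le> n" using rank_le_card[OF fin] card_rim by simp
  moreover have "rank_of M (e ` rim) \<noteq> n" using indep_iff_rank[OF fin] card_rim assms(2) by simp
  ultimately show ?thesis by linarith
qed

lemma KL_poly_wheel:
  assumes cyclic and dep: "e ` rim \<notin> indeps M"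
  shows "KL_poly M = wheel_poly n"
proof -
  \<comment> \<open>Index 0 stands for the rim, a flat of corank 1 whose contraction has polynomial
    1, whereas \<open>wheel_poly 0\<close> is 0.\<close>
  define v where "v k = (if k = 0 then 1 else wheel_poly k)" for k
  define c :: "nat \<Rightarrow> nat" where "c k = (if k = 0 then 1 else k)" for k
  let ?ok = "\<lambda>k::nat. k \<noteq> 1"
  have n3: "n \<ge> 3" using cyclic_n assms(1) by simp
  note rank_rim = rank_rim[OF assms]
  have wr: "Spoke \<notin> set (word (e ` rim))" "num_new (word (e ` rim)) = 0"
    using word_rim[OF assms(1)] num_new_replicate_Glue by auto
  have rim_ground: "e ` rim \<subseteq> ground M" using e_ground by auto
  \<comment> \<open>A larger closure would still have rank \<open>n - 1\<close>, hence one
    \<open>New\<close>, but passing to a larger set never increases the number of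
    \<open>New\<close>, which is 0 for the rim.\<close>
  have flat_rim: "cl (e ` rim) = e ` rim"
  proof (rule ccontr)
    let ?K = "cl (e ` rim)"
    assume ne: "?K \<noteq> e ` rim"
    have "num_new (word ?K) = 1"
      using rank_not_rim[OF assms(1) cl_closed[OF rim_ground] ne] rank_cl[OF rim_ground] rank_rim n3 by simp
    moreover have "word ?K \<in> up (word (e ` rim))"
      using word_in_up_iff[OF closed_rim cl_closed[OF rim_ground]] subset_cl[OF rim_ground] by simp
    then have "word ?K \<in> cyc_ups (word (e ` rim))" unfolding up_def using assms(1) by simp
    ultimately show False using num_new_cyc_ups[of "word ?K" "word (e ` rim)"] wr by simp
  qed
  have sub_rim: "F \<subseteq> e ` rim \<longleftrightarrow> Spoke \<notin> set (word F)" if "closed F" for F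
  proof
    assume "F \<subseteq> e ` rim"
    then show "Spoke \<notin> set (word F)" using d_neq_e by (auto simp: Spoke_in_word)
  next
    assume "Spoke \<notin> set (word F)"
    then show "F \<subseteq> e ` rim" using ground_cases closed_subset[OF that] by (auto simp: Spoke_in_word) blast
  qed
  have flats: "F \<in> flats M \<longleftrightarrow> closed F \<and> flat_word ?ok (word F)" for F
  proof
    assume F: "F \<in> flats M"
    have cF: "closed F" by (rule flat_closed[OF F])
    show "closed F \<and> flat_word ?ok (word F)"
    proof (rule ccontr)
      assume "\<not> ?thesis"
      \<comment> \<open>A spokeless set with one segment already has the rank of the rim that
        properly contains it, so it is not a flat.\<close>
      then have *: "Spoke \<notin> set (word F)" "num_new (word F) = 1" using cF by (auto simp: flat_word_def)
      then have ne: "F \<noteq> e ` rim" using wr by auto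
      then have "F \<subset> e ` rim" using * sub_rim[OF cF] by auto
      moreover have "rank_of M F = n - 1" using rank_not_rim[OF assms(1) cF ne] * by auto
      ultimately show False using flat_rank_less[OF F rim_ground] rank_rim by simp
    qed
  next
    assume *: "closed F \<and> flat_word ?ok (word F)"
    then have F: "closed F" by simp
    have FE: "F \<subseteq> ground M" by (rule closed_subset[OF F])
    show "F \<in> flats M"
    proof (cases "F = e ` rim")
      case True
      then show ?thesis using flat_rim cl_flat[OF rim_ground] by simp
    next
      case False
      have "cl F \<noteq> e ` rim"
      proof
        assume K: "cl F = e ` rim"
        then have "F \<subseteq> e ` rim" using subset_cl[OF FE] by simp
        moreover have "num_new (word F) = 1"
          using rank_not_rim[OF assms(1) F False] rank_cl[OF FE] K rank_rim n3 by simp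
        ultimately show False using * sub_rim[OF F] by (simp add: flat_word_def)
      qed
      then have "cl F = F" by (rule cl_eq_of_not_rim[OF assms(1) F False])
      then show ?thesis using cl_flat[OF FE] by simp
    qed
  qed
  have "KL_poly M = cyc_scan fan_poly v 0 (replicate n New)"
  proof (rule KL_poly_of_words[OF flats, where corank = "corank_word c"])
    show "rank_of M F + corank_word c (word F) = n" if "F \<in> flats M" for F
    proof (cases "F = e ` rim")
      case True
      then show ?thesis using wr rank_rim n3 by (simp add: corank_word_def c_def)
    next
      case False
      have cF: "closed F" by (rule flat_closed[OF that])
      show ?thesis
        using rank_not_rim[OF assms(1) cF False] not_rim_iff[OF assms(1) cF] False
        by (auto simp: corank_word_def c_def flat_word_def)
    qed
    show "cyc_scan fan_poly v 0 (replicate n Spoke) = 1"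
      by (rule cyc_scan_replicate_Spoke) (use n_pos in auto)
    show "2 * degree (cyc_scan fan_poly v 0 C) < corank_word c C"
      if "corank_word c C > 0" for C
      using that degree_cyc_scan_fan[of C v] degree_wheel_poly[of "num_new C"]
      by (cases "Spoke \<in> set C") (auto simp: corank_word_def cyc_scan_no_spoke v_def c_def)
    show "(\<Sum>C\<in>{C \<in> up A. flat_word ?ok C}. reverse_poly (corank_word c C) (cyc_scan fan_poly v 0 C))
      = (\<Sum>C\<in>{C \<in> up A. flat_word ?ok C}. T ^ (corank_word c A - corank_word c C) * cyc_scan fan_poly v 0 C)"
      if "length A = n" "flat_word ?ok A" for A
    proof -
      have id: "(\<Sum>k\<le>Suc m. of_nat (Suc m choose k) *
          (if k \<noteq> 1 then T ^ (Suc m - c k) * v k - reverse_poly (c k) (v k) else 0))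
        = (1 - T) * square_binomial_poly m" if "Suc m \<noteq> 1" for m
      proof -
        have "(\<Sum>k\<le>Suc m. of_nat (Suc m choose k) *
          (if k \<noteq> 1 then T ^ (Suc m - c k) * v k - reverse_poly (c k) (v k) else 0))
          = (\<Sum>k\<le>Suc m. of_nat (Suc m choose k) * (if k = 0 then T ^ (Suc m - 1) - T else if k = 1 then 0
            else T ^ (Suc m - k) * wheel_poly k - rev_weight wheel_poly k))"
          by (intro sum.cong) (auto simp: rev_weight_def c_def v_def T_def)
        then show ?thesis using wheel_identity[of "Suc m" m] that by simp
      qed
      have "up A = cyc_ups A" unfolding up_def using assms(1) by simp
      then show ?thesis
        using sum_cyc_scan_palindromic[of ?ok c v A, OF _ _ id that(2)] that(1) n_pos
        by (auto simp: c_def v_def)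
    qed
  qed
  then show ?thesis using n_pos by (simp add: cyc_scan_no_spoke v_def)
qed

end

section \<open>Fans, squares of paths, wheels and whirls\<close>

lemma not_forest_triangle:
  assumes "a \<noteq> b" "b \<noteq> c" "a \<noteq> c" "{a, b} \<in> A" "{b, c} \<in> A" "{a, c} \<in> A"
  shows "\<not> forest A"
proof -
  have "is_cycle A [a, b, c]"
    unfolding is_cycle_def
  proof (intro conjI allI impI)
    fix i assume "i < length [a, b, c]"
    then consider "i = 0" | "i = 1" | "i = 2" by fastforce
    then show "{[a, b, c] ! i, [a, b, c] ! (Suc i mod length [a, b, c])} \<in> A"
      using assms by cases (auto simp: insert_commute)
  qed (use assms in auto)
  then show ?thesis by (auto simp: forest_def)
qed

lemma adjacency_rtrancl_cases: "(u, v) \<in> (adjacency A)\<^sup>* \<Longrightarrow> u = v \<or> v \<in> \<Union> A"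
  by (induction rule: rtrancl_induct) (auto simp: adjacency_def)

lemma independent_insert_leaf:
  assumes "edge_closure.independent A" "u \<noteq> v" "v \<notin> \<Union> A"
  shows "edge_closure.independent (insert {u, v} A)"
proof (rule ccontr)
  assume "\<not> ?thesis"
  then have "{u, v} \<in> edge_closure A" using edge_closure.in_cl_of_dependent assms(1) by blast
  then show False using adjacency_rtrancl_cases[of u v A] assms(2,3) by (simp add: doubleton_in_edge_closure)
qed

text \<open>Each edge brings an end \<open>v i\<close> absent from all earlier edges, so edges are
  attached as leaves.\<close>

lemma forest_growing:
  fixes u v :: "nat \<Rightarrow> 'v"
  assumes "\<And>i. i < n \<Longrightarrow> u i \<noteq> v i"
    and "\<And>i j. j < i \<Longrightarrow> i < n \<Longrightarrow> v i \<noteq> u j \<and> v i \<noteq> v j"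
  shows "forest ((\<lambda>i. {u i, v i}) ` {..<n})"
proof -
  have "edge_closure.independent ((\<lambda>i. {u i, v i}) ` {..<k})" if "k \<le> n" for k
    using that
  proof (induction k)
    case 0
    then show ?case by (simp add: edge_closure.independent_def)
  next
    case (Suc k)
    have "v k \<notin> \<Union> ((\<lambda>i. {u i, v i}) ` {..<k})" using assms(2)[of _ k] Suc.prems by auto
    then show ?case
      using independent_insert_leaf[of "(\<lambda>i. {u i, v i}) ` {..<k}" "u k" "v k"] Suc assms(1)[of k]
      by (simp add: lessThan_Suc)
  qed
  then show ?thesis using assms(1) by (subst forest_iff_independent) (auto simp: card_2_iff)
qed

lemma forest_two_edges:
  assumes "u \<noteq> v" "w \<noteq> x" "x \<noteq> u" "x \<noteq> v"
  shows "forest {{u, v}, {w, x}}"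
proof -
  have "edge_closure.independent (insert {w, x} (insert {u, v} {}))"
    using assms by (intro independent_insert_leaf) (auto simp: edge_closure.independent_def)
  then show ?thesis using assms by (subst forest_iff_independent) (auto simp: insert_commute card_2_iff)
qed

lemma rk_ge_of_forest:
  assumes "loopless_matroid (graphic_matroid G)" "inj_on f {..<n}" "f ` {..<n} \<subseteq> edges G" "forest (f ` {..<n})"
  shows "n \<le> rk (graphic_matroid G)"
proof -
  interpret is_matroid "graphic_matroid G" using assms(1) by (rule matroid_of_loopless)
  have "f ` {..<n} \<in> indeps (graphic_matroid G)" "f ` {..<n} \<subseteq> ground (graphic_matroid G)"
    using assms by (auto simp: graphic_matroid_def)
  then show ?thesis using card_le_rank[of "f ` {..<n}" "ground (graphic_matroid G)"] assms(2)
    by (simp add: card_image rk_def)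
qed

text \<open>The conditions on \<open>u\<close> and \<open>v\<close> make the edges
  \<open>d i\<close> a forest, which yields the lower bound on the rank; the remaining axioms
  concern single triangles only.\<close>

lemma triangle_chain_graphic:
  fixes G :: "nat ugraph" and d e :: "nat \<Rightarrow> nat set"
  assumes n: "0 < n" "cyclic \<Longrightarrow> 3 \<le> n" and rim: "rim = {..<if cyclic then n else n - 1}"
    and edges: "edges G = d ` {..<n} \<union> e ` rim"
    and inj: "inj_on d {..<n}" "inj_on e rim" and de: "\<And>i j. i < n \<Longrightarrow> j \<in> rim \<Longrightarrow> d i \<noteq> e j"
    and d: "\<And>i. i < n \<Longrightarrow> d i = {u i, v i}" "\<And>i. i < n \<Longrightarrow> u i \<noteq> v i"
    and grow: "\<And>i j. j < i \<Longrightarrow> i < n \<Longrightarrow> v i \<noteq> u j \<and> v i \<noteq> v j"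
    and triangle: "\<And>i. i \<in> rim \<Longrightarrow> \<exists>a b c. a \<noteq> b \<and> b \<noteq> c \<and> a \<noteq> c \<and> d i = {a, b} \<and> e i = {b, c}
      \<and> d (succ_mod n i) = {a, c}"
  shows "triangle_chain (graphic_matroid G) n d e cyclic rim"
proof -
  have card: "card a = 2" if "a \<in> edges G" for a
    using that d triangle unfolding edges by (fastforce simp: card_2_iff)
  have fin: "finite (edges G)" unfolding edges rim by auto
  have ll: "loopless_matroid (graphic_matroid G)" by (rule loopless_graphic_matroid[OF fin card])
  interpret is_matroid "graphic_matroid G" using ll by (rule matroid_of_loopless)
  have star: "forest (d ` {..<n})"
  proof -
    have "forest ((\<lambda>i. {u i, v i}) ` {..<n})" by (rule forest_growing) (use d(2) grow in auto)
    moreover have "(\<lambda>i. {u i, v i}) ` {..<n} = d ` {..<n}" using d(1) by force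
    ultimately show ?thesis by simp
  qed
  have sub: "d i \<in> edges G" "e i \<in> edges G" "d (succ_mod n i) \<in> edges G" if "i \<in> rim" for i
  proof -
    have "i < n" using that rim by (auto split: if_splits)
    then show "d i \<in> edges G" "e i \<in> edges G" "d (succ_mod n i) \<in> edges G"
      using that edges succ_mod_less[of i n] by auto
  qed
  have pairs: "{d i, e i} \<in> indeps (graphic_matroid G)"
    "{d i, d (succ_mod n i)} \<in> indeps (graphic_matroid G)"
    "{e i, d (succ_mod n i)} \<in> indeps (graphic_matroid G)"
    "{d i, e i, d (succ_mod n i)} \<notin> indeps (graphic_matroid G)" if i: "i \<in> rim" for i
  proof -
    obtain a b c where abc: "a \<noteq> b" "b \<noteq> c" "a \<noteq> c" "d i = {a, b}" "e i = {b, c}" "d (succ_mod n i) = {a, c}"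
      using triangle[OF i] by blast
    have "forest {{a, b}, {b, c}}" "forest {{a, b}, {a, c}}" "forest {{b, c}, {c, a}}"
      by (rule forest_two_edges; use abc in auto)+
    then show "{d i, e i} \<in> indeps (graphic_matroid G)"
      "{d i, d (succ_mod n i)} \<in> indeps (graphic_matroid G)"
      "{e i, d (succ_mod n i)} \<in> indeps (graphic_matroid G)"
      using sub[OF i] abc(4-6) by (auto simp: graphic_matroid_def insert_commute)
    show "{d i, e i, d (succ_mod n i)} \<notin> indeps (graphic_matroid G)"
      using not_forest_triangle[OF abc(1-3), of "{d i, e i, d (succ_mod n i)}"] abc(4-6)
      by (auto simp: graphic_matroid_def)
  qed
  show ?thesis
  proof
    show "n \<le> rk (graphic_matroid G)"
      using rk_ge_of_forest[OF ll inj(1) _ star] edges by auto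
    show "ground (graphic_matroid G) = d ` {..<n} \<union> e ` rim" by (simp add: graphic_matroid_def edges)
  qed (use n rim ll inj de pairs in auto)
qed

lemma KL_poly_fan: "n \<ge> 1 \<Longrightarrow> KL_poly (graphic_matroid (fan_graph n)) = fan_poly n"
proof -
  assume n: "n \<ge> 1"
  let ?d = "\<lambda>i::nat. {0, i + 1}" and ?e = "\<lambda>i::nat. {i + 1, i + 2}"
  interpret triangle_chain "graphic_matroid (fan_graph n)" n ?d ?e False "{..<n - 1}"
  proof (rule triangle_chain_graphic[where u = "\<lambda>_. 0" and v = "\<lambda>i. i + 1"])
    show "edges (fan_graph n) = ?d ` {..<n} \<union> ?e ` {..<n - 1}"
    proof -
      have "{{i, i + 1} |i. 1 \<le> i \<and> i < n} = ?e ` {..<n - 1}"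
      proof (intro equalityI subsetI)
        fix x assume "x \<in> {{i, i + 1} |i. 1 \<le> i \<and> i < n}"
        then obtain i where "x = {i, i + 1}" "1 \<le> i" "i < n" by auto
        then show "x \<in> ?e ` {..<n - 1}" by (intro image_eqI[of _ _ "i - 1"]) auto
      qed force
      moreover have "{{0, i} |i. 1 \<le> i \<and> i \<le> n} = ?d ` {..<n}"
      proof (intro equalityI subsetI)
        fix x assume "x \<in> {{0, i} |i. 1 \<le> i \<and> i \<le> n}"
        then obtain i where "x = {0, i}" "1 \<le> i" "i \<le> n" by auto
        then show "x \<in> ?d ` {..<n}" by (intro image_eqI[of _ _ "i - 1"]) auto
      qed force
      ultimately show ?thesis by (auto simp: fan_graph_def)
    qed
    show "\<exists>a b c. a \<noteq> b \<and> b \<noteq> c \<and> a \<noteq> c \<and> ?d i = {a, b} \<and> ?e i = {b, c} \<and> ?d (succ_mod n i) = {a, c}"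
      if "i \<in> {..<n - 1}" for i
      using that by (intro exI[of _ 0] exI[of _ "i + 1"] exI[of _ "i + 2"]) (auto simp: succ_mod_def)
  qed (use n in \<open>auto simp: inj_on_def doubleton_eq_iff\<close>)
  show ?thesis by (rule KL_poly_linear) simp
qed

text \<open>Path edges play the role of spokes and edges of length two that of the rim: the triangle
  on \<open>i + 1\<close>, \<open>i + 2\<close>, \<open>i + 3\<close> shares the path edge
  \<open>{i + 2, i + 3}\<close> with the next one.\<close>

lemma KL_poly_path_square: "n \<ge> 1 \<Longrightarrow> KL_poly (graphic_matroid (path_square (n + 1))) = fan_poly n"
proof -
  assume n: "n \<ge> 1"
  let ?d = "\<lambda>i::nat. {i + 1, i + 2}" and ?e = "\<lambda>i::nat. {i + 1, i + 3}"
  interpret triangle_chain "graphic_matroid (path_square (n + 1))" n ?d ?e False "{..<n - 1}"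
  proof (rule triangle_chain_graphic[where u = "\<lambda>i. i + 1" and v = "\<lambda>i. i + 2"])
    show "edges (path_square (n + 1)) = ?d ` {..<n} \<union> ?e ` {..<n - 1}"
    proof (intro equalityI subsetI)
      fix x assume "x \<in> edges (path_square (n + 1))"
      then obtain i j where ij: "x = {i, j}" "i \<in> {1..n + 1}" "j \<in> {1..n + 1}"
        "1 \<le> \<bar>int i - int j\<bar>" "\<bar>int i - int j\<bar> \<le> 2" unfolding path_square_def by auto
      have "\<exists>a b. x = {a, b} \<and> 1 \<le> a \<and> b \<le> n + 1 \<and> (b = a + 1 \<or> b = a + 2)"
      proof (cases "i < j")
        case True
        then show ?thesis using ij by (intro exI[of _ i] exI[of _ j]) auto
      next
        case False
        then show ?thesis using ij by (intro exI[of _ j] exI[of _ i]) auto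
      qed
      then obtain a b where ab: "x = {a, b}" "1 \<le> a" "b \<le> n + 1" "b = a + 1 \<or> b = a + 2" by blast
      show "x \<in> ?d ` {..<n} \<union> ?e ` {..<n - 1}"
        using ab(4)
      proof
        assume "b = a + 1"
        then show ?thesis using ab by (intro UnI1 image_eqI[of _ _ "a - 1"]) auto
      next
        assume "b = a + 2"
        then show ?thesis using ab by (intro UnI2 image_eqI[of _ _ "a - 1"]) auto
      qed
    next
      fix x assume "x \<in> ?d ` {..<n} \<union> ?e ` {..<n - 1}"
      then consider i where "i < n" "x = ?d i" | i where "i < n - 1" "x = ?e i" by auto
      then show "x \<in> edges (path_square (n + 1))"
      proof cases
        case (1 i)
        then show ?thesis unfolding path_square_def
          by (simp, intro exI[of _ "i + 1"] exI[of _ "i + 2"]) auto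
      next
        case (2 i)
        then show ?thesis unfolding path_square_def
          by (simp, intro exI[of _ "i + 1"] exI[of _ "i + 3"]) auto
      qed
    qed
    show "\<exists>a b c. a \<noteq> b \<and> b \<noteq> c \<and> a \<noteq> c \<and> ?d i = {a, b} \<and> ?e i = {b, c} \<and> ?d (succ_mod n i) = {a, c}"
      if "i \<in> {..<n - 1}" for i
      using that by (intro exI[of _ "i + 2"] exI[of _ "i + 1"] exI[of _ "i + 3"]) (auto simp: succ_mod_def)
  qed (use n in \<open>auto simp: inj_on_def doubleton_eq_iff\<close>)
  show ?thesis by (rule KL_poly_linear) simp
qed

definition wheel_spoke :: "nat \<Rightarrow> nat set" where
  "wheel_spoke i = {0, i + 1}"

definition wheel_rim :: "nat \<Rightarrow> nat \<Rightarrow> nat set" where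
  "wheel_rim n i = {i + 1, succ_mod n i + 1}"

lemma outer_cycle_eq: "n \<ge> 1 \<Longrightarrow> outer_cycle n = wheel_rim n ` {..<n}"
proof (intro equalityI subsetI)
  fix x assume n: "n \<ge> 1" and "x \<in> outer_cycle n"
  then consider i where "x = {i, i + 1}" "1 \<le> i" "i < n" | "x = {n, 1}" by (auto simp: outer_cycle_def)
  then show "x \<in> wheel_rim n ` {..<n}"
  proof cases
    case 1
    then show ?thesis by (intro image_eqI[of _ _ "i - 1"]) (auto simp: wheel_rim_def succ_mod_def)
  next
    case 2
    then show ?thesis using n by (intro image_eqI[of _ _ "n - 1"]) (auto simp: wheel_rim_def succ_mod_def)
  qed
next
  fix x assume n: "n \<ge> 1" and "x \<in> wheel_rim n ` {..<n}"
  then obtain i where i: "i < n" "x = wheel_rim n i" by auto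
  show "x \<in> outer_cycle n"
  proof (cases "Suc i = n")
    case True
    then show ?thesis using i by (auto simp: outer_cycle_def wheel_rim_def succ_mod_def)
  next
    case False
    then show ?thesis using i unfolding outer_cycle_def
      by (intro UnI1 CollectI exI[of _ "i + 1"]) (auto simp: wheel_rim_def succ_mod_def)
  qed
qed

text \<open>This keeps distinct rim edges distinct; for \<open>n = 2\<close> the two would
  coincide.\<close>

lemma succ_mod_twice_neq: "n \<ge> 3 \<Longrightarrow> i < n \<Longrightarrow> succ_mod n (succ_mod n i) \<noteq> i"
  by (cases "Suc i = n"; cases "Suc (Suc i) = n") (auto simp: succ_mod_def)

lemma succ_mod_neq: "n \<ge> 3 \<Longrightarrow> i < n \<Longrightarrow> succ_mod n i \<noteq> i"
  by (cases "Suc i = n") (auto simp: succ_mod_def)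

lemma wheel_rim_eq_iff:
  "n \<ge> 3 \<Longrightarrow> i < n \<Longrightarrow> j < n \<Longrightarrow> wheel_rim n i = wheel_rim n j \<longleftrightarrow> i = j"
  using succ_mod_twice_neq[of n i] by (auto simp: wheel_rim_def doubleton_eq_iff)

lemma triangle_chain_wheel:
  assumes n: "n \<ge> 3"
  shows "triangle_chain (graphic_matroid (wheel_graph n)) n wheel_spoke (wheel_rim n) True {..<n}"
proof (rule triangle_chain_graphic[where u = "\<lambda>_. 0" and v = "\<lambda>i. i + 1"])
  show "edges (wheel_graph n) = wheel_spoke ` {..<n} \<union> wheel_rim n ` {..<n}"
  proof -
    have "{{0, i} |i. 1 \<le> i \<and> i \<le> n} = wheel_spoke ` {..<n}"
    proof (intro equalityI subsetI)
      fix x assume "x \<in> {{0, i} |i. 1 \<le> i \<and> i \<le> n}"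
      then obtain i where "x = {0, i}" "1 \<le> i" "i \<le> n" by auto
      then show "x \<in> wheel_spoke ` {..<n}"
        by (intro image_eqI[of _ _ "i - 1"]) (auto simp: wheel_spoke_def)
    qed (force simp: wheel_spoke_def)
    then show ?thesis using outer_cycle_eq[of n] n by (auto simp: wheel_graph_def)
  qed
  show "\<exists>a b c. a \<noteq> b \<and> b \<noteq> c \<and> a \<noteq> c \<and> wheel_spoke i = {a, b} \<and> wheel_rim n i = {b, c}
      \<and> wheel_spoke (succ_mod n i) = {a, c}" if "i \<in> {..<n}" for i
    using that n succ_mod_neq[of n i]
    by (intro exI[of _ 0] exI[of _ "i + 1"] exI[of _ "succ_mod n i + 1"])
      (auto simp: wheel_spoke_def wheel_rim_def)
  show "inj_on (wheel_rim n) {..<n}" using wheel_rim_eq_iff[OF n] by (auto simp: inj_on_def)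
qed (use n in \<open>auto simp: inj_on_def doubleton_eq_iff wheel_spoke_def wheel_rim_def\<close>)

lemma not_forest_outer_cycle:
  assumes "n \<ge> 3" shows "\<not> forest (outer_cycle n)"
proof -
  have "is_cycle (outer_cycle n) [1..<n + 1]"
    unfolding is_cycle_def
  proof (intro conjI allI impI)
    fix i assume "i < length [1..<n + 1]"
    then have i: "i < n" "Suc i mod n < n" using assms by auto
    have "{[1..<n + 1] ! i, [1..<n + 1] ! (Suc i mod length [1..<n + 1])} = wheel_rim n i"
      using i by (simp add: wheel_rim_def succ_mod_def nth_upt del: upt_Suc)
    then show "{[1..<n + 1] ! i, [1..<n + 1] ! (Suc i mod length [1..<n + 1])} \<in> outer_cycle n"
      using i assms outer_cycle_eq[of n] by auto
  qed (use assms in auto)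
  then show ?thesis by (auto simp: forest_def)
qed

lemma KL_poly_wheel_graph:
  assumes n: "n \<ge> 3" shows "KL_poly (graphic_matroid (wheel_graph n)) = wheel_poly n"
proof -
  interpret triangle_chain "graphic_matroid (wheel_graph n)" n wheel_spoke "wheel_rim n" True "{..<n}"
    by (rule triangle_chain_wheel[OF n])
  show ?thesis
    using not_forest_outer_cycle[OF n] outer_cycle_eq[of n] n
    by (intro KL_poly_wheel) (auto simp: graphic_matroid_def)
qed

text \<open>The whirl relaxes the wheel at its rim. Independent sets are only added, and triangles
  stay dependent because they contain a spoke and so differ from the rim.\<close>

lemma triangle_chain_whirl:
  assumes n: "n \<ge> 3"
  shows "triangle_chain (whirl_matroid n) n wheel_spoke (wheel_rim n) True {..<n}"
proof -
  let ?W = "graphic_matroid (wheel_graph n)"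
  interpret W: triangle_chain ?W n wheel_spoke "wheel_rim n" True "{..<n}"
    by (rule triangle_chain_wheel[OF n])
  have O: "outer_cycle n = wheel_rim n ` {..<n}" using n by (intro outer_cycle_eq) auto
  have whirl: "whirl_matroid n = \<lparr>ground = ground ?W, indeps = indeps ?W \<union> {outer_cycle n}\<rparr>"
    by (auto simp: whirl_matroid_def graphic_matroid_def)
  have card: "card (outer_cycle n) = n" unfolding O using W.inj_e by (simp add: card_image)
  have mat: "is_matroid (whirl_matroid n)"
    unfolding whirl
  proof (rule W.matroid_relaxation)
    show "outer_cycle n \<subseteq> ground ?W" unfolding O using W.e_ground by auto
    show "outer_cycle n \<noteq> {}" by (simp add: outer_cycle_def)
    show "outer_cycle n - {x} \<in> indeps ?W" if "x \<in> outer_cycle n" for x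
      using that W.rim_minus(5) unfolding O by auto
    show "insert y (outer_cycle n - {x}) \<in> indeps ?W"
      if "x \<in> outer_cycle n" "y \<in> ground ?W - outer_cycle n" for x y
      using that W.rim_minus_insert_spoke unfolding O by auto
    show "rk ?W \<le> card (outer_cycle n)" using card W.rk_eq by simp
  qed
  interpret is_matroid "whirl_matroid n" by (rule mat)
  have ind: "indeps ?W \<subseteq> indeps (whirl_matroid n)" and gr: "ground (whirl_matroid n) = ground ?W"
    by (auto simp: whirl)
  have spoke: "wheel_spoke i \<notin> outer_cycle n" if "i < n" for i using W.d_neq_e[OF that] unfolding O by auto
  show ?thesis
  proof
    show "loopless_matroid (whirl_matroid n)"
      using W.loopless mat ind gr unfolding loopless_matroid_def by auto
    show "n \<le> rk (whirl_matroid n)"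
      using card_le_rank[of "outer_cycle n" "ground (whirl_matroid n)"] card
        indeps_subset_ground[of "outer_cycle n"] by (simp add: rk_def whirl)
    show "{wheel_spoke i, wheel_rim n i, wheel_spoke (succ_mod n i)} \<notin> indeps (whirl_matroid n)"
      if "i \<in> {..<n}" for i
      using W.triangle[OF that] spoke[of i] that by (auto simp: whirl)
  qed (use n W.inj_d W.inj_e W.d_neq_e W.ground_eq W.pair1 W.pair2 W.pair3 ind gr in auto)
qed

lemma KL_poly_whirl_matroid:
  assumes n: "n \<ge> 3" shows "KL_poly (whirl_matroid n) = whirl_poly n"
proof -
  interpret triangle_chain "whirl_matroid n" n wheel_spoke "wheel_rim n" True "{..<n}"
    by (rule triangle_chain_whirl[OF n])
  show ?thesis
    using outer_cycle_eq[of n] n by (intro KL_poly_whirl) (auto simp: whirl_matroid_def)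
qed

section \<open>Comparison with multinomial coefficients\<close>

lemma map_poly_eq_sum_monom:
  assumes "\<And>k. k \<le> N \<Longrightarrow> rat_of_int (coeff p k) = f k" "\<And>k. k > N \<Longrightarrow> coeff p k = 0"
  shows "map_poly rat_of_int p = (\<Sum>k = 0..N. monom (f k) k)"
proof (rule poly_eqI)
  fix j
  have "coeff (\<Sum>k = 0..N. monom (f k) k) j = (\<Sum>k = 0..N. if k = j then f k else 0)"
    by (simp add: coeff_sum)
  then show "coeff (map_poly rat_of_int p) j = coeff (\<Sum>k = 0..N. monom (f k) k) j"
    using assms by (auto simp: coeff_map_poly not_le)
qed

lemma fan_poly_formula:
  assumes "n \<ge> 1"
  shows "map_poly rat_of_int (fan_poly n) = (\<Sum>k = 0..(n - 1) div 2.
    monom (1 / (of_nat k + 1) * multinomial3 (n - 1) k k (n - 2 * k - 1)) k)"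
proof (rule map_poly_eq_sum_monom)
  obtain m where n: "n = Suc m" using assms by (cases n) auto
  show "coeff (fan_poly n) k = 0" if "k > (n - 1) div 2" for k
    using that by (auto simp: n coeff_fan_poly binomial_eq_0)
  fix k assume k: "k \<le> (n - 1) div 2"
  have "rat_of_nat (m choose (2 * k)) = fact m / (fact (2 * k) * fact (m - 2 * k))"
    using k n by (subst binomial_fact) auto
  then show "rat_of_int (coeff (fan_poly n) k) = 1 / (of_nat k + 1) * multinomial3 (n - 1) k k (n - 2 * k - 1)"
    by (simp add: n coeff_fan_poly of_int_catalan multinomial3_def add.commute)
qed

lemma whirl_coeff_formula:
  assumes "2 * k < n"
  shows "rat_of_int (coeff (whirl_poly n) k)
    = of_nat n / (of_nat n - of_nat k) * multinomial3 (n - 1) k k (n - 2 * k - 1)"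
proof -
  obtain m where m: "n = 2 * k + Suc m" using assms less_imp_Suc_add by fastforce
  have 1: "rat_of_nat (n choose k) = fact n / (fact k * fact (n - k))"
    using m by (subst binomial_fact) auto
  have 2: "rat_of_nat (n - k - 1 choose k) = fact (n - k - 1) / (fact k * fact m)"
    using m by (subst binomial_fact) auto
  have f: "(fact (n - k) :: rat) = of_nat (n - k) * fact (n - k - 1)" "(fact n :: rat) = of_nat n * fact (n - 1)"
    using m by (intro fact_reduce; simp)+
  have s: "(of_nat n - of_nat k :: rat) = of_nat (n - k)" "n - 2 * k - 1 = m" "of_nat (n - k) \<noteq> (0 :: rat)"
    using m by (auto simp: of_nat_diff)
  show ?thesis
    unfolding s(1,2) multinomial3_def coeff_whirl_poly using m 1 2 f s(3) by simp
qed

lemma whirl_poly_formula: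
  assumes "n \<ge> 1"
  shows "map_poly rat_of_int (whirl_poly n) = (\<Sum>k = 0..(n - 1) div 2.
    monom (of_nat n / (of_nat n - of_nat k) * multinomial3 (n - 1) k k (n - 2 * k - 1)) k)"
proof (rule map_poly_eq_sum_monom)
  show "coeff (whirl_poly n) k = 0" if "k > (n - 1) div 2" for k
    using that assms degree_whirl_poly[of n] by (intro coeff_eq_0) linarith
  show "rat_of_int (coeff (whirl_poly n) k)
    = of_nat n / (of_nat n - of_nat k) * multinomial3 (n - 1) k k (n - 2 * k - 1)" if "k \<le> (n - 1) div 2" for k
    using that assms by (intro whirl_coeff_formula) linarith
qed

text \<open>The first fraction is the whirl coefficient; the other two, with opposite sign, come
  from the two products in \<open>relaxation_coeff\<close>.\<close>

lemma wheel_poly_formula: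
  assumes "n \<ge> 1"
  shows "map_poly rat_of_int (wheel_poly n) = (\<Sum>k = 0..(n - 1) div 2.
    monom (((of_nat k + 1) / (of_nat n - of_nat k) + of_nat k / (of_nat n - of_nat k + 1)
      - of_nat k / (of_nat n - of_nat k - 1)) * multinomial3 n k (k + 1) (n - 2 * k - 1)) k)"
proof (rule map_poly_eq_sum_monom)
  show "coeff (wheel_poly n) k = 0" if "k > (n - 1) div 2" for k
    using that assms degree_wheel_poly[of n] by (intro coeff_eq_0) linarith
  fix k assume "k \<le> (n - 1) div 2"
  then have "2 * k < n" using assms by linarith
  then obtain m where m: "n = 2 * k + Suc m" using less_imp_Suc_add by fastforce
  let ?M = "multinomial3 n k (k + 1) (n - 2 * k - 1)"
  let ?r = "of_nat n - of_nat k :: rat"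
  have r: "?r = of_nat (k + Suc m)" using m by simp
  have W: "rat_of_int (coeff (whirl_poly n) k) = (of_nat k + 1) / ?r * ?M"
  proof -
    have "multinomial3 (n - 1) k k (n - 2 * k - 1) * of_nat n = (of_nat k + 1) * ?M"
      using m by (simp add: multinomial3_def fact_reduce[of n] add_eq_0_iff mult_ac add_ac)
    then show ?thesis using whirl_coeff_formula[OF \<open>2 * k < n\<close>] by (simp add: mult.commute)
  qed
  have R: "rat_of_int (coeff (relaxation_poly n) k) = (of_nat k / (?r - 1) - of_nat k / (?r + 1)) * ?M"
  proof (cases k)
    case 0
    then show ?thesis by (simp add: coeff_relaxation_poly relaxation_coeff_def)
  next
    case (Suc j)
    \<comment> \<open>With \<open>k = Suc j\<close> the truncated subtractions become sums in
      \<open>j\<close> and \<open>m\<close>.\<close>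
    have n: "n = 2 * j + m + 3" using m Suc by simp
    have "rat_of_nat ((n choose Suc k) * (n - k - 2 choose (k - 1))) = of_nat k / (?r - 1) * ?M"
    proof -
      have "rat_of_nat (n choose Suc k) = fact n / (fact (Suc k) * fact (j + m + 1))"
        using n Suc by (subst binomial_fact) auto
      moreover have "rat_of_nat (n - k - 2 choose (k - 1)) = fact (j + m) / (fact j * fact m)"
        using n Suc by (subst binomial_fact) auto
      moreover have "(fact (j + m + 1) :: rat) = of_nat (j + m + 1) * fact (j + m)" by simp
      moreover have "?r - 1 = of_nat (j + m + 1)" using r Suc by simp
      moreover have "(fact k :: rat) = of_nat k * fact j" using Suc by simp
      moreover have "(of_nat k :: rat) \<noteq> 0" "(of_nat (j + m + 1) :: rat) \<noteq> 0" using Suc by simp_all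
      moreover have "n - 2 * k - 1 = m" using m by simp
      ultimately show ?thesis
        unfolding multinomial3_def by (simp del: fact_Suc of_nat_Suc of_nat_add add: Suc_eq_plus1[symmetric])
    qed
    moreover have "rat_of_nat ((n choose (k - 1)) * (n - k choose Suc k)) = of_nat k / (?r + 1) * ?M"
    proof -
      have "rat_of_nat (n choose (k - 1)) = fact n / (fact j * fact (j + m + 3))"
        using n Suc by (subst binomial_fact) (auto simp: add.assoc)
      moreover have "rat_of_nat (n - k choose Suc k) = fact (j + m + 2) / (fact (Suc k) * fact m)"
        using n Suc by (subst binomial_fact) (auto simp: add.commute)
      moreover have "(fact (j + m + 3) :: rat) = of_nat (j + m + 3) * fact (j + m + 2)"
        using fact_Suc[of "j + m + 2"] by (simp add: eval_nat_numeral)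
      moreover have "?r + 1 = of_nat (j + m + 3)" using r Suc by simp
      moreover have "(fact k :: rat) = of_nat k * fact j" using Suc by simp
      moreover have "(of_nat k :: rat) \<noteq> 0" "(of_nat (j + m + 3) :: rat) \<noteq> 0" using Suc by simp_all
      moreover have "n - 2 * k - 1 = m" using m by simp
      ultimately show ?thesis
        unfolding multinomial3_def by (simp del: fact_Suc of_nat_Suc of_nat_add add: Suc_eq_plus1[symmetric])
    qed
    ultimately show ?thesis
      using Suc n unfolding coeff_relaxation_poly relaxation_coeff_def
      by (simp only: of_int_diff of_int_of_nat_eq left_diff_distrib) simp
  qed
  show "rat_of_int (coeff (wheel_poly n) k) = ((of_nat k + 1) / ?r + of_nat k / (?r + 1) - of_nat k / (?r - 1)) * ?M"
    unfolding wheel_poly_def coeff_diff of_int_diff W R by (simp only: left_diff_distrib distrib_right add_diff_eq)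
qed

theorem theorem1p1:
  shows "(\<forall>n::nat. n \<ge> 1 \<longrightarrow>
      map_poly rat_of_int (KL_poly (graphic_matroid (fan_graph n))) =
        (\<Sum>k = 0..(n - 1) div 2.
           monom (1 / (of_nat k + 1) * multinomial3 (n - 1) k k (n - 2 * k - 1)) k)) \<and>
    (\<forall>n::nat. n \<ge> 1 \<longrightarrow>
      map_poly rat_of_int (KL_poly (graphic_matroid (path_square (n + 1)))) =
        (\<Sum>k = 0..(n - 1) div 2.
           monom (1 / (of_nat k + 1) * multinomial3 (n - 1) k k (n - 2 * k - 1)) k)) \<and>
    (\<forall>n::nat. n \<ge> 3 \<longrightarrow>
      map_poly rat_of_int (KL_poly (graphic_matroid (wheel_graph n))) =
        (\<Sum>k = 0..(n - 1) div 2.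
           monom (((of_nat k + 1) / (of_nat n - of_nat k)
                    + of_nat k / (of_nat n - of_nat k + 1)
                    - of_nat k / (of_nat n - of_nat k - 1))
                  * multinomial3 n k (k + 1) (n - 2 * k - 1)) k)) \<and>
    (\<forall>n::nat. n \<ge> 3 \<longrightarrow>
      map_poly rat_of_int (KL_poly (whirl_matroid n)) =
        (\<Sum>k = 0..(n - 1) div 2.
           monom (of_nat n / (of_nat n - of_nat k) * multinomial3 (n - 1) k k (n - 2 * k - 1)) k))"
  by (intro conjI allI impI) (simp_all only: KL_poly_fan KL_poly_path_square KL_poly_wheel_graph KL_poly_whirl_matroid
    fan_poly_formula wheel_poly_formula whirl_poly_formula order_trans[of 1 3, simplified])

end
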